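(* Let $k_1,\dots,k_t$ be distinct positive integers, $\mathbf k=(k_1,\dots,k_t)$, $K=\sum_jk_j$. For $P\ge2$ and $\boldsymbol\alpha\in(\mathbb R/\mathbb Z)^t$ let $f(\boldsymbol\alpha)=\sum_{p\le P}(\log p)\,e(\sum_{j=1}^t\alpha_jp^{k_j})$ (sum over primes). Let $\delta>0$ be a fixed (sufficiently small) constant and $Q=P^\delta$. For $q<Q$ and integers $1\le a_j\le q$ with $\gcd(a_1,\dots,a_t,q)=1$ let $\mathfrak M(\mathbf a,q;Q)=\{\boldsymbol\alpha:|\alpha_j-a_j/q|\le Q/(qP^{k_j})\ (1\le j\le t)\}$, let $\mathfrak M(Q)$ be their union and $\mathfrak m(Q)=(\mathbb R/\mathbb Z)^t\setminus\mathfrak M(Q)$. If $s\ge 2s_\varepsilon(\mathbf k)+1$, then for some constant $\varepsilon>0$, \[ \int_{\mathfrak m(Q)}|f(\boldsymbol\alpha)|^s\,d\boldsymbol\alpha\ll P^{s-K-\varepsilon}. \]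
   Context: $e(\alpha)=e^{2\pi i\alpha}$. $J_{\ell,\mathbf k}(P)$ is the number of integral solutions of $\sum_{i=1}^\ell x_i^{k_j}=\sum_{i=1}^\ell y_i^{k_j}$ ($1\le j\le t$) with $1\le x_i,y_i\le P$; for a fixed small $\varepsilon>0$, $s_\varepsilon(\mathbf k)$ is the least integer $\ell$ with $J_{\ell,\mathbf k}(P)\ll P^{2\ell-K+\varepsilon}$. *)

theory Defs
  imports "HOL-Analysis.Analysis" "HOL-Computational_Algebra.Primes"
begin

text \<open>The exponents \<open>k\<^sub>1, \<dots>, k\<^sub>t\<close> are a function \<open>k\<close> on a finite index type \<open>'t\<close>
  with \<open>t = CARD('t)\<close>.\<close>

definition add_char :: "real \<Rightarrow> complex" where
  "add_char x = exp (2 * of_real pi * \<i> * of_real x)"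

definition exponent_sum :: "('t::finite \<Rightarrow> nat) \<Rightarrow> nat" where
  "exponent_sum k = (\<Sum>j\<in>UNIV. k j)"

text \<open>Solutions are pairs of extensional functions on \<open>{..<l}\<close>, so that each \<open>l\<close>-tuple is
  represented exactly once and \<open>card\<close> counts solutions.\<close>

definition num_solutions :: "nat \<Rightarrow> ('t::finite \<Rightarrow> nat) \<Rightarrow> real \<Rightarrow> nat" where
  "num_solutions l k P =
     card {(x, y). x \<in> {..<l} \<rightarrow>\<^sub>E {n::nat. 1 \<le> n \<and> real n \<le> P} \<and>
                   y \<in> {..<l} \<rightarrow>\<^sub>E {n::nat. 1 \<le> n \<and> real n \<le> P} \<and>
                   (\<forall>j. (\<Sum>i<l. x i ^ k j) = (\<Sum>i<l. y i ^ k j))}"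

text \<open>The least \<open>l\<close> for which the mean value bound holds; an infimum in \<^typ>\<open>enat\<close>, hence
  \<open>\<infinity>\<close> rather than an unspecified number should there be no such \<open>l\<close>. The implied constant
  may depend on \<open>k\<close>, \<open>\<epsilon>\<close> and \<open>l\<close>, but not on \<open>P\<close>.\<close>

definition s_eps :: "real \<Rightarrow> ('t::finite \<Rightarrow> nat) \<Rightarrow> enat" where
  "s_eps \<epsilon> k =
     Inf {enat l | l. \<exists>C. \<forall>P\<ge>2. real (num_solutions l k P)
                        \<le> C * P powr (2 * real l - real (exponent_sum k) + \<epsilon>)}"

definition prime_exp_sum :: "('t::finite \<Rightarrow> nat) \<Rightarrow> real \<Rightarrow> real ^ 't \<Rightarrow> complex" where
  "prime_exp_sum k P \<alpha> =
     (\<Sum>p | prime p \<and> real p \<le> P. of_real (ln (real p)) * add_char (\<Sum>j\<in>UNIV. \<alpha> $ j * real p ^ k j))"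

text \<open>The torus \<open>(\<real>/\<int>)\<^sup>t\<close> is represented by its fundamental domain \<open>[0,1)\<^sup>t\<close> with Lebesgue
  measure. The inequalities defining a major arc are between classes modulo 1, so some integer
  translate has to satisfy them; for \<open>q = 1\<close>, \<open>a\<^sub>j = 1\<close> the arc surrounds \<open>0\<close>.\<close>

definition torus :: "(real ^ 't::finite) set" where
  "torus = {\<alpha>. \<forall>j. 0 \<le> \<alpha> $ j \<and> \<alpha> $ j < 1}"

definition major_arc ::
    "('t::finite \<Rightarrow> nat) \<Rightarrow> real \<Rightarrow> ('t \<Rightarrow> nat) \<Rightarrow> nat \<Rightarrow> real \<Rightarrow> (real ^ 't) set" where
  "major_arc k P a q Q =
     {\<alpha>\<in>torus. \<forall>j. \<exists>m::int. \<bar>\<alpha> $ j - real (a j) / real q - of_int m\<bar> \<le> Q / (real q * P ^ k j)}"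

definition major_arcs :: "('t::finite \<Rightarrow> nat) \<Rightarrow> real \<Rightarrow> real \<Rightarrow> (real ^ 't) set" where
  "major_arcs k P Q =
     \<Union> {major_arc k P a q Q | a q.
          1 \<le> q \<and> real q < Q \<and> (\<forall>j. 1 \<le> a j \<and> a j \<le> q) \<and> Gcd (insert q (range a)) = 1}"

definition minor_arcs :: "('t::finite \<Rightarrow> nat) \<Rightarrow> real \<Rightarrow> real \<Rightarrow> (real ^ 't) set" where
  "minor_arcs k P Q = torus - major_arcs k P Q"

end

theory Submission
  imports Defs "HOL-Number_Theory.Prime_Powers" "HOL-Computational_Algebra.Squarefree"
begin

text \<open>With \<open>l = s\<^sub>\<epsilon>(k)\<close>, take out \<open>s - 2l \<ge> 1\<close> factors of \<open>sup |f|\<close> over the minor arcs;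
  by orthogonality the remaining \<open>2l\<close>-th moment is at most \<open>(log P)\<^bsup>2l\<^esup> J(P)\<close>. So a power
  saving in \<open>sup |f|\<close> beats the loss \<open>P\<^sup>\<epsilon>\<close> once \<open>\<epsilon>\<close> is small.

  For the supremum, \<open>|f(\<alpha>)| \<ge> P / T\<close> with \<open>T\<close> a small power of \<open>P\<close> is shown to yield a single
  \<open>q \<le> T\<^sup>C\<close> with all \<open>q \<alpha>\<^sub>j\<close> within \<open>T\<^sup>C P\<^bsup>-k_j\<^esup>\<close> of integers. In Vaughan's identity with
  small cut-offs, the type I sums fall to Weyl's inequality for all coefficients at once. In the
  type II sums, Cauchy-Schwarz and Weyl make \<open>q \<alpha>\<^sub>j (m\<^bsup>k_j\<^esup> - m'\<^bsup>k_j\<^esup>)\<close> nearly integral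
  for many \<open>m\<close>, and a polynomial that is nearly integral that often has coefficients close to
  rationals of small denominator. Weyl's inequality and this recurrence statement are proved by
  induction on the degree through differencing, all constants being absorbed into powers of
  \<open>T \<ge> 2\<close>.\<close>

section \<open>Distance to the nearest integer\<close>

text \<open>The major arcs ask for one denominator below \<open>P powr \<delta>\<close> shared by
  all coordinates, whereas differencing and Cauchy-Schwarz produce a denominator for each shift
  \<open>h\<close> or each \<open>m\<close>. Hence a recurring pattern: among the at most
  \<open>T\<close> possible multipliers keep the most popular one, and pay a factor \<open>T\<close>
  in density. No exponent is optimised. Each analytic result says that some exponent
  \<open>C\<close>, depending on the degree or on \<open>k\<close> only, serves every admissible
  \<open>T\<close>; such statements compose, since \<open>T\<close> may be replaced by a power of
  \<open>T\<close>. In the end \<open>T = P powr \<eta>\<close> with \<eta> a small multiple of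
  \<delta>, so that all accumulated powers of \<open>T\<close> stay within
  \<open>P powr \<delta>\<close>. This is why every \<delta> below 1 can be treated, at the price of
  a saving \<eta> that depends on \<delta>. The linear coefficient enters the differences only
  through their constant term, so differencing loses it. It has to be recovered from the
  undifferenced data each time: by linear recurrence in the counting problem, by averaging over
  shifts in the Weyl sum.\<close>

definition near :: "real \<Rightarrow> real \<Rightarrow> bool" where
  "near e x \<longleftrightarrow> (\<exists>a::int. \<bar>x - of_int a\<bar> \<le> e)"

lemma near_mono: "near e x \<Longrightarrow> e \<le> e' \<Longrightarrow> near e' x"
  unfolding near_def by (meson order_trans)

lemma near_trivial: "1 \<le> e \<Longrightarrow> near e x"
  unfolding near_def by (rule exI[of _ "\<lfloor>x\<rfloor>"]) linarith

lemma near_add: assumes "near e x" "near e' y" shows "near (e + e') (x + y)"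
proof -
  obtain a b :: int where "\<bar>x - of_int a\<bar> \<le> e" "\<bar>y - of_int b\<bar> \<le> e'"
    using assms unfolding near_def by blast
  then have "\<bar>(x + y) - of_int (a + b)\<bar> \<le> e + e'" by simp
  then show ?thesis unfolding near_def by blast
qed

lemma near_minus: assumes "near e x" shows "near e (- x)"
proof -
  obtain a :: int where "\<bar>x - of_int a\<bar> \<le> e"
    using assms unfolding near_def by blast
  then have "\<bar>- x - of_int (- a)\<bar> \<le> e" by simp
  then show ?thesis unfolding near_def by blast
qed

lemma near_diff: "near e x \<Longrightarrow> near e' y \<Longrightarrow> near (e + e') (x - y)"
  using near_add[of e x e' "- y"] near_minus[of e' y] by simp

lemma near_mult: assumes "near e x" shows "near (real n * e) (real n * x)"
proof -
  obtain a :: int where "\<bar>x - of_int a\<bar> \<le> e"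
    using assms unfolding near_def by blast
  then have "real n * \<bar>x - of_int a\<bar> \<le> real n * e" by (simp add: mult_left_mono)
  then have "\<bar>real n * x - of_int (int n * a)\<bar> \<le> real n * e"
    by (simp add: abs_mult flip: right_diff_distrib)
  then show ?thesis unfolding near_def by blast
qed

lemma near_mult_le: "near e x \<Longrightarrow> real n * e \<le> e' \<Longrightarrow> near e' (real n * x)"
  using near_mult near_mono by blast

lemma near_sum:
  "finite A \<Longrightarrow> (\<And>i. i \<in> A \<Longrightarrow> near (e i) (x i)) \<Longrightarrow> near (\<Sum>i\<in>A. e i) (\<Sum>i\<in>A. x i)"
proof (induction A rule: finite_induct)
  case empty
  then show ?case by (auto simp: near_def intro: exI[of _ 0])
next
  case (insert a A)
  then show ?case using near_add[of "e a" "x a"] by simp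
qed

lemma near_nonneg: "near e x \<Longrightarrow> 0 \<le> e"
  unfolding near_def using abs_ge_zero order_trans by blast

section \<open>Vinogradov's lemma on linear phases, and the pigeonhole principle for
  multipliers\<close>

lemma disjoint_translates_card:
  fixes H :: "nat set"
  assumes H: "H \<subseteq> {1..N}" and u: "\<And>i h. 1 \<le> i \<Longrightarrow> i \<le> n \<Longrightarrow> h \<in> H \<Longrightarrow> h + i * u \<notin> H"
  shows "(n + 1) * card H \<le> N + n * u"
proof -
  have fin: "finite H" using H finite_subset by blast
  have disj: "(\<lambda>h. h + i * u) ` H \<inter> (\<lambda>h. h + j * u) ` H = {}" if "i < j" "j \<le> n" for i j
  proof (rule ccontr)
    assume "\<not> ?thesis"
    then obtain h h' where h: "h \<in> H" "h' \<in> H" "h + i * u = h' + j * u" by auto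
    then have "h = h' + (j - i) * u" using that by (simp add: diff_mult_distrib)
    moreover have "1 \<le> j - i" "j - i \<le> n" using that by auto
    ultimately show False using u[of "j - i" h'] h by auto
  qed
  have "card (\<Union>i\<in>{0..n}. (\<lambda>h. h + i * u) ` H) = (\<Sum>i\<in>{0..n}. card ((\<lambda>h. h + i * u) ` H))"
  proof (rule card_UN_disjoint)
    show "\<forall>i\<in>{0..n}. \<forall>j\<in>{0..n}. i \<noteq> j \<longrightarrow> (\<lambda>h. h + i * u) ` H \<inter> (\<lambda>h. h + j * u) ` H = {}"
      using disj by (metis atLeastAtMost_iff inf_commute nat_neq_iff)
  qed (use fin in auto)
  also have "\<dots> = (\<Sum>i\<in>{0..n}. card H)" by (intro sum.cong card_image) (auto simp: inj_on_def)
  also have "\<dots> = (n + 1) * card H" by simp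
  finally have "(n + 1) * card H = card (\<Union>i\<in>{0..n}. (\<lambda>h. h + i * u) ` H)" by simp
  also have "\<dots> \<le> card {1..N + n * u}"
  proof (rule card_mono)
    show "(\<Union>i\<in>{0..n}. (\<lambda>h. h + i * u) ` H) \<subseteq> {1..N + n * u}"
    proof
      fix x assume "x \<in> (\<Union>i\<in>{0..n}. (\<lambda>h. h + i * u) ` H)"
      then obtain i h where "i \<le> n" "h \<in> H" "x = h + i * u" by auto
      moreover have "i * u \<le> n * u" using \<open>i \<le> n\<close> by simp
      moreover have "1 \<le> h" "h \<le> N" using \<open>h \<in> H\<close> H by auto
      ultimately show "x \<in> {1..N + n * u}" by (auto intro: add_mono)
    qed
  qed auto
  finally show ?thesis by simp
qed

text \<open>Differences \<open>u\<close> of elements of \<open>H\<close> satisfy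
  \<open>near (2 * \<epsilon>) (real u * \<theta>)\<close>, and density supplies a difference
  \<open>r\<close> of size about \<open>T\<close>. Let \<beta> be the signed distance of
  \<open>r * \<theta>\<close> from an integer. Were \<beta> large, a small multiple of it would
  leave the window of radius \<open>2 * \<epsilon>\<close>, and the corresponding steps could not be
  differences of \<open>H\<close>, which contradicts the density. Thus closeness \<epsilon> improves
  to order \<open>T^2 * \<epsilon> / N\<close>.\<close>

lemma vinogradov_linear:
  fixes \<theta> \<gamma> \<epsilon> T :: real
  assumes H: "H \<subseteq> {1..N}" and card: "real (card H) \<ge> N / T" and T: "T \<ge> 2"
    and near: "\<And>h. h \<in> H \<Longrightarrow> near \<epsilon> (\<theta> * real h - \<gamma>)"
    and eps: "20 * \<epsilon> * T \<le> 1" and N: "3 * T \<le> real N"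
  shows "\<exists>r::nat. 1 \<le> r \<and> real r \<le> 3 * T \<and> near (36 * T^2 * \<epsilon> / N) (real r * \<theta>)"
proof -
  \<comment> \<open>\<open>n + 1\<close> translates of a set of density \<open>1 / T\<close> have
    total size above \<open>2 * N\<close>; both applications of
    \<open>disjoint_translates_card\<close> play against this.\<close>
  define n where "n = nat \<lceil>2 * T\<rceil>"
  have n: "2 * T \<le> real n" "real n \<le> 2 * T + 1" using T unfolding n_def by linarith+
  have fin: "finite H" using H finite_subset by blast
  have Npos: "real N > 0" using N T by linarith
  have "card H > 0" using card T Npos by (metis divide_pos_pos gr0I less_le_trans not_less of_nat_0 order_less_irrefl zero_less_numeral)
  then obtain h0 where "h0 \<in> H" by (metis card_gt_0_iff ex_in_conv)
  then have e0: "0 \<le> \<epsilon>" using near near_nonneg by blast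
  have diff: "near (2 * \<epsilon>) (real u * \<theta>)" if "h \<in> H" "h + u \<in> H" for h u
  proof -
    have "near (\<epsilon> + \<epsilon>) ((\<theta> * real (h + u) - \<gamma>) - (\<theta> * real h - \<gamma>))"
      by (intro near_diff near that)
    then show ?thesis by (simp add: algebra_simps)
  qed
  have big: "2 * real N < real ((n + 1) * card H)"
  proof -
    have "2 * real N = (2 * T) * (N / T)" using T by simp
    also have "\<dots> < (real n + 1) * (N / T)" using n T Npos by (intro mult_strict_right_mono) auto
    also have "\<dots> \<le> (real n + 1) * card H" using card by (intro mult_left_mono) auto
    finally show ?thesis by (simp add: algebra_simps)
  qed
  have "\<exists>i h. 1 \<le> i \<and> i \<le> n \<and> h \<in> H \<and> h + i * 1 \<in> H"
  proof (rule ccontr)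
    assume "\<not> ?thesis"
    then have "(n + 1) * card H \<le> N + n * 1" by (intro disjoint_translates_card[OF H]) blast
    then have "real ((n + 1) * card H) \<le> real (N + n)" by (metis mult_1_right of_nat_mono)
    then show False using big n N T by simp
  qed
  then obtain r where r: "1 \<le> r" "r \<le> n" "near (2 * \<epsilon>) (real r * \<theta>)" using diff by auto
  then obtain a :: int where a: "\<bar>real r * \<theta> - of_int a\<bar> \<le> 2 * \<epsilon>" unfolding near_def by blast
  define \<beta> where "\<beta> = real r * \<theta> - of_int a"
  have r3: "real r \<le> 3 * T" using r n T by linarith
  have "\<bar>\<beta>\<bar> \<le> 36 * T^2 * \<epsilon> / N"
  proof (cases "\<beta> = 0")
    case True
    then show ?thesis using e0 by simp
  next
    case False
    then have bp: "\<bar>\<beta>\<bar> > 0" by simp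
    \<comment> \<open>The least \<open>l\<close> for which \<open>l * \<bar>\<beta>\<bar>\<close>
      exceeds \<open>2 * \<epsilon>\<close>; since \<open>\<bar>\<beta>\<bar>\<close> itself is at
      most \<open>2 * \<epsilon>\<close>, the product does not exceed
      \<open>4 * \<epsilon>\<close>.\<close>
    define l where "l = nat (\<lfloor>2 * \<epsilon> / \<bar>\<beta>\<bar>\<rfloor> + 1)"
    have "0 \<le> 2 * \<epsilon> / \<bar>\<beta>\<bar>" using e0 bp by simp
    then have l1: "2 * \<epsilon> / \<bar>\<beta>\<bar> < real l" "real l \<le> 2 * \<epsilon> / \<bar>\<beta>\<bar> + 1" unfolding l_def by linarith+
    have l2: "2 * \<epsilon> < real l * \<bar>\<beta>\<bar>" using l1(1) bp by (simp add: field_simps)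
    have "real l * \<bar>\<beta>\<bar> \<le> (2 * \<epsilon> / \<bar>\<beta>\<bar> + 1) * \<bar>\<beta>\<bar>" using l1(2) bp by (intro mult_right_mono) auto
    also have "\<dots> = 2 * \<epsilon> + \<bar>\<beta>\<bar>" using bp by (simp add: field_simps)
    finally have l3: "real l * \<bar>\<beta>\<bar> \<le> 4 * \<epsilon>" using a \<beta>_def by linarith
    \<comment> \<open>For \<open>1 \<le> i \<le> n\<close> the number
      \<open>i * l * \<bar>\<beta>\<bar>\<close> lies strictly between \<open>2 * \<epsilon>\<close>
      and \<open>1 - 2 * \<epsilon>\<close>, because \<open>\<epsilon> * T\<close> is small. So no
      \<open>i * (r * l)\<close> is a difference of \<open>H\<close>, and counting forces
      \<open>n * r * l \<ge> N\<close>.\<close>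
    have "(n + 1) * card H \<le> N + n * (r * l)"
    proof (rule disjoint_translates_card[OF H], rule notI)
      fix i h assume i: "1 \<le> i" "i \<le> n" and h: "h \<in> H" "h + i * (r * l) \<in> H"
      have "near (2 * \<epsilon>) (real (i * (r * l)) * \<theta>)" using diff h by blast
      then obtain b :: int where b: "\<bar>real (i * (r * l)) * \<theta> - of_int b\<bar> \<le> 2 * \<epsilon>" unfolding near_def by blast
      have "real (i * (r * l)) * \<theta> = real (i * l) * \<beta> + of_int (int (i * l) * a)"
        unfolding \<beta>_def by (simp add: algebra_simps)
      then have b2: "\<bar>real (i * l) * \<beta> - of_int (b - int (i * l) * a)\<bar> \<le> 2 * \<epsilon>" using b by simp
      define c where "c = b - int (i * l) * a"
      have up: "real (i * l) * \<bar>\<beta>\<bar> \<le> (2 * T + 1) * (4 * \<epsilon>)"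
      proof -
        have "real (i * l) * \<bar>\<beta>\<bar> = real i * (real l * \<bar>\<beta>\<bar>)" by simp
        also have "\<dots> \<le> (2 * T + 1) * (4 * \<epsilon>)" using i n l3 T by (intro mult_mono[OF _ l3]) auto
        finally show ?thesis .
      qed
      have lo: "2 * \<epsilon> < real (i * l) * \<bar>\<beta>\<bar>"
      proof -
        have "1 * (real l * \<bar>\<beta>\<bar>) \<le> real i * (real l * \<bar>\<beta>\<bar>)" using i by (intro mult_right_mono) auto
        then show ?thesis using l2 by simp
      qed
      have ab: "\<bar>real (i * l) * \<beta>\<bar> = real (i * l) * \<bar>\<beta>\<bar>" by (simp add: abs_mult)
      have "\<epsilon> * 2 \<le> \<epsilon> * T" using T e0 by (intro mult_left_mono) auto
      then have "(2 * T + 1) * (4 * \<epsilon>) + 2 * \<epsilon> < 1"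
        using eps by (simp add: algebra_simps)
      then have "\<bar>of_int c :: real\<bar> < 1" using b2 up ab unfolding c_def[symmetric] by linarith
      then have "c = 0" by linarith
      then show False using b2 lo ab c_def by auto
    qed
    then have "real ((n + 1) * card H) \<le> real (N + n * (r * l))" using of_nat_mono by blast
    then have "real N \<le> real n * real r * real l" using big by simp
    then have "real N * \<bar>\<beta>\<bar> \<le> (real n * real r * real l) * \<bar>\<beta>\<bar>" by (intro mult_right_mono) auto
    also have "\<dots> = real n * real r * (real l * \<bar>\<beta>\<bar>)" by simp
    also have "\<dots> \<le> (3 * T) * (3 * T) * (4 * \<epsilon>)" using n T r3 l3 by (intro mult_mono[OF mult_mono l3]) auto
    finally show ?thesis using Npos by (simp add: field_simps power2_eq_square)
  qed
  then have "near (36 * T^2 * \<epsilon> / N) (real r * \<theta>)" unfolding near_def \<beta>_def by blast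
  then show ?thesis using r r3 by blast
qed

lemma const_le_power: fixes T :: real shows "T \<ge> 2 \<Longrightarrow> c \<le> 2 ^ k \<Longrightarrow> c \<le> T ^ k"
  by (meson order_trans power_mono zero_le_numeral)

lemma three_times_le_cube: fixes T :: real assumes "T \<ge> 2" shows "3 * T \<le> T ^ 3"
  using mult_right_mono[OF const_le_power[OF assms, of 3 2], of T] assms by (simp add: power3_eq_cube power2_eq_square)

lemma eight_square_le_power: fixes T :: real assumes "T \<ge> 2" shows "8 * T ^ 2 \<le> T ^ 5"
  using mult_right_mono[OF const_le_power[OF assms, of 8 3], of "T ^ 2"] by (simp flip: power_add)

text \<open>There are at most \<open>T\<close> candidates for \<open>q\<close>, so the most popular
  one serves a proportion \<open>1 / T\<close> of \<open>H\<close>.\<close>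

lemma pigeonhole_multiplier:
  fixes T :: real
  assumes "finite H" "T \<ge> 1" and ex: "\<And>h. h \<in> H \<Longrightarrow> \<exists>q::nat. 1 \<le> q \<and> real q \<le> T \<and> P h q"
  shows "\<exists>q::nat. 1 \<le> q \<and> real q \<le> T \<and> real (card H) / T \<le> real (card {h\<in>H. P h q})"
proof (rule ccontr)
  assume neg: "\<not> ?thesis"
  define n where "n = nat \<lfloor>T\<rfloor>"
  have n: "q \<le> n \<longleftrightarrow> real q \<le> T" for q using assms(2) unfolding n_def by linarith
  have lt: "real (card {h\<in>H. P h q}) < real (card H) / T" if "q \<in> {1..n}" for q
    using neg that n by (metis atLeastAtMost_iff not_le)
  have "H = (\<Union>q\<in>{1..n}. {h\<in>H. P h q})" using ex n by fastforce
  then have "card H = card (\<Union>q\<in>{1..n}. {h\<in>H. P h q})" by simp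
  also have "\<dots> \<le> (\<Sum>q\<in>{1..n}. card {h\<in>H. P h q})" by (rule card_UN_le) simp
  finally have "real (card H) \<le> (\<Sum>q\<in>{1..n}. real (card {h\<in>H. P h q}))"
    by (metis of_nat_mono of_nat_sum)
  also have "\<dots> < (\<Sum>q\<in>{1..n}. real (card H) / T)"
    using n[of 1] assms(2) lt by (intro sum_strict_mono) auto
  also have "\<dots> = real n * (real (card H) / T)" by simp
  also have "\<dots> \<le> T * (real (card H) / T)"
    using n[of n] assms(2) by (intro mult_right_mono) auto
  finally show False using assms(2) by simp
qed

section \<open>Recovering a polynomial p from the coefficients of p(n + h) - p(n), of which
  \<open>difference_coeff\<close> is the one at index \<open>i\<close>\<close>

definition difference_coeff :: "(nat \<Rightarrow> real) \<Rightarrow> nat \<Rightarrow> nat \<Rightarrow> nat \<Rightarrow> real" where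
  "difference_coeff c d h i = (\<Sum>j\<in>{i<..d}. real (j choose i) * real h ^ (j - i) * c j)"

text \<open>At scale \<open>N ^ i\<close> an error in the coefficient of index \<open>i\<close>
  costs at most \<epsilon> in the value at any \<open>n \<le> N\<close>. The constant coefficient is
  left out, because the inductive statements control only indices from 1 on.\<close>

definition near_difference_coeffs :: "(nat \<Rightarrow> real) \<Rightarrow> nat \<Rightarrow> nat \<Rightarrow> real \<Rightarrow> nat \<Rightarrow> nat \<Rightarrow> bool" where
  "near_difference_coeffs c d N \<epsilon> h q \<longleftrightarrow>
     (\<forall>i. 1 \<le> i \<and> i < d \<longrightarrow> near (\<epsilon> / real N ^ i) (real q * difference_coeff c d h i))"

text \<open>The lowest index \<open>a\<close> is 2 for what differences reveal, since
  \<open>c 1\<close> occurs in \<open>difference_coeff\<close> at index 0 only, and 1 once the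
  linear coefficient has been recovered.\<close>

abbreviation coeffs_approx :: "nat \<Rightarrow> nat \<Rightarrow> (nat \<Rightarrow> real) \<Rightarrow> nat \<Rightarrow> real \<Rightarrow> real \<Rightarrow> bool" where
  "coeffs_approx a d c N D e \<equiv> (\<exists>q::nat. 1 \<le> q \<and> real q \<le> D \<and>
     (\<forall>j. a \<le> j \<and> j \<le> d \<longrightarrow> near (e / real N ^ j) (real q * c j)))"

text \<open>Shaped for induction: \<open>m\<close> counts the leading coefficients already
  recovered, and all \<open>h\<close> share the multiplier \<open>q0\<close>. The error \<epsilon>
  may be large, provided it stays below \<open>N\<close> by a power of \<open>T\<close>.\<close>

definition fixed_multiplier_exponent :: "nat \<Rightarrow> nat \<Rightarrow> nat \<Rightarrow> bool" where
  "fixed_multiplier_exponent d m C \<longleftrightarrow> (\<forall>(c :: nat \<Rightarrow> real) N (T::real) \<epsilon> H (q0::nat). T \<ge> 2 \<longrightarrow> T ^ C \<le> real N \<longrightarrow> 0 \<le> \<epsilon> \<longrightarrow>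
     \<epsilon> * T ^ C \<le> real N \<longrightarrow> H \<subseteq> {1..N} \<longrightarrow> real N / T \<le> real (card H) \<longrightarrow> 1 \<le> q0 \<longrightarrow> real q0 \<le> T \<longrightarrow>
     (\<forall>h\<in>H. near_difference_coeffs c d N \<epsilon> h q0) \<longrightarrow>
     (\<exists>q::nat. 1 \<le> q \<and> real q \<le> T ^ C \<and> (\<forall>j. d - m < j \<and> 2 \<le> j \<and> j \<le> d \<longrightarrow> near (\<epsilon> * T ^ C / real N ^ j) (real q * c j))))"

text \<open>The coefficients \<open>c\<^sub>j\<close> are recovered from those of the differences from the top
  down: once the \<open>c\<^sub>j\<close> with \<open>j > e\<close> are close to rationals, the coefficient with \<open>i = e - 1\<close>
  is linear in \<open>h\<close> up to a negligible error.\<close>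

lemma differenced_coefficients_fixed_multiplier:
  "\<exists>C. fixed_multiplier_exponent d m C"
proof (induction m)
  case 0
  show ?case unfolding fixed_multiplier_exponent_def by (rule exI[of _ 0]) (auto intro: exI[of _ 1])
next
  case (Suc m)
  then obtain C where C0: "fixed_multiplier_exponent d m C" ..
  note C = C0[unfolded fixed_multiplier_exponent_def, rule_format]
  show ?case
  \<comment> \<open>In this case every index from 2 to \<open>d\<close> is covered already.\<close>
  proof (cases "d - m \<le> 1")
    case True
    then have "d - Suc m < j \<and> 2 \<le> j \<and> j \<le> d \<longleftrightarrow> d - m < j \<and> 2 \<le> j \<and> j \<le> d" for j by auto
    then show ?thesis using Suc unfolding fixed_multiplier_exponent_def by simp
  next
    case False
    define e where "e = d - m"
    define i where "i = e - 1"
    have ei: "e \<ge> 2" "e = Suc i" "i \<ge> 1" "i < d" "e \<le> d" using False unfolding e_def i_def by auto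
    \<comment> \<open>\<open>2 * d\<close> pays for the binomial coefficients and for the number of
      summands, each at most \<open>T ^ d\<close>; the remaining 10 pay for \<open>q0\<close>, for
      numerical constants and for the factor \<open>36 * T ^ 2\<close> of
      \<open>vinogradov_linear\<close>.\<close>
    define C' where "C' = C + 2 * d + 10"
    show ?thesis unfolding fixed_multiplier_exponent_def
    proof (rule exI[of _ C'], intro allI impI)
      fix c :: "nat \<Rightarrow> real" and N :: nat and T \<epsilon> :: real and H and q0 :: nat
      assume T: "T \<ge> 2" and N: "T ^ C' \<le> real N" and e0: "0 \<le> \<epsilon>" and eN: "\<epsilon> * T ^ C' \<le> real N"
        and H: "H \<subseteq> {1..N}" and cH: "real N / T \<le> real (card H)" and q0: "1 \<le> q0" "real q0 \<le> T"
        and hyp: "\<forall>h\<in>H. near_difference_coeffs c d N \<epsilon> h q0"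
      have Tp: "T ^ a \<le> T ^ b" if "a \<le> b" for a b using T that by (intro power_increasing) auto
      have T1: "1 \<le> T ^ a" for a using T by (simp add: one_le_power)
      have "T ^ C \<le> T ^ C'" by (rule Tp) (simp add: C'_def)
      moreover from this have "\<epsilon> * T ^ C \<le> \<epsilon> * T ^ C'" using e0 by (intro mult_left_mono)
      ultimately have "T ^ C \<le> real N" "\<epsilon> * T ^ C \<le> real N" using N eN by linarith+
      then have "\<exists>q::nat. 1 \<le> q \<and> real q \<le> T ^ C \<and> (\<forall>j. d - m < j \<and> 2 \<le> j \<and> j \<le> d \<longrightarrow> near (\<epsilon> * T ^ C / real N ^ j) (real q * c j))"
        using T e0 H cH q0 hyp by (intro C[of T N \<epsilon> H q0 c]) blast+
      then obtain q :: nat where q: "1 \<le> q" "real q \<le> T ^ C"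
        and qn0: "\<forall>j. d - m < j \<and> 2 \<le> j \<and> j \<le> d \<longrightarrow> near (\<epsilon> * T ^ C / real N ^ j) (real q * c j)" by blast
      have qn: "near (\<epsilon> * T ^ C / real N ^ j) (real q * c j)" if "e < j" "j \<le> d"
        for j using that qn0 ei unfolding e_def by auto
      have N1: "1 \<le> real N" using N T1[of C'] by linarith
      define \<epsilon>' where "\<epsilon>' = \<epsilon> * T ^ (C + 2 * d + 2) / real N ^ i"
      have dT: "real d \<le> T ^ d" using T by (rule const_le_power) (simp add: less_imp_le of_nat_less_two_power)
      \<comment> \<open>In the difference coefficient of index \<open>i = e - 1\<close> the summand
        \<open>j = e\<close> is \<open>e * h * c e\<close>, and those with \<open>j > e\<close> are
        controlled by the induction hypothesis. Subtracting them leaves a phase linear in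
        \<open>h\<close>.\<close>
      have near_h: "near \<epsilon>' ((real (q * q0 * e) * c e) * real h - 0)" if h: "h \<in> H" for h
      proof -
        have hN: "real h \<le> real N" using h H by auto
        have a1: "near (\<epsilon> * T ^ C / real N ^ i) (real q * (real q0 * (\<Sum>j\<in>{i<..d}. real (j choose i) * real h ^ (j - i) * c j)))"
        proof (rule near_mult_le)
          show "near (\<epsilon> / real N ^ i) (real q0 * (\<Sum>j\<in>{i<..d}. real (j choose i) * real h ^ (j - i) * c j))"
            using hyp h ei unfolding near_difference_coeffs_def difference_coeff_def by blast
          have "real q * (\<epsilon> / real N ^ i) \<le> T ^ C * (\<epsilon> / real N ^ i)" using q e0 by (intro mult_right_mono) auto
          then show "real q * (\<epsilon> / real N ^ i) \<le> \<epsilon> * T ^ C / real N ^ i" by (simp add: mult.commute)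
        qed
        have a2: "near (\<epsilon> * T ^ (C + d + 1) / real N ^ i) (real (q0 * (j choose i) * h ^ (j - i)) * (real q * c j))"
          if j: "j \<in> {e<..d}" for j
        proof (rule near_mult_le)
          show "near (\<epsilon> * T ^ C / real N ^ j) (real q * c j)" using qn j by auto
          have Nj: "real N ^ j = real N ^ (j - i) * real N ^ i"
            using j ei by (simp flip: power_add)
          have "real (j choose i) \<le> 2 ^ j" using binomial_le_pow2[of j i] by (metis of_nat_le_iff of_nat_numeral of_nat_power)
          also have "\<dots> \<le> 2 ^ d" using j by (intro power_increasing) auto
          also have "\<dots> \<le> T ^ d" using T by (intro power_mono) auto
          finally have b: "real (j choose i) \<le> T ^ d" .
          have "real (q0 * (j choose i) * h ^ (j - i)) \<le> T * T ^ d * real N ^ (j - i)"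
            using b q0 hN T by (simp, intro mult_mono power_mono) auto
          then have "real (q0 * (j choose i) * h ^ (j - i)) * (\<epsilon> * T ^ C / real N ^ j) \<le>
              (T * T ^ d * real N ^ (j - i)) * (\<epsilon> * T ^ C / real N ^ j)"
            using e0 T by (intro mult_right_mono) auto
          also have "\<dots> = \<epsilon> * T ^ (C + d + 1) / real N ^ i"
            using N1 by (simp add: Nj power_add)
          finally show "real (q0 * (j choose i) * h ^ (j - i)) * (\<epsilon> * T ^ C / real N ^ j) \<le> \<epsilon> * T ^ (C + d + 1) / real N ^ i" .
        qed
        have a3: "near (\<Sum>j\<in>{e<..d}. \<epsilon> * T ^ (C + d + 1) / real N ^ i) (\<Sum>j\<in>{e<..d}. real (q0 * (j choose i) * h ^ (j - i)) * (real q * c j))"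
          by (intro near_sum a2) auto
        have ins: "{i<..d} = insert e {e<..d}" using ei by auto
        have eq: "(real (q * q0 * e) * c e) * real h = real q * (real q0 * (\<Sum>j\<in>{i<..d}. real (j choose i) * real h ^ (j - i) * c j)) - (\<Sum>j\<in>{e<..d}. real (q0 * (j choose i) * h ^ (j - i)) * (real q * c j))"
          unfolding ins using ei by (simp add: algebra_simps sum_distrib_left)
        have "real (d - e) * (\<epsilon> * T ^ (C + d + 1) / real N ^ i) \<le> T ^ d * (\<epsilon> * T ^ (C + d + 1) / real N ^ i)"
          using dT e0 T by (intro mult_right_mono) auto
        then have "(\<Sum>j\<in>{e<..d}. \<epsilon> * T ^ (C + d + 1) / real N ^ i) \<le> \<epsilon> * T ^ (C + 2 * d + 1) / real N ^ i"
          by (simp add: power_add mult_ac power_mult power2_eq_square)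
        moreover have "\<epsilon> * T ^ C / real N ^ i \<le> \<epsilon> * T ^ (C + 2 * d + 1) / real N ^ i"
          using e0 Tp[of C "C + 2 * d + 1"] by (intro divide_right_mono mult_left_mono) auto
        ultimately have "\<epsilon> * T ^ C / real N ^ i + (\<Sum>j\<in>{e<..d}. \<epsilon> * T ^ (C + d + 1) / real N ^ i) \<le> 2 * (\<epsilon> * T ^ (C + 2 * d + 1) / real N ^ i)"
          by linarith
        also have "\<dots> \<le> T * (\<epsilon> * T ^ (C + 2 * d + 1) / real N ^ i)" using T e0 by (intro mult_right_mono) auto
        also have "\<dots> = \<epsilon>'" by (simp add: \<epsilon>'_def)
        finally have "\<epsilon> * T ^ C / real N ^ i + (\<Sum>j\<in>{e<..d}. \<epsilon> * T ^ (C + d + 1) / real N ^ i) \<le> \<epsilon>'" .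
        then show ?thesis using near_mono[OF near_diff[OF a1 a3]] eq by simp
      qed
      \<comment> \<open>Here \<open>i \<ge> 1\<close> matters: at least one factor
        \<open>1 / N\<close> is present, so \<epsilon> need not be small by itself. Weyl's
        inequality will use this with \<epsilon> a positive power of \<open>T\<close>.\<close>
      have "\<epsilon>' \<le> \<epsilon> * T ^ (C + 2 * d + 2) / real N"
        unfolding \<epsilon>'_def using N1 e0 T self_le_power[of "real N" i] ei by (intro divide_left_mono) auto
      then have "20 * \<epsilon>' * T \<le> 20 * (\<epsilon> * T ^ (C + 2 * d + 2) / real N) * T" using T by (intro mult_right_mono mult_left_mono) auto
      also have "\<dots> = (\<epsilon> * T ^ (C + 2 * d + 3) / real N) * 20" by (simp add: power_add power3_eq_cube power2_eq_square)
      also have "\<dots> \<le> (\<epsilon> * T ^ (C + 2 * d + 3) / real N) * T ^ 7"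
        using e0 T const_le_power[OF T, of 20 7] by (intro mult_left_mono) auto
      also have "\<dots> = \<epsilon> * T ^ C' / real N" by (simp add: C'_def add_ac flip: power_add)
      also have "\<dots> \<le> 1" using eN N1 by (simp add: divide_le_eq)
      finally have small: "20 * \<epsilon>' * T \<le> 1" .
      have T3: "3 * T \<le> T ^ 3" by (rule three_times_le_cube[OF T])
      have "T ^ 3 \<le> T ^ C'" by (rule Tp) (simp add: C'_def)
      then have "3 * T \<le> real N" using T3 N by linarith
      from vinogradov_linear[OF H cH T near_h small this]
      obtain r where r: "1 \<le> r" "real r \<le> 3 * T" "near (36 * T\<^sup>2 * \<epsilon>' / real N) (real r * (real (q * q0 * e) * c e))"
        by blast
      have r3: "real r \<le> T ^ 3" using r T3 by linarith
      have eT: "real e \<le> T ^ d" using dT ei by linarith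
      have mult: "real (r * q0 * e) \<le> T ^ (d + 4)"
      proof -
        have "real r * real q0 * real e \<le> T ^ 3 * T * T ^ d" using r3 q0 eT T by (intro mult_mono) auto
        then show ?thesis by (simp add: power_add eval_nat_numeral mult_ac)
      qed
      have qle: "real (r * q * q0 * e) \<le> T ^ C'"
      proof -
        have "real (r * q0 * e) * real q \<le> T ^ (d + 4) * T ^ C" using mult q T by (intro mult_mono) auto
        also have "\<dots> = T ^ (d + 4 + C)" by (simp add: power_add)
        also have "\<dots> \<le> T ^ C'" by (rule Tp) (simp add: C'_def)
        finally show ?thesis by (simp add: mult_ac)
      qed
      have nj: "near (\<epsilon> * T ^ C' / real N ^ j) (real (r * q * q0 * e) * c j)" if j: "d - Suc m < j" "2 \<le> j" "j \<le> d" for j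
      proof (cases "j = e")
        case True
        have "36 * T\<^sup>2 * \<epsilon>' / real N = (\<epsilon> * T ^ (C + 2 * d + 4) / real N ^ e) * 36"
          unfolding \<epsilon>'_def using ei by (simp add: power_add eval_nat_numeral mult_ac)
        also have "\<dots> \<le> (\<epsilon> * T ^ (C + 2 * d + 4) / real N ^ e) * T ^ 6"
          using e0 T const_le_power[OF T, of 36 6] by (intro mult_left_mono) auto
        also have "\<dots> = \<epsilon> * T ^ C' / real N ^ e" by (simp add: C'_def add_ac flip: power_add)
        finally show ?thesis using near_mono r(3) True by (simp add: mult_ac)
      next
        case False
        then have "e < j" using j ei by (simp add: e_def)
        have "near (\<epsilon> * T ^ C' / real N ^ j) (real (r * q0 * e) * (real q * c j))"
        proof (rule near_mult_le[OF qn])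
          have "real (r * q0 * e) * (\<epsilon> * T ^ C / real N ^ j) \<le> T ^ (d + 4) * (\<epsilon> * T ^ C / real N ^ j)"
            using mult e0 T by (intro mult_right_mono) auto
          also have "\<dots> = \<epsilon> * T ^ (d + 4 + C) / real N ^ j" by (simp add: power_add)
          also have "\<dots> \<le> \<epsilon> * T ^ C' / real N ^ j"
            using e0 by (intro divide_right_mono mult_left_mono Tp) (auto simp: C'_def)
          finally show "real (r * q0 * e) * (\<epsilon> * T ^ C / real N ^ j) \<le> \<epsilon> * T ^ C' / real N ^ j" .
        qed (use \<open>e < j\<close> j in auto)
        then show ?thesis by (simp add: mult_ac)
      qed
      have "0 < r * q * q0 * e" using r(1) q(1) q0(1) ei(1) by (intro mult_pos_pos) auto
      then have q1: "1 \<le> r * q * q0 * e" by simp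
      show "\<exists>q::nat. 1 \<le> q \<and> real q \<le> T ^ C' \<and> (\<forall>j. d - Suc m < j \<and> 2 \<le> j \<and> j \<le> d \<longrightarrow> near (\<epsilon> * T ^ C' / real N ^ j) (real q * c j))"
        using q1 qle nj by (intro exI[of _ "r * q * q0 * e"] conjI allI impI) simp_all
    qed
  qed
qed

definition differencing_exponent :: "nat \<Rightarrow> nat \<Rightarrow> bool" where
  "differencing_exponent d C \<longleftrightarrow> (\<forall>(c :: nat \<Rightarrow> real) N (T::real) \<epsilon> H. T \<ge> 2 \<longrightarrow> T ^ C \<le> real N \<longrightarrow> 0 \<le> \<epsilon> \<longrightarrow>
     \<epsilon> * T ^ C \<le> real N \<longrightarrow> H \<subseteq> {1..N} \<longrightarrow> real N / T \<le> real (card H) \<longrightarrow>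
     (\<forall>h\<in>H. \<exists>q::nat. 1 \<le> q \<and> real q \<le> T \<and> near_difference_coeffs c d N \<epsilon> h q) \<longrightarrow>
     (coeffs_approx 2 d c N (T ^ C) (\<epsilon> * T ^ C)))"

text \<open>After pigeonholing, one multiplier serves a subset of \<open>H\<close> of density
  \<open>1 / T ^ 2\<close> in \<open>{1..N}\<close>. The statement for a fixed multiplier is then
  applied with \<open>m = d\<close> and with \<open>T ^ 2\<close> for \<open>T\<close>, hence the
  exponent \<open>2 * C\<close>.\<close>

lemma differenced_coefficients:
  "\<exists>C. differencing_exponent d C"
proof -
  from differenced_coefficients_fixed_multiplier[of d d]
  obtain C where C0: "fixed_multiplier_exponent d d C" ..
  note C = C0[unfolded fixed_multiplier_exponent_def, rule_format]
  show ?thesis unfolding differencing_exponent_def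
  proof (rule exI[of _ "2 * C"], intro allI impI)
    fix c :: "nat \<Rightarrow> real" and N :: nat and T \<epsilon> :: real and H
    assume T: "T \<ge> 2" and N: "T ^ (2 * C) \<le> real N" "0 \<le> \<epsilon>" "\<epsilon> * T ^ (2 * C) \<le> real N"
      and H: "H \<subseteq> {1..N}" and cH: "real N / T \<le> real (card H)"
      and hyp: "\<forall>h\<in>H. \<exists>q::nat. 1 \<le> q \<and> real q \<le> T \<and> near_difference_coeffs c d N \<epsilon> h q"
    have fin: "finite H" using H finite_subset by blast
    have "\<exists>q::nat. 1 \<le> q \<and> real q \<le> T \<and> real (card H) / T \<le> real (card {h\<in>H. near_difference_coeffs c d N \<epsilon> h q})"
      using fin T hyp by (intro pigeonhole_multiplier) auto
    then obtain q0 :: nat where q0: "1 \<le> q0" "real q0 \<le> T"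
      "real (card H) / T \<le> real (card {h\<in>H. near_difference_coeffs c d N \<epsilon> h q0})" by blast
    have T2: "T \<le> T ^ 2" using T by (simp add: power2_eq_square)
    have "real N / T ^ 2 = real N / T / T" by (simp add: power2_eq_square)
    also have "\<dots> \<le> real (card H) / T" using cH T by (intro divide_right_mono) auto
    also note q0(3)
    finally have "\<exists>q::nat. 1 \<le> q \<and> real q \<le> (T ^ 2) ^ C \<and>
        (\<forall>j. d - d < j \<and> 2 \<le> j \<and> j \<le> d \<longrightarrow> near (\<epsilon> * (T ^ 2) ^ C / real N ^ j) (real q * c j))"
      using T T2 N H q0 by (intro C[of "T ^ 2" N \<epsilon> "{h\<in>H. near_difference_coeffs c d N \<epsilon> h q0}" q0 c]) (auto simp flip: power_mult)
    moreover have "(d - d < j \<and> 2 \<le> j \<and> j \<le> d) = (2 \<le> j \<and> j \<le> d)" for j by auto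
    ultimately show "coeffs_approx 2 d c N (T ^ (2 * C)) (\<epsilon> * T ^ (2 * C))"
      by (simp only: power_mult)
  qed
qed

section \<open>Polynomial recurrence\<close>

definition poly_phase :: "(nat \<Rightarrow> real) \<Rightarrow> nat \<Rightarrow> nat \<Rightarrow> real" where
  "poly_phase c d n = (\<Sum>i\<le>d. c i * real n ^ i)"

lemma poly_phase_difference:
  "poly_phase c (Suc d) (n + h) - poly_phase c (Suc d) n = poly_phase (difference_coeff c (Suc d) h) d n"
proof -
  have "poly_phase c (Suc d) (n + h) - poly_phase c (Suc d) n =
      (\<Sum>j\<le>Suc d. c j * (real (n + h) ^ j - real n ^ j))"
    unfolding poly_phase_def by (simp add: right_diff_distrib sum_subtractf)
  also have "\<dots> = (\<Sum>j\<le>Suc d. \<Sum>i\<in>{i\<in>{..d}. i < j}. real (j choose i) * real h ^ (j - i) * c j * real n ^ i)"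
  proof (rule sum.cong)
    fix j assume j: "j \<in> {..Suc d}"
    have "real (n + h) ^ j = (\<Sum>i\<le>j. real (j choose i) * real n ^ i * real h ^ (j - i))"
      by (simp add: binomial_ring)
    also have "\<dots> = (\<Sum>i<j. real (j choose i) * real n ^ i * real h ^ (j - i)) + real n ^ j"
      by (simp flip: lessThan_Suc_atMost)
    finally have "c j * (real (n + h) ^ j - real n ^ j) = (\<Sum>i<j. real (j choose i) * real h ^ (j - i) * c j * real n ^ i)"
      by (simp add: sum_distrib_left mult_ac)
    also have "{..<j} = {i\<in>{..d}. i < j}" using j by auto
    finally show "c j * (real (n + h) ^ j - real n ^ j) =
      (\<Sum>i\<in>{i\<in>{..d}. i < j}. real (j choose i) * real h ^ (j - i) * c j * real n ^ i)" .
  qed simp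
  also have "\<dots> = (\<Sum>i\<le>d. \<Sum>j\<in>{j\<in>{..Suc d}. i < j}. real (j choose i) * real h ^ (j - i) * c j * real n ^ i)"
    by (rule sum.swap_restrict) auto
  also have "\<dots> = poly_phase (difference_coeff c (Suc d) h) d n"
    unfolding poly_phase_def difference_coeff_def
    by (intro sum.cong) (auto simp: sum_distrib_right intro!: sum.cong)
  finally show ?thesis .
qed

lemma poly_phase_split:
  "poly_phase c (Suc d) n = c 0 + c 1 * real n + (\<Sum>j\<in>{2..Suc d}. c j * real n ^ j)"
  unfolding poly_phase_def
  by (simp add: atMost_atLeast0 sum.atLeast_Suc_atMost numeral_2_eq_2)

text \<open>Values below half of the average \<open>S / card A\<close> contribute at most
  \<open>S / 2\<close> altogether; the other half of \<open>S\<close> comes from values of size at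
  most \<open>B\<close>, so there are many of those.\<close>

lemma card_large_values:
  fixes f :: "'a \<Rightarrow> real"
  assumes fin: "finite A" and B: "B > 0" and fB: "\<And>h. h \<in> A \<Longrightarrow> f h \<le> B" and S: "0 \<le> S" "S \<le> sum f A"
  shows "S / (2 * B) \<le> real (card {h\<in>A. S / (2 * real (card A)) \<le> f h})"
proof -
  let ?L = "{h\<in>A. S / (2 * real (card A)) \<le> f h}"
  have "sum f A = sum f ?L + sum f (A - ?L)" using fin by (subst sum.subset_diff[of ?L A]) auto
  also have "sum f ?L \<le> real (card ?L) * B" using fB by (intro sum_bounded_above) auto
  also have "sum f (A - ?L) \<le> (\<Sum>h\<in>A - ?L. S / (2 * real (card A)))" by (intro sum_mono) auto
  also have "\<dots> \<le> (\<Sum>h\<in>A. S / (2 * real (card A)))" using S fin by (intro sum_mono2) auto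
  also have "\<dots> \<le> S / 2" using S by (cases "card A = 0") auto
  finally have "S / 2 \<le> real (card ?L) * B" using S by linarith
  then show ?thesis using B by (simp add: field_simps)
qed

text \<open>Since the number of indices and the bound on \<open>f\<close> are both \<open>N\<close>,
  threshold and count come out as the same \<open>N / (8 * T ^ 2)\<close>; the exponent 5 absorbs
  the 8.\<close>

lemma card_large_values_power:
  fixes f :: "nat \<Rightarrow> real"
  assumes T: "T \<ge> 2" and N: "0 < real N" and f: "\<And>h. f h \<le> real N" and sum: "(real N / T) ^ 2 / 4 \<le> sum f {1..N}"
  shows "real N / T ^ 5 \<le> real (card {h\<in>{1..N}. real N / T ^ 5 \<le> f h})"
proof -
  define S where "S = (real N / T) ^ 2 / 4"
  have Seq: "S / (2 * real N) = real N / (8 * T ^ 2)"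
    using N T unfolding S_def by (simp add: field_simps power2_eq_square)
  have le: "real N / T ^ 5 \<le> real N / (8 * T ^ 2)"
    using eight_square_le_power[OF T] T by (intro divide_left_mono) auto
  have "S / (2 * real N) \<le> real (card {h\<in>{1..N}. S / (2 * real (card {1..N})) \<le> f h})"
    using N f sum unfolding S_def by (intro card_large_values) auto
  also have "card {h\<in>{1..N}. S / (2 * real (card {1..N})) \<le> f h} \<le> card {h\<in>{1..N}. real N / T ^ 5 \<le> f h}"
    using Seq le by (intro card_mono) auto
  finally show ?thesis using Seq le by simp
qed

text \<open>Pairs from \<open>A\<close> are the diagonal and two copies of the pairs
  \<open>a < b\<close>, which are sorted by their difference \<open>h\<close>.\<close>

lemma card_pairs_le:
  assumes A: "A \<subseteq> {1..N::nat}"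
  shows "card A ^ 2 \<le> card A + 2 * (\<Sum>h\<in>{1..N}. card {n\<in>A. n + h \<in> A})"
proof -
  define P where "P = {(a, b). a \<in> A \<and> b \<in> A \<and> a < b}"
  have fin: "finite A" using A finite_subset by blast
  have finP: "finite P" unfolding P_def by (rule finite_subset[of _ "A \<times> A"]) (use fin in auto)
  have "A \<times> A \<subseteq> (\<lambda>a. (a, a)) ` A \<union> (P \<union> prod.swap ` P)" unfolding P_def by force
  then have "card (A \<times> A) \<le> card ((\<lambda>a. (a, a)) ` A \<union> (P \<union> prod.swap ` P))"
    using fin finP by (intro card_mono) auto
  also have "\<dots> \<le> card ((\<lambda>a. (a, a)) ` A) + (card P + card (prod.swap ` P))"
    by (meson add_mono card_Un_le order_refl order_trans)
  also have "\<dots> \<le> card A + (card P + card P)"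
    using fin finP by (intro add_mono card_image_le) auto
  finally have 1: "card A ^ 2 \<le> card A + 2 * card P" by (simp add: card_cartesian_product power2_eq_square)
  have "P \<subseteq> (\<lambda>(h, n). (n, n + h)) ` (SIGMA h:{1..N}. {n\<in>A. n + h \<in> A})"
  proof
    fix x assume "x \<in> P"
    then obtain a b where ab: "x = (a, b)" "a \<in> A" "b \<in> A" "a < b" unfolding P_def by auto
    then have "x = (\<lambda>(h, n). (n, n + h)) (b - a, a)" by auto
    moreover have "(b - a, a) \<in> (SIGMA h:{1..N}. {n\<in>A. n + h \<in> A})" using ab A by auto
    ultimately show "x \<in> (\<lambda>(h, n). (n, n + h)) ` (SIGMA h:{1..N}. {n\<in>A. n + h \<in> A})" by blast
  qed
  then have "card P \<le> card ((\<lambda>(h, n). (n, n + h)) ` (SIGMA h:{1..N}. {n\<in>A. n + h \<in> A}))"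
    using fin by (intro card_mono finite_imageI finite_SigmaI) auto
  also have "\<dots> \<le> card (SIGMA h:{1..N}. {n\<in>A. n + h \<in> A})"
    using fin by (intro card_image_le finite_SigmaI) auto
  also have "\<dots> = (\<Sum>h\<in>{1..N}. card {n\<in>A. n + h \<in> A})" using fin by (intro card_SigmaI) auto
  finally show ?thesis using 1 by linarith
qed

definition recurrence_exponent :: "nat \<Rightarrow> nat \<Rightarrow> bool" where
  "recurrence_exponent d C \<longleftrightarrow> (\<forall>(c :: nat \<Rightarrow> real) N (T::real) \<epsilon>. T \<ge> 2 \<longrightarrow> T ^ C \<le> real N \<longrightarrow> 0 \<le> \<epsilon> \<longrightarrow> \<epsilon> * T ^ C \<le> 1 \<longrightarrow>
     real N / T \<le> real (card {n\<in>{1..N}. near \<epsilon> (poly_phase c d n)}) \<longrightarrow>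
     (coeffs_approx 1 d c N (T ^ C) (\<epsilon> * T ^ C)))"

text \<open>If the values at \<open>n\<close> and \<open>n + h\<close> are both nearly integral, so
  is the value at \<open>n\<close> of a polynomial of lower degree. A dense set has a dense set of
  popular differences \<open>h\<close>; induction applies to each of them, and
  \<open>differenced_coefficients\<close> returns all coefficients of index at least 2. Removing
  these terms on the original set leaves a linear phase for \<open>vinogradov_linear\<close>, whose
  shift \<gamma> takes up the constant coefficient.\<close>

lemma polynomial_recurrence:
  "\<exists>C. recurrence_exponent d C"
proof (induction d)
  case 0
  show ?case unfolding recurrence_exponent_def by (rule exI[of _ 0]) (auto intro: exI[of _ 1])
next
  case (Suc d)
  from Suc.IH obtain C0 where C0: "recurrence_exponent d C0" ..
  from differenced_coefficients[of "Suc d"] obtain C1 where C1: "differencing_exponent (Suc d) C1" ..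
  \<comment> \<open>\<open>5 * C0 + 1\<close> is the exponent of the error left by induction at
    \<open>T ^ 5\<close>, and the product is the cost of \<open>differenced_coefficients\<close> at
    \<open>T ^ (5 * C0 + 5)\<close>. In \<open>C\<close> the summand \<open>d\<close> pays for the
    number of higher terms, 9 for constants and for the loss in
    \<open>vinogradov_linear\<close>.\<close>
  define E where "E = 5 * C0 + 1 + (5 * C0 + 5) * C1"
  define C where "C = E + d + 9"
  show ?case unfolding recurrence_exponent_def
  proof (rule exI[of _ C], intro allI impI)
    fix c :: "nat \<Rightarrow> real" and N :: nat and T \<epsilon> :: real
    assume T: "T \<ge> 2" and N: "T ^ C \<le> real N" and e0: "0 \<le> \<epsilon>" and eC: "\<epsilon> * T ^ C \<le> 1"
      and card: "real N / T \<le> real (card {n\<in>{1..N}. near \<epsilon> (poly_phase c (Suc d) n)})"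
    have Tp: "T ^ a \<le> T ^ b" if "a \<le> b" for a b using T that by (intro power_increasing) auto
    have eTp: "\<epsilon> * T ^ a \<le> \<epsilon> * T ^ b" if "a \<le> b" for a b using e0 Tp that by (intro mult_left_mono)
    have NT: "T ^ a \<le> real N" if "a \<le> C" for a using Tp that N order_trans by blast
    have eT1: "\<epsilon> * T ^ a \<le> 1" if "a \<le> C" for a using eTp that eC order_trans by blast
    have N1: "1 \<le> real N" using NT[of 0] by simp
    define A where "A = {n\<in>{1..N}. near \<epsilon> (poly_phase c (Suc d) n)}"
    have AN: "A \<subseteq> {1..N}" unfolding A_def by blast
    have cA: "real N / T \<le> real (card A)" using card A_def by simp
    have "T * 2 \<le> T ^ 2" using T by (simp add: power2_eq_square)
    also have "T ^ 2 \<le> real N" by (rule NT) (simp add: C_def)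
    finally have "2 \<le> real N / T" using T by (simp add: field_simps)
    then have c2: "2 \<le> real (card A)" using cA by linarith
    define f where "f = (\<lambda>h. real (card {n\<in>A. n + h \<in> A}))"
    have "(real N / T) ^ 2 \<le> real (card A) ^ 2" using cA T by (intro power_mono) auto
    moreover have "2 * real (card A) \<le> real (card A) ^ 2" using c2 by (simp add: power2_eq_square)
    moreover have "real (card A) ^ 2 \<le> real (card A) + 2 * sum f {1..N}"
      using of_nat_mono[OF card_pairs_le[OF AN], where 'a = real] unfolding f_def by simp
    ultimately have Ssum: "(real N / T) ^ 2 / 4 \<le> sum f {1..N}" by linarith
    have finA: "finite A" using AN finite_subset by blast
    have fN: "f h \<le> real N" for h
      unfolding f_def using card_mono[of "{1..N}" "{n\<in>A. n + h \<in> A}"] AN by auto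
    \<comment> \<open>The popular differences: each is realised by at least \<open>N / T ^ 5\<close>
      pairs from \<open>A\<close>.\<close>
    define H where "H = {h\<in>{1..N}. real N / T ^ 5 \<le> f h}"
    have cH: "real N / T ^ 5 \<le> real (card H)"
      unfolding H_def using Ssum fN N1 T by (intro card_large_values_power) auto
    have fH: "real N / T ^ 5 \<le> f h" if "h \<in> H" for h using that unfolding H_def by blast
    define \<epsilon>2 where "\<epsilon>2 = \<epsilon> * T ^ (5 * C0 + 1)"
    define T2 where "T2 = T ^ (5 * C0 + 5)"
    have T22: "2 \<le> T2" "T ^ 5 \<le> T2" "T ^ (5 * C0) \<le> T2"
      unfolding T2_def using Tp[of 1 "5 * C0 + 5"] T by (auto intro: Tp)
    have T2C1: "T2 ^ C1 = T ^ ((5 * C0 + 5) * C1)" unfolding T2_def by (rule power_mult[symmetric])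
    have hyp: "\<forall>h\<in>H. \<exists>q::nat. 1 \<le> q \<and> real q \<le> T2 \<and> near_difference_coeffs c (Suc d) N \<epsilon>2 h q"
    proof
      fix h assume h: "h \<in> H"
      have sub: "{n\<in>A. n + h \<in> A} \<subseteq> {n\<in>{1..N}. near (2 * \<epsilon>) (poly_phase (difference_coeff c (Suc d) h) d n)}"
      proof
        fix n assume "n \<in> {n\<in>A. n + h \<in> A}"
        then have "near \<epsilon> (poly_phase c (Suc d) n)" "near \<epsilon> (poly_phase c (Suc d) (n + h))" "n \<in> {1..N}"
          unfolding A_def by auto
        then have "near (\<epsilon> + \<epsilon>) (poly_phase (difference_coeff c (Suc d) h) d n)"
          unfolding poly_phase_difference[symmetric] by (intro near_diff)
        then show "n \<in> {n\<in>{1..N}. near (2 * \<epsilon>) (poly_phase (difference_coeff c (Suc d) h) d n)}"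
          using \<open>n \<in> {1..N}\<close> by simp
      qed
      have c5: "real N / T ^ 5 \<le> real (card {n\<in>{1..N}. near (2 * \<epsilon>) (poly_phase (difference_coeff c (Suc d) h) d n)})"
        using fH[OF h] card_mono[OF _ sub] unfolding f_def by (simp add: order_trans)
      have "2 * \<epsilon> * (T ^ 5) ^ C0 = \<epsilon> * T ^ (5 * C0) * 2" by (simp add: power_mult)
      also have "\<dots> \<le> \<epsilon> * T ^ (5 * C0) * T" using T e0 by (intro mult_left_mono) auto
      also have "\<dots> = \<epsilon>2" by (simp add: \<epsilon>2_def)
      finally have le2: "2 * \<epsilon> * (T ^ 5) ^ C0 \<le> \<epsilon>2" .
      moreover have "\<epsilon>2 \<le> 1" unfolding \<epsilon>2_def by (rule eT1) (simp add: C_def E_def)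
      moreover have "(T ^ 5) ^ C0 \<le> real N" using NT[of "5 * C0"] by (simp add: C_def E_def power_mult)
      moreover have "2 \<le> T ^ 5" using Tp[of 1 5] T by simp
      ultimately have "coeffs_approx 1 d (difference_coeff c (Suc d) h) N ((T ^ 5) ^ C0) (2 * \<epsilon> * (T ^ 5) ^ C0)"
        using e0 c5 by (intro C0[unfolded recurrence_exponent_def, rule_format, of "T ^ 5" N "2 * \<epsilon>" "difference_coeff c (Suc d) h"]) auto
      then obtain q :: nat where q: "1 \<le> q" "real q \<le> (T ^ 5) ^ C0" and qn: "\<And>j. 1 \<le> j \<Longrightarrow> j \<le> d \<Longrightarrow>
          near (2 * \<epsilon> * (T ^ 5) ^ C0 / real N ^ j) (real q * difference_coeff c (Suc d) h j)" by blast
      have "near_difference_coeffs c (Suc d) N \<epsilon>2 h q"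
        unfolding near_difference_coeffs_def
      proof (intro allI impI)
        fix i assume i: "1 \<le> i \<and> i < Suc d"
        show "near (\<epsilon>2 / real N ^ i) (real q * difference_coeff c (Suc d) h i)"
          by (rule near_mono[OF qn]) (use i le2 in \<open>auto intro: divide_right_mono\<close>)
      qed
      moreover have "real q \<le> T2" using q(2) T22(3) by (simp add: power_mult)
      ultimately show "\<exists>q::nat. 1 \<le> q \<and> real q \<le> T2 \<and> near_difference_coeffs c (Suc d) N \<epsilon>2 h q"
        using q by blast
    qed
    have e2E: "\<epsilon>2 * T2 ^ C1 = \<epsilon> * T ^ E"
      unfolding \<epsilon>2_def T2C1 E_def by (simp add: power_add)
    have "real N / T2 \<le> real N / T ^ 5" using T22 T by (intro divide_left_mono) auto
    then have "real N / T2 \<le> real (card H)" using cH by linarith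
    moreover have "T2 ^ C1 \<le> real N" unfolding T2C1 by (rule NT) (simp add: C_def E_def)
    moreover have "\<epsilon>2 * T2 ^ C1 \<le> real N" unfolding e2E using eT1[of E] N1 by (simp add: C_def)
    ultimately have "coeffs_approx 2 (Suc d) c N (T2 ^ C1) (\<epsilon>2 * T2 ^ C1)"
      using T22 e0 T hyp unfolding H_def \<epsilon>2_def
      by (intro C1[unfolded differencing_exponent_def, rule_format, of T2 N "\<epsilon> * T ^ (5 * C0 + 1)" H c]) (auto simp: H_def)
    then obtain q :: nat where q: "1 \<le> q" "real q \<le> T2 ^ C1" and qn: "\<And>j. 2 \<le> j \<Longrightarrow> j \<le> Suc d \<Longrightarrow> near (\<epsilon> * T ^ E / real N ^ j) (real q * c j)"
      unfolding e2E by blast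
    have qE: "real q \<le> T ^ E" using q(2) Tp[of "(5 * C0 + 5) * C1" E] unfolding T2C1 by (simp add: E_def)
    define \<epsilon>3 where "\<epsilon>3 = \<epsilon> * T ^ (E + d + 1)"
    \<comment> \<open>After multiplication by \<open>q\<close> each term of index at least 2 is
      within \<open>\<epsilon> * T ^ E\<close> of an integer for all \<open>n \<le> N\<close>,
      because its coefficient is approximated at scale \<open>N ^ j\<close>.\<close>
    have near_n: "near \<epsilon>3 ((real q * c 1) * real n - (- (real q * c 0)))" if n: "n \<in> A" for n
    proof -
      have nN: "real n \<le> real N" using n AN by auto
      have a1: "near (\<epsilon> * T ^ E) (real q * poly_phase c (Suc d) n)"
        by (rule near_mult_le[of \<epsilon>]) (use n qE e0 in \<open>auto simp: A_def mult.commute intro: mult_left_mono\<close>)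
      have a2: "near (\<Sum>j\<in>{2..Suc d}. \<epsilon> * T ^ E) (\<Sum>j\<in>{2..Suc d}. real (n ^ j) * (real q * c j))"
      proof (rule near_sum)
        fix j assume j: "j \<in> {2..Suc d}"
        show "near (\<epsilon> * T ^ E) (real (n ^ j) * (real q * c j))"
        proof (rule near_mult_le[OF qn])
          have "real (n ^ j) * (\<epsilon> * T ^ E / real N ^ j) \<le> real N ^ j * (\<epsilon> * T ^ E / real N ^ j)"
            using nN e0 T by (intro mult_right_mono) (auto intro: power_mono)
          then show "real (n ^ j) * (\<epsilon> * T ^ E / real N ^ j) \<le> \<epsilon> * T ^ E" using N1 by simp
        qed (use j in auto)
      qed simp
      have dT: "real d \<le> T ^ d" using T by (rule const_le_power) (simp add: less_imp_le of_nat_less_two_power)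
      have "real d * (\<epsilon> * T ^ E) \<le> T ^ d * (\<epsilon> * T ^ E)" using dT e0 T by (intro mult_right_mono) auto
      moreover have "\<epsilon> * T ^ E \<le> T ^ d * (\<epsilon> * T ^ E)" using eTp[of E "E + d"] by (simp add: power_add mult_ac)
      moreover have "2 * (T ^ d * (\<epsilon> * T ^ E)) \<le> T * (T ^ d * (\<epsilon> * T ^ E))" using T e0 by (intro mult_right_mono) auto
      ultimately have "\<epsilon> * T ^ E + (\<Sum>j\<in>{2..Suc d}. \<epsilon> * T ^ E) \<le> \<epsilon>3"
        by (simp add: \<epsilon>3_def power_add mult_ac)
      moreover have "(real q * c 1) * real n - (- (real q * c 0)) =
          real q * poly_phase c (Suc d) n - (\<Sum>j\<in>{2..Suc d}. real (n ^ j) * (real q * c j))"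
        unfolding poly_phase_split by (simp add: algebra_simps sum_distrib_left)
      ultimately show ?thesis using near_mono[OF near_diff[OF a1 a2]] by simp
    qed
    have "20 * \<epsilon>3 * T = (\<epsilon> * T ^ (E + d + 2)) * 20" by (simp add: \<epsilon>3_def)
    also have "\<dots> \<le> (\<epsilon> * T ^ (E + d + 2)) * T ^ 5"
      using e0 T const_le_power[OF T, of 20 5] by (intro mult_left_mono) auto
    also have "\<dots> = \<epsilon> * T ^ (E + d + 7)" by (simp add: power_add eval_nat_numeral mult_ac)
    also have "\<dots> \<le> 1" by (rule eT1) (simp add: C_def)
    finally have small: "20 * \<epsilon>3 * T \<le> 1" .
    have T3: "3 * T \<le> T ^ 3" by (rule three_times_le_cube[OF T])
    have "T ^ 3 \<le> real N" by (rule NT) (simp add: C_def)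
    then have "3 * T \<le> real N" using T3 by linarith
    from vinogradov_linear[OF AN cA T near_n small this]
    obtain r :: nat where r: "1 \<le> r" "real r \<le> 3 * T" "near (36 * T\<^sup>2 * \<epsilon>3 / real N) (real r * (real q * c 1))" by blast
    have r3: "real r \<le> T ^ 3" using r T3 by linarith
    have "real (r * q) \<le> T ^ 3 * T ^ E" using r3 qE T by (simp, intro mult_mono) auto
    also have "\<dots> \<le> T ^ C" using Tp[of "3 + E" C] by (simp add: power_add C_def)
    finally have rq: "real (r * q) \<le> T ^ C" .
    have rq1: "1 \<le> r * q" using r q by (simp add: Suc_le_eq)
    have fin: "near (\<epsilon> * T ^ C / real N ^ j) (real (r * q) * c j)" if j: "1 \<le> j" "j \<le> Suc d" for j
    proof (cases "j = 1")
      case True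
      have "36 * T\<^sup>2 * \<epsilon>3 / real N = (\<epsilon> * T ^ (E + d + 3) / real N) * 36"
        unfolding \<epsilon>3_def by (simp add: power_add eval_nat_numeral mult_ac)
      also have "\<dots> \<le> (\<epsilon> * T ^ (E + d + 3) / real N) * T ^ 6"
        using e0 T const_le_power[OF T, of 36 6] by (intro mult_left_mono) auto
      also have "\<dots> = \<epsilon> * T ^ C / real N" by (simp add: C_def add_ac flip: power_add)
      finally show ?thesis using near_mono r(3) True by (simp add: mult_ac)
    next
      case False
      have "near (\<epsilon> * T ^ C / real N ^ j) (real r * (real q * c j))"
      proof (rule near_mult_le[OF qn])
        have "real r * (\<epsilon> * T ^ E / real N ^ j) \<le> T ^ 3 * (\<epsilon> * T ^ E / real N ^ j)"
          using r3 e0 T by (intro mult_right_mono) auto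
        also have "\<dots> = \<epsilon> * T ^ (3 + E) / real N ^ j" by (simp add: power_add)
        also have "\<dots> \<le> \<epsilon> * T ^ C / real N ^ j"
          by (intro divide_right_mono eTp) (auto simp: C_def)
        finally show "real r * (\<epsilon> * T ^ E / real N ^ j) \<le> \<epsilon> * T ^ C / real N ^ j" .
      qed (use False j in auto)
      then show ?thesis by (simp add: mult_ac)
    qed
    show "coeffs_approx 1 (Suc d) c N (T ^ C) (\<epsilon> * T ^ C)"
      by (rule exI[of _ "r * q"]) (use rq rq1 fin in blast)
  qed
qed

section \<open>Weyl sums\<close>

lemma add_char_cis: "add_char x = cis (2 * pi * x)"
  unfolding add_char_def cis_conv_exp by (simp add: mult_ac)

lemma norm_add_char [simp]: "cmod (add_char x) = 1"
  by (simp add: add_char_cis)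

lemma add_char_add: "add_char (x + y) = add_char x * add_char y"
  by (simp add: add_char_cis cis_mult distrib_left)

lemma add_char_minus: "add_char (- x) = cnj (add_char x)"
  by (simp add: add_char_cis cis_cnj)

lemma add_char_diff: "add_char (x - y) = add_char x * cnj (add_char y)"
  using add_char_add[of x "- y"] by (simp add: add_char_minus)

lemma add_char_of_int [simp]: "add_char (of_int n) = 1"
  using cis_multiple_2pi[of "of_int n"] by (simp add: add_char_cis)

lemma add_char_mod1: "add_char (x - of_int a) = add_char x"
  by (simp add: add_char_diff)

lemma norm_add_char_minus_one: "cmod (add_char x - 1) = 2 * \<bar>sin (pi * x)\<bar>"
  using dist_exp_i_1[of "2 * pi * x"] by (simp add: add_char_def mult_ac)

lemma norm_add_char_minus_one_le: assumes "near \<delta> x" shows "cmod (add_char x - 1) \<le> 7 * \<delta>"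
proof -
  obtain a :: int where a: "\<bar>x - of_int a\<bar> \<le> \<delta>" using assms unfolding near_def by blast
  have "cmod (add_char x - 1) = 2 * \<bar>sin (pi * (x - of_int a))\<bar>"
    by (metis norm_add_char_minus_one add_char_mod1)
  also have "\<dots> \<le> 2 * \<bar>pi * (x - of_int a)\<bar>" by (simp add: abs_sin_x_le_abs_x)
  also have "\<dots> = 2 * pi * \<bar>x - of_int a\<bar>" by (simp add: abs_mult)
  also have "\<dots> \<le> 7 * \<delta>" using a pi_less_4 pi_approx by (intro mult_mono) auto
  finally show ?thesis .
qed

text \<open>A weak form of Jordan's inequality. The bound 1.6 lies just beyond
  \<open>pi / 2\<close>, and \<open>1.6 * 1.6 < 3\<close> makes the cubic Taylor remainder at most
  \<open>y / 2\<close>.\<close>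

lemma half_le_sin: fixes y :: real assumes "0 \<le> y" "y \<le> 1.6" shows "y / 2 \<le> sin y"
proof -
  have "\<bar>sin y - (\<Sum>m<3. sin_coeff m * y ^ m)\<bar> \<le> inverse (fact 3) * \<bar>y\<bar> ^ 3"
    by (rule Maclaurin_sin_bound)
  then have "\<bar>sin y - y\<bar> \<le> y * (y * y) / 6"
    using assms by (simp add: sin_coeff_def eval_nat_numeral lessThan_Suc fact_numeral divide_simps)
  moreover have "y * y \<le> 1.6 * 1.6" using assms by (intro mult_mono) auto
  then have "y * (y * y) \<le> y * 3" using assms by (intro mult_left_mono) auto
  ultimately show ?thesis by linarith
qed

lemma near_norm_add_char_minus_one: "near (cmod (add_char x - 1) / 2) x"
proof -
  define \<beta> where "\<beta> = x - of_int (round x)"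
  have b: "\<bar>\<beta>\<bar> \<le> 1 / 2" unfolding \<beta>_def using of_int_round_abs_le[of x] by (simp add: abs_minus_commute)
  have eq: "cmod (add_char x - 1) = 2 * \<bar>sin (pi * \<beta>)\<bar>"
    unfolding \<beta>_def by (metis norm_add_char_minus_one add_char_mod1)
  have "\<bar>sin (pi * \<beta>)\<bar> = \<bar>sin (pi * \<bar>\<beta>\<bar>)\<bar>" by (cases "\<beta> \<ge> 0") (auto simp: abs_if)
  moreover have "pi * \<bar>\<beta>\<bar> \<le> 3.2 * (1 / 2)" using b pi_approx by (intro mult_mono) auto
  then have "pi * \<bar>\<beta>\<bar> / 2 \<le> sin (pi * \<bar>\<beta>\<bar>)" by (intro half_le_sin) auto
  moreover have "2 * \<bar>\<beta>\<bar> \<le> pi * \<bar>\<beta>\<bar>" using pi_ge_two by (intro mult_right_mono) auto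
  ultimately have "\<bar>\<beta>\<bar> \<le> cmod (add_char x - 1) / 2" using eq by linarith
  then show ?thesis unfolding near_def \<beta>_def by blast
qed

text \<open>Multiplying the geometric sum by \<open>add_char x - 1\<close> telescopes it to two
  terms of modulus 1, so \<open>add_char x - 1\<close> has modulus at most
  \<open>4 / L\<close>.\<close>

lemma near_of_large_linear_sum:
  assumes L: "L \<ge> 1" and big: "real L / 2 \<le> cmod (\<Sum>l\<in>{1..L}. add_char (x * real l))"
  shows "near (2 / real L) x"
proof -
  have tel: "(\<Sum>l\<in>{1..L}. add_char (x * real l)) * (add_char x - 1) = add_char (x * real (L + 1)) - add_char x"
  proof (induction L)
    case (Suc L)
    have "add_char (x * real (Suc L + 1)) = add_char (x * real (Suc L)) * add_char x"
      by (simp add: algebra_simps flip: add_char_add)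
    then show ?case using Suc by (simp add: algebra_simps)
  qed simp
  have "real L / 2 * cmod (add_char x - 1) \<le> cmod (\<Sum>l\<in>{1..L}. add_char (x * real l)) * cmod (add_char x - 1)"
    using big by (intro mult_right_mono) auto
  also have "\<dots> = cmod (add_char (x * real (L + 1)) - add_char x)" using tel by (metis norm_mult)
  also have "\<dots> \<le> 2" using norm_triangle_ineq4[of "add_char (x * real (L + 1))" "add_char x"] by simp
  finally have "cmod (add_char x - 1) / 2 \<le> 2 / real L" using L by (simp add: field_simps)
  then show ?thesis using near_norm_add_char_minus_one near_mono by blast
qed

text \<open>Expand the square of the modulus. The diagonal gives at most \<open>N\<close>; the terms
  above and below it are conjugate, and grouping by the difference of the two indices yields the
  sums over \<open>h\<close>.\<close>

lemma van_der_corput: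
  fixes f :: "nat \<Rightarrow> complex"
  assumes f: "\<And>n. cmod (f n) \<le> 1"
  shows "cmod (\<Sum>n\<in>{1..N}. f n) ^ 2 \<le> real N + 2 * (\<Sum>h\<in>{1..N}. cmod (\<Sum>n\<in>{1..N-h}. f (n + h) * cnj (f n)))"
proof -
  define g where "g = (\<lambda>(a, b). f a * cnj (f b))"
  define U where "U = {(a, b). a \<in> {1..N} \<and> b \<in> {1..N} \<and> b < a}"
  define V where "V = {(a, b). a \<in> {1..N} \<and> b \<in> {1..N} \<and> a < b}"
  define D where "D = (\<lambda>a. (a, a)) ` {1..N}"
  have fin: "finite U" "finite V" "finite D"
    by (rule finite_subset[of _ "{1..N} \<times> {1..N}"]; force simp: U_def V_def D_def)+
  have part: "{1..N} \<times> {1..N} = D \<union> (U \<union> V)" unfolding U_def V_def D_def by force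
  have "(\<Sum>n\<in>{1..N}. f n) * cnj (\<Sum>n\<in>{1..N}. f n) = (\<Sum>x\<in>{1..N} \<times> {1..N}. g x)"
    unfolding g_def by (simp add: sum_product sum.cartesian_product)
  also have "\<dots> = sum g D + (sum g U + sum g V)"
    unfolding part using fin by (subst sum.union_disjoint; (subst sum.union_disjoint)?) (auto simp: U_def V_def D_def)
  finally have eq: "(\<Sum>n\<in>{1..N}. f n) * cnj (\<Sum>n\<in>{1..N}. f n) = sum g D + (sum g U + sum g V)" .
  have "sum g V = (\<Sum>x\<in>U. cnj (g x))"
    by (rule sum.reindex_bij_witness[of _ prod.swap prod.swap]) (auto simp: U_def V_def g_def)
  then have "sum g V = cnj (sum g U)" by simp
  then have UV: "cmod (sum g V) = cmod (sum g U)" by (metis complex_mod_cnj)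
  have "cmod (sum g D) \<le> (\<Sum>x\<in>D. 1)"
  proof (rule sum_norm_le)
    fix x assume "x \<in> D"
    then obtain a where "x = (a, a)" unfolding D_def by auto
    then show "cmod (g x) \<le> 1" using f[of a] unfolding g_def by (simp add: norm_mult mult_le_one)
  qed
  also have "\<dots> \<le> real N" using card_image_le[of "{1..N}" "\<lambda>a. (a, a)"] by (simp add: D_def)
  finally have Dn: "cmod (sum g D) \<le> real N" .
  have "sum g U = (\<Sum>x\<in>(SIGMA h:{1..N}. {1..N-h}). case x of (h, n) \<Rightarrow> f (n + h) * cnj (f n))"
    by (rule sum.reindex_bij_witness[of _ "\<lambda>(h, n). (n + h, n)" "\<lambda>(a, b). (a - b, b)"])
       (auto simp: U_def g_def)
  also have "\<dots> = (\<Sum>h\<in>{1..N}. \<Sum>n\<in>{1..N-h}. f (n + h) * cnj (f n))"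
    by (subst sum.Sigma) auto
  finally have "cmod (sum g U) \<le> (\<Sum>h\<in>{1..N}. cmod (\<Sum>n\<in>{1..N-h}. f (n + h) * cnj (f n)))"
    by (simp add: norm_sum)
  moreover have "cmod (\<Sum>n\<in>{1..N}. f n) ^ 2 = cmod ((\<Sum>n\<in>{1..N}. f n) * cnj (\<Sum>n\<in>{1..N}. f n))"
    by (simp only: norm_mult complex_mod_cnj power2_eq_square)
  moreover have "\<dots> \<le> cmod (sum g D) + (cmod (sum g U) + cmod (sum g V))"
    unfolding eq by (meson norm_triangle_ineq norm_triangle_mono order_refl)
  ultimately show ?thesis using UV Dn by linarith
qed

text \<open>Replacing \<open>n\<close> by \<open>n + q l\<close> changes the higher-order terms of the phase by almost an
  integer, so averaging over \<open>l\<close> isolates the linear term.\<close>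

lemma linear_coefficient_of_large_sum:
  fixes c :: "nat \<Rightarrow> real" and K T :: real
  assumes q: "1 \<le> q" "real q \<le> K" and K: "K \<ge> 1" and T: "T \<ge> 1" and N: "1 \<le> N" and L: "1 \<le> L"
    and nearc: "\<And>j. 2 \<le> j \<Longrightarrow> j \<le> Suc d \<Longrightarrow> near (K / real N ^ j) (real q * c j)"
    and LN: "real L * (T * K * (4 + 14 * (real d * (real (Suc d) * 2 ^ d)))) \<le> real N"
    and big: "real N / T \<le> cmod (\<Sum>n\<in>{1..N}. add_char (poly_phase c (Suc d) n))"
  shows "near (2 / real L) (real q * c 1)"
proof -
  define G where "G = (\<Sum>l\<in>{1..L}. add_char (real q * c 1 * real l))"
  define e where "e = (\<lambda>n. add_char (poly_phase c (Suc d) n))"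
  define S where "S = (\<Sum>n\<in>{1..N}. e n)"
  define W where "W = real d * (real (Suc d) * 2 ^ d)"
  define \<delta> where "\<delta> = real L * K * W / real N"
  have W0: "0 \<le> W" unfolding W_def by simp
  have Np: "real N > 0" using N by simp
  have KL: "real L * K \<le> real N"
  proof -
    have "real L * K * 1 \<le> real L * K * (T * (4 + 14 * W))" using K T W0
      by (intro mult_left_mono) (auto intro: mult_ge1_I)
    also have "\<dots> \<le> real N" using LN W_def by (simp add: mult_ac)
    finally show ?thesis by simp
  qed
  have qlN: "q * l \<le> N" if "l \<in> {1..L}" for l
  proof -
    have "real (q * l) \<le> K * real L" using q K that by (simp, intro mult_mono) auto
    then have "real (q * l) \<le> real N" using KL by (simp add: mult.commute)
    then show ?thesis by (simp only: of_nat_le_iff)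
  qed
  have near_shift: "near \<delta> (poly_phase c (Suc d) (n + q * l) - poly_phase c (Suc d) n - real q * c 1 * real l)"
    if n: "n \<in> {1..N}" and l: "l \<in> {1..L}" for n l
  proof -
    \<comment> \<open>\<open>(n + q * l) ^ j - n ^ j\<close> is \<open>q\<close> times the integer
      \<open>m j\<close>, so in the phase \<open>c j\<close> appears as \<open>q * c j\<close>,
      which is nearly integral. This is why the shifts are multiples of \<open>q\<close>.\<close>
    define m where "m = (\<lambda>j. l * (\<Sum>i<j. n ^ (j - Suc i) * (n + q * l) ^ i))"
    have m: "real (n + q * l) ^ j - real n ^ j = real q * real (m j)" for j
      using power_diff_sumr2[of "real (n + q * l)" j "real n"] unfolding m_def by simp
    have mb: "real (m j) \<le> real L * (real (Suc d) * 2 ^ d) * real N ^ (j - 1)" if j: "j \<in> {2..Suc d}" for j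
    proof -
      have "(\<Sum>i<j. n ^ (j - Suc i) * (n + q * l) ^ i) \<le> (\<Sum>i<j. N ^ (j - Suc i) * (2 * N) ^ i)"
        using n qlN[OF l] by (intro sum_mono mult_mono power_mono) auto
      also have "\<dots> \<le> (\<Sum>i<j. 2 ^ d * N ^ (j - 1))"
      proof (rule sum_mono)
        fix i assume i: "i \<in> {..<j}"
        have "N ^ (j - Suc i) * (2 * N) ^ i = 2 ^ i * (N ^ (j - Suc i) * N ^ i)" by (simp add: power_mult_distrib)
        also have "N ^ (j - Suc i) * N ^ i = N ^ (j - 1)" using i by (simp flip: power_add)
        also have "2 ^ i * N ^ (j - 1) \<le> 2 ^ d * N ^ (j - 1)" using i j by (intro mult_right_mono power_increasing) auto
        finally show "N ^ (j - Suc i) * (2 * N) ^ i \<le> 2 ^ d * N ^ (j - 1)" .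
      qed
      also have "\<dots> = j * (2 ^ d * N ^ (j - 1))" by simp
      also have "\<dots> \<le> Suc d * (2 ^ d * N ^ (j - 1))" using j by (intro mult_right_mono) auto
      finally have "m j \<le> L * (Suc d * (2 ^ d * N ^ (j - 1)))" unfolding m_def using l by (intro mult_mono) auto
      then have "real (m j) \<le> real (L * (Suc d * (2 ^ d * N ^ (j - 1))))" by (rule of_nat_mono)
      then show ?thesis by (simp add: algebra_simps)
    qed
    have "near (\<Sum>j\<in>{2..Suc d}. real L * K * (real (Suc d) * 2 ^ d) / real N) (\<Sum>j\<in>{2..Suc d}. real (m j) * (real q * c j))"
    proof (rule near_sum)
      fix j assume j: "j \<in> {2..Suc d}"
      show "near (real L * K * (real (Suc d) * 2 ^ d) / real N) (real (m j) * (real q * c j))"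
      proof (rule near_mult_le[OF nearc])
        have "real (m j) * (K / real N ^ j) \<le> real L * (real (Suc d) * 2 ^ d) * real N ^ (j - 1) * (K / real N ^ j)"
          using mb[OF j] K by (intro mult_right_mono) auto
        also have "real N ^ j = real N ^ (j - 1) * real N" using j by (simp flip: power_Suc2)
        then have "real L * (real (Suc d) * 2 ^ d) * real N ^ (j - 1) * (K / real N ^ j) = real L * K * (real (Suc d) * 2 ^ d) / real N"
          using Np by (simp add: field_simps)
        finally show "real (m j) * (K / real N ^ j) \<le> real L * K * (real (Suc d) * 2 ^ d) / real N" .
      qed (use j in auto)
    qed simp
    moreover have "(\<Sum>j\<in>{2..Suc d}. real L * K * (real (Suc d) * 2 ^ d) / real N) = \<delta>"
      unfolding \<delta>_def W_def by simp
    moreover have "poly_phase c (Suc d) (n + q * l) - poly_phase c (Suc d) n - real q * c 1 * real l =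
        (\<Sum>j\<in>{2..Suc d}. c j * (real (n + q * l) ^ j - real n ^ j))"
      unfolding poly_phase_split by (simp add: algebra_simps sum_subtractf)
    moreover have "\<dots> = (\<Sum>j\<in>{2..Suc d}. real (m j) * (real q * c j))"
      unfolding m by (simp add: mult_ac)
    ultimately show ?thesis by simp
  qed
  have d0: "0 \<le> \<delta>" unfolding \<delta>_def using W0 K by simp
  \<comment> \<open>Shifting the range by \<open>u = q * l\<close> changes \<open>S\<close> by at
    most \<open>2 * u\<close>; in the shifted sum each term differs from \<open>e n\<close> times
    the linear factor by at most \<open>7 * \<delta>\<close>.\<close>
  have one: "cmod (S - S * add_char (real q * c 1 * real l)) \<le> 2 * (real L * K) + 7 * \<delta> * real N" if l: "l \<in> {1..L}" for l
  proof -
    define u where "u = q * l"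
    define R where "R = (\<Sum>n\<in>{1..N}. e (n + u))"
    have "real l * real q \<le> real L * K" using q K l by (intro mult_mono) auto
    then have ule: "real u \<le> real L * K" unfolding u_def by (simp add: mult.commute)
    have Req: "R = (\<Sum>n\<in>{Suc u..N + u}. e n)"
      unfolding R_def by (rule sum.reindex_bij_witness[of _ "\<lambda>n. n - u" "\<lambda>n. n + u"]) auto
    have uN: "u \<le> N" using qlN[OF l] u_def by simp
    have "S = sum e {1..u} + sum e {Suc u..N}"
      unfolding S_def using uN by (subst sum.union_disjoint[symmetric]) (auto intro!: sum.cong)
    moreover have "(\<Sum>n\<in>{Suc u..N + u}. e n) = sum e {Suc u..N} + sum e {Suc N..N + u}"
      using uN by (subst sum.union_disjoint[symmetric]) (auto intro!: sum.cong)
    ultimately have "S - R = sum e {1..u} - sum e {Suc N..N + u}" using Req by simp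
    moreover have "cmod (sum e {1..u}) \<le> real u" "cmod (sum e {Suc N..N + u}) \<le> real u"
      using sum_norm_le[of "{1..u}" e "\<lambda>_. 1"] sum_norm_le[of "{Suc N..N + u}" e "\<lambda>_. 1"] unfolding e_def by auto
    ultimately have a: "cmod (S - R) \<le> 2 * real u"
      using norm_triangle_ineq4[of "sum e {1..u}" "sum e {Suc N..N + u}"] by simp
    have "R - S * add_char (real q * c 1 * real l) = (\<Sum>n\<in>{1..N}. e (n + u) - e n * add_char (real q * c 1 * real l))"
      unfolding R_def S_def by (simp add: sum_subtractf sum_distrib_right)
    moreover have "cmod (e (n + u) - e n * add_char (real q * c 1 * real l)) \<le> 7 * \<delta>" if n: "n \<in> {1..N}" for n
    proof -
      have "e (n + u) - e n * add_char (real q * c 1 * real l) =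
          e n * add_char (real q * c 1 * real l) *
            (add_char (poly_phase c (Suc d) (n + q * l) - poly_phase c (Suc d) n - real q * c 1 * real l) - 1)"
        unfolding e_def u_def right_diff_distrib by (simp flip: add_char_add)
      then have "cmod (e (n + u) - e n * add_char (real q * c 1 * real l)) =
         cmod (add_char (poly_phase c (Suc d) (n + q * l) - poly_phase c (Suc d) n - real q * c 1 * real l) - 1)"
        by (simp add: norm_mult e_def)
      then show ?thesis using norm_add_char_minus_one_le[OF near_shift[OF n l]] by simp
    qed
    then have "cmod (\<Sum>n\<in>{1..N}. e (n + u) - e n * add_char (real q * c 1 * real l)) \<le> (\<Sum>n\<in>{1..N}. 7 * \<delta>)"
      by (intro sum_norm_le)
    ultimately have "cmod (R - S * add_char (real q * c 1 * real l)) \<le> 7 * \<delta> * real N" by (simp add: mult_ac)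
    then have "cmod ((S - R) + (R - S * add_char (real q * c 1 * real l))) \<le> 2 * real u + 7 * \<delta> * real N"
      using a norm_triangle_mono by blast
    then show ?thesis using ule by simp
  qed
  have "cmod (\<Sum>l\<in>{1..L}. S - S * add_char (real q * c 1 * real l)) \<le> (\<Sum>l\<in>{1..L}. 2 * (real L * K) + 7 * \<delta> * real N)"
    by (intro sum_norm_le one)
  moreover have "(\<Sum>l\<in>{1..L}. S - S * add_char (real q * c 1 * real l)) = S * (of_nat L - G)"
    unfolding G_def by (simp add: sum_subtractf sum_distrib_left right_diff_distrib)
  ultimately have b: "cmod S * cmod (of_nat L - G) \<le> real L * (2 * (real L * K) + 7 * \<delta> * real N)"
    by (simp add: norm_mult)
  have "2 * (real L * K) + 7 * \<delta> * real N = real L * K * (2 + 7 * W)"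
    unfolding \<delta>_def using Np by (simp add: field_simps)
  \<comment> \<open>The hypothesis has \<open>4 + 14 * W\<close>, twice the \<open>2 + 7 * W\<close>
    needed to bound the error. So the error is at most half of the main term, and \<open>G\<close>
    keeps modulus at least \<open>L / 2\<close>.\<close>
  moreover have "T * (real L * K * (2 + 7 * W)) \<le> real N / 2" using LN unfolding W_def[symmetric] by (simp add: algebra_simps)
  ultimately have T2: "T * (2 * (real L * K) + 7 * \<delta> * real N) \<le> real N / 2" by simp
  have "real N * cmod (of_nat L - G) = T * (real N / T * cmod (of_nat L - G))" using T by simp
  also have "\<dots> \<le> T * (cmod S * cmod (of_nat L - G))"
    using big T unfolding S_def e_def by (intro mult_left_mono mult_right_mono) auto
  also have "\<dots> \<le> T * (real L * (2 * (real L * K) + 7 * \<delta> * real N))" using b T by (intro mult_left_mono) auto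
  also have "\<dots> = real L * (T * (2 * (real L * K) + 7 * \<delta> * real N))" by simp
  also have "\<dots> \<le> real L * (real N / 2)" using T2 by (intro mult_left_mono) auto
  also have "\<dots> = real N * (real L / 2)" by simp
  finally have "cmod (of_nat L - G) \<le> real L / 2" using Np by (simp only: mult_le_cancel_left_pos)
  moreover have "real L \<le> cmod (of_nat L - G) + cmod G"
    using norm_triangle_ineq[of "of_nat L - G" G] by simp
  ultimately have "real L / 2 \<le> cmod G" by linarith
  then show ?thesis unfolding G_def using L by (intro near_of_large_linear_sum) auto
qed

definition weyl_exponent :: "nat \<Rightarrow> nat \<Rightarrow> bool" where
  "weyl_exponent d C \<longleftrightarrow> (\<forall>(c :: nat \<Rightarrow> real) N (T::real). T \<ge> 2 \<longrightarrow> 1 \<le> N \<longrightarrow>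
     real N / T \<le> cmod (\<Sum>n\<in>{1..N}. add_char (poly_phase c d n)) \<longrightarrow>
     (coeffs_approx 1 d c N (T ^ C) (T ^ C)))"

text \<open>\<open>van_der_corput\<close> turns one large sum into many shifts \<open>h\<close> with
  large sums of lower degree. Induction and \<open>differenced_coefficients\<close> settle the
  indices from 2 on, after which \<open>linear_coefficient_of_large_sum\<close> supplies the linear
  coefficient.\<close>

lemma weyl_polynomial:
  "\<exists>C. weyl_exponent d C"
proof (induction d)
  case 0
  show ?case unfolding weyl_exponent_def by (rule exI[of _ 0]) (auto intro: exI[of _ 1])
next
  case (Suc d)
  from Suc.IH obtain C0 where C0: "weyl_exponent d C0" ..
  from differenced_coefficients[of "Suc d"] obtain C1 where C1: "differencing_exponent (Suc d) C1" ..
  define E where "E = 5 * C0 + 5 * d + (5 * C0 + 5) * C1"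
  define G where "G = E + 3 * d + 7"
  define C2 where "C2 = G + 3"
  \<comment> \<open>The factor \<open>Suc d\<close> disposes of short sums: if
    \<open>N < T ^ C2\<close>, then \<open>N ^ j \<le> T ^ C\<close> for all indices
    \<open>j\<close> concerned, and \<open>q = 1\<close> works trivially.\<close>
  define C where "C = C2 * Suc d"
  show ?case unfolding weyl_exponent_def
  proof (rule exI[of _ C], intro allI impI)
    fix c :: "nat \<Rightarrow> real" and N :: nat and T :: real
    assume T: "T \<ge> 2" and N1: "1 \<le> N"
      and big: "real N / T \<le> cmod (\<Sum>n\<in>{1..N}. add_char (poly_phase c (Suc d) n))"
    have Tp: "T ^ a \<le> T ^ b" if "a \<le> b" for a b using T that by (intro power_increasing) auto
    have T1: "1 \<le> T ^ a" for a using T by (simp add: one_le_power)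
    have Np: "real N > 0" using N1 by simp
    have CC2: "C2 \<le> C" unfolding C_def by simp
    show "coeffs_approx 1 (Suc d) c N (T ^ C) (T ^ C)"
    proof (cases "real N < T ^ C2")
      case True
      have "near (T ^ C / real N ^ j) (real 1 * c j)" if j: "1 \<le> j" "j \<le> Suc d" for j
      proof (rule near_trivial)
        have "real N ^ j \<le> (T ^ C2) ^ j" using True by (intro power_mono) auto
        also have "\<dots> = T ^ (C2 * j)" by (simp add: power_mult)
        also have "\<dots> \<le> T ^ C" unfolding C_def using j by (intro Tp mult_left_mono) auto
        finally show "1 \<le> T ^ C / real N ^ j" using Np by simp
      qed
      then show ?thesis using T1[of C] by (intro exI[of _ 1]) auto
    next
      case False
      then have NT: "T ^ a \<le> real N" if "a \<le> C2" for a using Tp[OF that] by linarith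
      define e where "e = (\<lambda>n. add_char (poly_phase c (Suc d) n))"
      define f where "f = (\<lambda>h. cmod (\<Sum>n\<in>{1..N-h}. e (n + h) * cnj (e n)))"
      have e_diff: "e (n + h) * cnj (e n) = add_char (poly_phase (difference_coeff c (Suc d) h) d n)" for n h
        unfolding e_def poly_phase_difference[symmetric] add_char_diff ..
      have "(real N / T) ^ 2 \<le> cmod (\<Sum>n\<in>{1..N}. e n) ^ 2"
        using big T unfolding e_def by (intro power_mono) auto
      also have "\<dots> \<le> real N + 2 * sum f {1..N}"
        unfolding f_def by (rule van_der_corput) (simp add: e_def)
      finally have "(real N / T) ^ 2 \<le> real N + 2 * sum f {1..N}" .
      \<comment> \<open>The diagonal term of \<open>van_der_corput\<close> is absorbed, as
        \<open>N\<close> is at least \<open>T ^ 3\<close>.\<close>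
      moreover have "real N \<le> (real N / T) ^ 2 / 2"
      proof -
        have "2 * T ^ 2 \<le> T * T ^ 2" using T by (intro mult_right_mono) auto
        also have "\<dots> \<le> real N" using NT[of 3] by (simp add: C2_def eval_nat_numeral)
        finally have "real N * (2 * T ^ 2) \<le> real N * real N" by (intro mult_left_mono) auto
        then show ?thesis using T by (simp add: field_simps power2_eq_square)
      qed
      ultimately have Ssum: "(real N / T) ^ 2 / 4 \<le> sum f {1..N}" by linarith
      have fNh: "f h \<le> real (N - h)" for h
        unfolding f_def e_diff using sum_norm_le[of "{1..N-h}" _ "\<lambda>_. 1"] by force
      have fN: "f h \<le> real N" for h using fNh[of h] by (meson diff_le_self of_nat_mono order_trans)
      define H where "H = {h\<in>{1..N}. real N / T ^ 5 \<le> f h}"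
      have cH: "real N / T ^ 5 \<le> real (card H)"
      unfolding H_def using Ssum fN Np T by (intro card_large_values_power) auto
    have fH: "real N / T ^ 5 \<le> f h" if "h \<in> H" for h using that unfolding H_def by blast
      define \<epsilon>2 where "\<epsilon>2 = T ^ (5 * C0 + 5 * d)"
      define T2 where "T2 = T ^ (5 * C0 + 5)"
      have T22: "2 \<le> T2" "T ^ 5 \<le> T2" "T ^ (5 * C0) \<le> T2"
        unfolding T2_def using Tp[of 1 "5 * C0 + 5"] T by (auto intro: Tp)
      have T2C1: "T2 ^ C1 = T ^ ((5 * C0 + 5) * C1)" unfolding T2_def by (rule power_mult[symmetric])
      have hyp: "\<forall>h\<in>H. \<exists>q::nat. 1 \<le> q \<and> real q \<le> T2 \<and> near_difference_coeffs c (Suc d) N \<epsilon>2 h q"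
      proof
        fix h assume h: "h \<in> H"
        have "0 < real N / T ^ 5" using Np T by simp
        then have M1: "1 \<le> N - h" using fH[OF h] fNh[of h] by linarith
        \<comment> \<open>The differenced sum has only \<open>N - h\<close> terms, but being large
          it cannot be short. Passing from scale \<open>N - h\<close> to scale \<open>N\<close> thus
          costs at most \<open>T ^ (5 * i)\<close> at index \<open>i\<close>, hence the
          \<open>5 * d\<close> in \<open>\<epsilon>2\<close>.\<close>
        have M2: "real N / T ^ 5 \<le> real (N - h)" using fH[OF h] fNh[of h] by linarith
        have "real (N - h) / T ^ 5 \<le> real N / T ^ 5" using T by (intro divide_right_mono) auto
        also note fH[OF h]
        finally have "real (N - h) / T ^ 5 \<le> cmod (\<Sum>n\<in>{1..N-h}. add_char (poly_phase (difference_coeff c (Suc d) h) d n))"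
          unfolding f_def e_diff .
        moreover have "2 \<le> T ^ 5" using Tp[of 1 5] T by simp
        ultimately have "coeffs_approx 1 d (difference_coeff c (Suc d) h) (N - h) ((T ^ 5) ^ C0) ((T ^ 5) ^ C0)"
          using M1 by (intro C0[unfolded weyl_exponent_def, rule_format, of "T ^ 5" "N - h" "difference_coeff c (Suc d) h"]) auto
        then obtain q :: nat where q: "1 \<le> q" "real q \<le> (T ^ 5) ^ C0" and qn: "\<And>j. 1 \<le> j \<Longrightarrow> j \<le> d \<Longrightarrow>
            near ((T ^ 5) ^ C0 / real (N - h) ^ j) (real q * difference_coeff c (Suc d) h j)" by blast
        have "near_difference_coeffs c (Suc d) N \<epsilon>2 h q"
          unfolding near_difference_coeffs_def
        proof (intro allI impI)
          fix i assume i: "1 \<le> i \<and> i < Suc d"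
          have "(real N / T ^ 5) ^ i \<le> real (N - h) ^ i" using M2 T by (intro power_mono) auto
          then have "(T ^ 5) ^ C0 / real (N - h) ^ i \<le> (T ^ 5) ^ C0 / (real N / T ^ 5) ^ i"
            using Np T M1 by (intro divide_left_mono) auto
          also have "\<dots> = T ^ (5 * C0 + 5 * i) / real N ^ i"
            by (simp add: power_divide power_add power_mult)
          also have "\<dots> \<le> \<epsilon>2 / real N ^ i" unfolding \<epsilon>2_def using i by (intro divide_right_mono Tp) auto
          finally show "near (\<epsilon>2 / real N ^ i) (real q * difference_coeff c (Suc d) h i)"
            using near_mono[OF qn] i by simp
        qed
        moreover have "real q \<le> T2" using q(2) T22(3) by (simp add: power_mult)
        ultimately show "\<exists>q::nat. 1 \<le> q \<and> real q \<le> T2 \<and> near_difference_coeffs c (Suc d) N \<epsilon>2 h q"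
          using q by blast
      qed
      have e2E: "\<epsilon>2 * T2 ^ C1 = T ^ E"
        unfolding \<epsilon>2_def T2C1 E_def by (simp add: power_add)
      have "real N / T2 \<le> real N / T ^ 5" using T22 T by (intro divide_left_mono) auto
      then have "real N / T2 \<le> real (card H)" using cH by linarith
      moreover have "T2 ^ C1 \<le> real N" unfolding T2C1 by (rule NT) (simp add: C2_def G_def E_def)
      moreover have "\<epsilon>2 * T2 ^ C1 \<le> real N" unfolding e2E by (rule NT) (simp add: C2_def G_def)
      moreover have "0 \<le> \<epsilon>2" unfolding \<epsilon>2_def using T by simp
      moreover have "H \<subseteq> {1..N}" unfolding H_def by blast
      ultimately have "coeffs_approx 2 (Suc d) c N (T2 ^ C1) (\<epsilon>2 * T2 ^ C1)"
        using T22 hyp by (intro C1[unfolded differencing_exponent_def, rule_format, of T2 N "\<epsilon>2" H c]) auto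
      then obtain q :: nat where q: "1 \<le> q" "real q \<le> T2 ^ C1" and qn: "\<And>j. 2 \<le> j \<Longrightarrow> j \<le> Suc d \<Longrightarrow> near (T ^ E / real N ^ j) (real q * c j)"
        unfolding e2E by blast
      have qE: "real q \<le> T ^ E" using q(2) Tp[of "(5 * C0 + 5) * C1" E] unfolding T2C1 by (simp add: E_def)
      define B where "B = T * T ^ E * (4 + 14 * (real d * (real (Suc d) * 2 ^ d)))"
      have "real d * (real (Suc d) * 2 ^ d) \<le> 2 ^ d * (2 ^ Suc d * 2 ^ d)"
        using of_nat_less_two_power[of d, where 'a = real] of_nat_less_two_power[of "Suc d", where 'a = real]
        by (intro mult_mono) auto
      also have "\<dots> = 2 * 2 ^ (3 * d)" by (simp add: power_mult power3_eq_cube power_mult_distrib flip: power_mult_distrib)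
      finally have "4 + 14 * (real d * (real (Suc d) * 2 ^ d)) \<le> 4 + 28 * 2 ^ (3 * d)" by simp
      also have "\<dots> \<le> 32 * 2 ^ (3 * d)" by simp
      also have "\<dots> \<le> 2 ^ (3 * d + 6)" by (simp add: power_add)
      also have "\<dots> \<le> T ^ (3 * d + 6)" using T by (intro power_mono) auto
      finally have "B \<le> T * T ^ E * T ^ (3 * d + 6)" unfolding B_def using T by (intro mult_left_mono) auto
      also have "\<dots> = T ^ G" unfolding G_def by (simp add: power_add eval_nat_numeral mult_ac)
      finally have BG: "B \<le> T ^ G" .
      \<comment> \<open>The longest averaging compatible with \<open>L * T ^ G \<le> N\<close>, so
        that \<open>2 / L\<close> has order \<open>T ^ G / N\<close>, the required scale at index
        1.\<close>
      define L where "L = nat \<lfloor>real N / T ^ G\<rfloor>"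
      have "T ^ G \<le> real N" by (rule NT) (simp add: C2_def)
      then have NG: "1 \<le> real N / T ^ G" using T by (simp add: field_simps)
      then have L: "1 \<le> L" "real L \<le> real N / T ^ G" "real N / T ^ G < real L + 1" unfolding L_def by linarith+
      have "real L * B \<le> real N / T ^ G * T ^ G" using L BG T1[of G] Np T by (intro mult_mono) (auto simp: B_def)
      then have LB: "real L * B \<le> real N" using T by simp
      have near1: "near (2 / real L) (real q * c 1)"
        using T big q(1) qE T1 N1 L qn LB unfolding B_def
        by (intro linear_coefficient_of_large_sum[where K = "T ^ E" and T = T and d = d and N = N]) auto
      have "real N / T ^ G \<le> 2 * real L" using L by linarith
      then have "2 / real L \<le> 4 * (T ^ G / real N)" using L(1) Np T by (simp add: field_simps)
      also have "\<dots> \<le> T ^ 2 * (T ^ G / real N)" using const_le_power[OF T, of 4 2] T by (intro mult_right_mono) auto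
      also have "\<dots> = T ^ (2 + G) / real N ^ 1" by (simp add: power_add power2_eq_square)
      also have "\<dots> \<le> T ^ C / real N ^ 1" using CC2 by (intro divide_right_mono Tp) (auto simp: C2_def)
      finally have near1': "near (T ^ C / real N ^ 1) (real q * c 1)" using near1 near_mono by blast
      have "E \<le> C" using CC2 by (simp add: C2_def G_def)
      then have EC: "T ^ E \<le> T ^ C" by (rule Tp)
      have "near (T ^ C / real N ^ j) (real q * c j)" if j: "1 \<le> j" "j \<le> Suc d" for j
      proof (cases "j = 1")
        case True
        then show ?thesis using near1' by simp
      next
        case False
        show ?thesis by (rule near_mono[OF qn]) (use j False EC in \<open>auto intro: divide_right_mono\<close>)
      qed
      then show ?thesis using q(1) qE EC by (intro exI[of _ q]) auto
    qed
  qed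
qed

section \<open>Bilinear sums\<close>

definition phase :: "('t::finite \<Rightarrow> nat) \<Rightarrow> ('t \<Rightarrow> real) \<Rightarrow> nat \<Rightarrow> real" where
  "phase k \<alpha> n = (\<Sum>j\<in>UNIV. \<alpha> j * real n ^ k j)"

lemma exponent_le_sum: "k j \<le> exponent_sum k"
  unfolding exponent_sum_def by (rule member_le_sum) auto

abbreviation rational_approx :: "('t::finite \<Rightarrow> nat) \<Rightarrow> ('t \<Rightarrow> real) \<Rightarrow> nat \<Rightarrow> real \<Rightarrow> bool" where
  "rational_approx k \<alpha> X D \<equiv>
     (\<exists>q::nat. 1 \<le> q \<and> real q \<le> D \<and> (\<forall>j. near (D / real X ^ k j) (real q * \<alpha> j)))"

definition weyl_system_exponent :: "('t::finite \<Rightarrow> nat) \<Rightarrow> nat \<Rightarrow> bool" where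
  "weyl_system_exponent k C \<longleftrightarrow> (\<forall>(\<beta> :: 't \<Rightarrow> real) N (T::real). T \<ge> 2 \<longrightarrow> 1 \<le> N \<longrightarrow>
     real N / T \<le> cmod (\<Sum>n\<in>{1..N}. add_char (phase k \<beta> n)) \<longrightarrow>
     (rational_approx k \<beta> N (T ^ C)))"

text \<open>The phase is a polynomial of degree at most \<open>exponent_sum k\<close>. Because the
  exponents are distinct, its coefficient at \<open>k j\<close> is exactly \<open>\<beta> j\<close>;
  because they are positive, none of the coordinates hides in the constant term, about which
  \<open>weyl_polynomial\<close> says nothing.\<close>

lemma weyl_system:
  fixes k :: "'t::finite \<Rightarrow> nat"
  assumes inj: "inj k" and k0: "\<And>j. k j > 0"
  shows "\<exists>C. weyl_system_exponent k C"
proof -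
  define d where "d = exponent_sum k"
  from weyl_polynomial[of d] obtain C where C: "weyl_exponent d C" ..
  show ?thesis unfolding weyl_system_exponent_def
  proof (rule exI[of _ C], intro allI impI)
    fix \<beta> :: "'t \<Rightarrow> real" and N :: nat and T :: real
    assume T: "T \<ge> 2" and N: "1 \<le> N" and big: "real N / T \<le> cmod (\<Sum>n\<in>{1..N}. add_char (phase k \<beta> n))"
    define c where "c = (\<lambda>i. \<Sum>j\<in>{j\<in>UNIV. k j = i}. \<beta> j)"
    have ck: "c (k j) = \<beta> j" for j
    proof -
      have "{j'\<in>UNIV. k j' = k j} = {j}" using inj by (auto dest: injD)
      then show ?thesis unfolding c_def by simp
    qed
    have "poly_phase c d n = phase k \<beta> n" for n
    proof -
      have "poly_phase c d n = (\<Sum>i\<le>d. \<Sum>j\<in>{j\<in>UNIV. k j = i}. \<beta> j * real n ^ k j)"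
        unfolding poly_phase_def c_def sum_distrib_right by (intro sum.cong) auto
      also have "\<dots> = phase k \<beta> n"
        unfolding phase_def by (rule sum.group) (auto simp: d_def exponent_le_sum)
      finally show ?thesis .
    qed
    then obtain q :: nat where q: "1 \<le> q" "real q \<le> T ^ C"
      "\<forall>j. 1 \<le> j \<and> j \<le> d \<longrightarrow> near (T ^ C / real N ^ j) (real q * c j)"
      using C[unfolded weyl_exponent_def, rule_format, OF T N, of c] big by auto
    have "near (T ^ C / real N ^ k j) (real q * \<beta> j)" for j
      using q(3)[rule_format, of "k j"] k0[of j] exponent_le_sum[of k j] by (simp add: ck d_def)
    then show "rational_approx k \<beta> N (T ^ C)"
      using q by blast
  qed
qed

text \<open>One exponent serves all \<open>m \<le> d\<close>, so that it can be used at every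
  \<open>k j\<close> simultaneously. In the bilinear sums the shift \<gamma> will hold the power of
  a fixed \<open>m'\<close>.\<close>

definition monomial_recurrence_exponent :: "nat \<Rightarrow> nat \<Rightarrow> bool" where
  "monomial_recurrence_exponent d C \<longleftrightarrow> (\<forall>m \<theta> \<gamma> N (T::real) \<epsilon>. 1 \<le> m \<longrightarrow> m \<le> d \<longrightarrow> T \<ge> 2 \<longrightarrow> T ^ C \<le> real N \<longrightarrow> 0 \<le> \<epsilon> \<longrightarrow> \<epsilon> * T ^ C \<le> 1 \<longrightarrow>
     real N / T \<le> real (card {n\<in>{1..N}. near \<epsilon> (\<theta> * real n ^ m - \<gamma>)}) \<longrightarrow>
     (\<exists>q::nat. 1 \<le> q \<and> real q \<le> T ^ C \<and> near (\<epsilon> * T ^ C / real N ^ m) (real q * \<theta>)))"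

lemma monomial_recurrence:
  "\<exists>C. monomial_recurrence_exponent d C"
proof -
  from polynomial_recurrence[of d] obtain C where C: "recurrence_exponent d C" ..
  show ?thesis unfolding monomial_recurrence_exponent_def
  proof (rule exI[of _ C], intro allI impI)
    fix m :: nat and \<theta> \<gamma> :: real and N :: nat and T \<epsilon> :: real
    assume m: "1 \<le> m" "m \<le> d" and a: "T \<ge> 2" "T ^ C \<le> real N" "0 \<le> \<epsilon>" "\<epsilon> * T ^ C \<le> 1"
      and big: "real N / T \<le> real (card {n\<in>{1..N}. near \<epsilon> (\<theta> * real n ^ m - \<gamma>)})"
    define c where "c = (\<lambda>i. (if i = m then \<theta> else 0) + (if i = 0 then - \<gamma> else 0))"
    have "poly_phase c d n = \<theta> * real n ^ m - \<gamma>" for n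
    proof -
      have "poly_phase c d n = (\<Sum>i\<le>d. (if i = m then \<theta> * real n ^ m else 0) + (if i = 0 then - \<gamma> else 0))"
        unfolding poly_phase_def c_def by (intro sum.cong) auto
      then show ?thesis using m by (simp add: sum.distrib)
    qed
    then obtain q :: nat where "1 \<le> q" "real q \<le> T ^ C"
      "\<forall>j. 1 \<le> j \<and> j \<le> d \<longrightarrow> near (\<epsilon> * T ^ C / real N ^ j) (real q * c j)"
      using C[unfolded recurrence_exponent_def, rule_format, OF a, of c] big by auto
    moreover have "c m = \<theta>" using m unfolding c_def by simp
    ultimately show "\<exists>q::nat. 1 \<le> q \<and> real q \<le> T ^ C \<and> near (\<epsilon> * T ^ C / real N ^ m) (real q * \<theta>)"
      using m by metis
  qed
qed

lemma real_nat_div_le: "real (m div n) \<le> real m / real n"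
proof (cases "n = 0")
  case False
  have "real (m div n * n) \<le> real m" by (rule of_nat_mono) (rule div_times_less_eq_dividend)
  then show ?thesis using False by (simp add: field_simps)
qed simp

text \<open>Cauchy-Schwarz over \<open>n\<close> removes the coefficients \<open>b\<close>; opening
  the square leaves correlations of \<open>F\<close> along \<open>m\<close> and \<open>m'\<close>.
  The range of \<open>n\<close> depends on \<open>m\<close>, so \<open>w\<close> extends each inner
  sum by zero to the common range up to \<open>X div M\<close>; two such ranges meet in the one for
  \<open>max m m'\<close>.\<close>

lemma bilinear_cauchy_schwarz:
  fixes a b F :: "nat \<Rightarrow> complex"
  assumes M: "1 \<le> M" and a: "\<And>m. cmod (a m) \<le> A" and b: "(\<Sum>n\<in>{1..X div M}. cmod (b n) ^ 2) \<le> B"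
  shows "cmod (\<Sum>m\<in>{M<..2*M}. \<Sum>n\<in>{1..X div m}. a m * b n * F (m * n)) ^ 2 \<le>
    B * (A ^ 2 * (\<Sum>m'\<in>{M<..2*M}. \<Sum>m\<in>{M<..2*M}. cmod (\<Sum>n\<in>{1..X div (max m m')}. F (m * n) * cnj (F (m' * n)))))"
proof -
  define I where "I = {M<..2*M}"
  define N where "N = X div M"
  define w where "w = (\<lambda>m n. if n \<le> X div m then a m * F (m * n) else 0)"
  define g where "g = (\<lambda>n. \<Sum>m\<in>I. w m n)"
  define W where "W = (\<lambda>m m'. \<Sum>n\<in>{1..X div (max m m')}. F (m * n) * cnj (F (m' * n)))"
  have A0: "0 \<le> A" using a[of 0] norm_ge_zero order_trans by blast
  have divN: "X div m \<le> N" if "m \<in> I" for m using that M unfolding I_def N_def by (intro div_le_mono2) auto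
  have "(\<Sum>m\<in>I. \<Sum>n\<in>{1..X div m}. a m * b n * F (m * n)) = (\<Sum>m\<in>I. \<Sum>n\<in>{1..N}. b n * w m n)"
  proof (rule sum.cong)
    fix m assume m: "m \<in> I"
    show "(\<Sum>n\<in>{1..X div m}. a m * b n * F (m * n)) = (\<Sum>n\<in>{1..N}. b n * w m n)"
      using divN[OF m] by (intro sum.mono_neutral_cong_left) (auto simp: w_def)
  qed simp
  also have "\<dots> = (\<Sum>n\<in>{1..N}. b n * g n)"
    unfolding g_def sum_distrib_left by (rule sum.swap)
  finally have eq: "(\<Sum>m\<in>I. \<Sum>n\<in>{1..X div m}. a m * b n * F (m * n)) = (\<Sum>n\<in>{1..N}. b n * g n)" .
  have "cmod (\<Sum>n\<in>{1..N}. b n * g n) \<le> (\<Sum>n\<in>{1..N}. cmod (b n) * cmod (g n))"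
    by (rule sum_norm_le) (simp add: norm_mult)
  then have "cmod (\<Sum>n\<in>{1..N}. b n * g n) ^ 2 \<le> (\<Sum>n\<in>{1..N}. cmod (b n) * cmod (g n)) ^ 2"
    by (intro power_mono) auto
  also have "\<dots> \<le> (\<Sum>n\<in>{1..N}. cmod (b n) ^ 2) * (\<Sum>n\<in>{1..N}. cmod (g n) ^ 2)"
    by (rule Cauchy_Schwarz_ineq_sum)
  also have "\<dots> \<le> B * (\<Sum>n\<in>{1..N}. cmod (g n) ^ 2)"
    using b unfolding N_def by (intro mult_right_mono sum_nonneg) auto
  finally have 1: "cmod (\<Sum>n\<in>{1..N}. b n * g n) ^ 2 \<le> B * (\<Sum>n\<in>{1..N}. cmod (g n) ^ 2)" .
  have "complex_of_real (\<Sum>n\<in>{1..N}. cmod (g n) ^ 2) = (\<Sum>n\<in>{1..N}. g n * cnj (g n))"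
    by (simp only: of_real_sum complex_norm_square)
  also have "\<dots> = (\<Sum>n\<in>{1..N}. \<Sum>m\<in>I. \<Sum>m'\<in>I. w m n * cnj (w m' n))"
    unfolding g_def by (simp add: sum_product)
  also have "\<dots> = (\<Sum>m\<in>I. \<Sum>n\<in>{1..N}. \<Sum>m'\<in>I. w m n * cnj (w m' n))" by (rule sum.swap)
  also have "\<dots> = (\<Sum>m\<in>I. \<Sum>m'\<in>I. \<Sum>n\<in>{1..N}. w m n * cnj (w m' n))" by (intro sum.cong sum.swap) auto
  also have "\<dots> = (\<Sum>m\<in>I. \<Sum>m'\<in>I. a m * cnj (a m') * W m m')"
  proof (intro sum.cong refl)
    fix m m' assume m: "m \<in> I" "m' \<in> I"
    have min: "n \<le> X div m \<and> n \<le> X div m' \<longleftrightarrow> n \<le> X div (max m m')" for n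
    proof (cases "m \<le> m'")
      case True
      then have "X div m' \<le> X div m" using m M unfolding I_def by (intro div_le_mono2) auto
      then show ?thesis using True by (auto simp: max_def)
    next
      case False
      then have "X div m \<le> X div m'" using m M unfolding I_def by (intro div_le_mono2) auto
      then show ?thesis using False by (auto simp: max_def)
    qed
    have "(\<Sum>n\<in>{1..X div (max m m')}. a m * cnj (a m') * (F (m * n) * cnj (F (m' * n)))) = (\<Sum>n\<in>{1..N}. w m n * cnj (w m' n))"
      using divN[OF m(1)] divN[OF m(2)] min by (intro sum.mono_neutral_cong_left) (auto simp: w_def)
    then show "(\<Sum>n\<in>{1..N}. w m n * cnj (w m' n)) = a m * cnj (a m') * W m m'"
      unfolding W_def sum_distrib_left by simp
  qed
  finally have ceq: "complex_of_real (\<Sum>n\<in>{1..N}. cmod (g n) ^ 2) = (\<Sum>m\<in>I. \<Sum>m'\<in>I. a m * cnj (a m') * W m m')" .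
  have "0 \<le> (\<Sum>n\<in>{1..N}. cmod (g n) ^ 2)" by (intro sum_nonneg) auto
  then have "(\<Sum>n\<in>{1..N}. cmod (g n) ^ 2) = cmod (complex_of_real (\<Sum>n\<in>{1..N}. cmod (g n) ^ 2))"
    by (simp only: norm_of_real abs_of_nonneg)
  also have "\<dots> = cmod (\<Sum>m\<in>I. \<Sum>m'\<in>I. a m * cnj (a m') * W m m')" by (simp only: ceq)
  also have "\<dots> \<le> (\<Sum>m\<in>I. \<Sum>m'\<in>I. A ^ 2 * cmod (W m m'))"
  proof (intro sum_norm_le)
    fix m m' assume "m \<in> I" "m' \<in> I"
    have "cmod (a m) * cmod (a m') * cmod (W m m') \<le> A * A * cmod (W m m')"
      using a A0 by (intro mult_right_mono mult_mono) auto
    then show "cmod (a m * cnj (a m') * W m m') \<le> A ^ 2 * cmod (W m m')"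
      by (simp add: norm_mult power2_eq_square)
  qed
  also have "\<dots> = A ^ 2 * (\<Sum>m'\<in>I. \<Sum>m\<in>I. cmod (W m m'))"
    by (subst sum.swap) (simp only: sum_distrib_left)
  finally have 2: "(\<Sum>n\<in>{1..N}. cmod (g n) ^ 2) \<le> A ^ 2 * (\<Sum>m'\<in>I. \<Sum>m\<in>I. cmod (W m m'))" .
  have "0 \<le> B" using b by (meson order_trans sum_nonneg zero_le_power2)
  then have "B * (\<Sum>n\<in>{1..N}. cmod (g n) ^ 2) \<le> B * (A ^ 2 * (\<Sum>m'\<in>I. \<Sum>m\<in>I. cmod (W m m')))"
    using 2 by (intro mult_left_mono)
  then show ?thesis using 1 eq unfolding I_def W_def by simp
qed

text \<open>The product of all \<open>r j\<close> is a multiple of each of them by a cofactor of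
  size at most \<open>D ^ CARD('t)\<close>.\<close>

lemma near_common_multiplier:
  fixes r :: "'t::finite \<Rightarrow> nat"
  assumes r1: "\<And>j. 1 \<le> r j" and r: "\<And>j. real (r j) \<le> D" and near: "\<And>j. near (e j) (real (r j) * x j)"
  shows "\<exists>R::nat. 1 \<le> R \<and> real R \<le> D ^ CARD('t) \<and> (\<forall>j. near (D ^ CARD('t) * e j) (real R * x j))"
proof -
  define R where "R = (\<Prod>j\<in>UNIV. r j)"
  have D1: "1 \<le> D" using r1[of undefined] r[of undefined] by linarith
  have le: "real (\<Prod>j\<in>A. r j) \<le> D ^ CARD('t)" for A
  proof -
    have "real (\<Prod>j\<in>A. r j) = (\<Prod>j\<in>A. real (r j))" by simp
    also have "\<dots> \<le> (\<Prod>j\<in>A. D)" using r by (intro prod_mono) auto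
    also have "\<dots> = D ^ card A" by simp
    also have "\<dots> \<le> D ^ CARD('t)" using D1 by (intro power_increasing card_mono) auto
    finally show ?thesis .
  qed
  have "near (D ^ CARD('t) * e j) (real R * x j)" for j
  proof -
    have "R = (\<Prod>i\<in>UNIV - {j}. r i) * r j"
      unfolding R_def by (metis UNIV_I finite_class.finite_UNIV mult.commute prod.remove)
    then have eq: "real R * x j = real (\<Prod>i\<in>UNIV - {j}. r i) * (real (r j) * x j)" by simp
    show ?thesis unfolding eq
      by (rule near_mult_le[OF near]) (rule mult_right_mono[OF le near_nonneg[OF near]])
  qed
  moreover have "1 \<le> R" unfolding R_def using r1 by (simp add: Suc_le_eq prod_pos)
  ultimately show ?thesis using le[of UNIV] unfolding R_def by blast
qed

text \<open>Both variables must be long: \<open>M\<close> and \<open>X / M\<close> are at least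
  \<open>T ^ C\<close>. The coefficients \<open>b\<close> are bounded in mean square only, because
  they will be divisor sums, which are large at some \<open>n\<close>.\<close>

definition type_II_exponent :: "('t::finite \<Rightarrow> nat) \<Rightarrow> nat \<Rightarrow> bool" where
  "type_II_exponent k C \<longleftrightarrow> (\<forall>(\<alpha> :: 't \<Rightarrow> real) X M (T::real) a b. T \<ge> 2 \<longrightarrow> T ^ C \<le> real M \<longrightarrow> T ^ C * real M \<le> real X \<longrightarrow>
     (\<forall>m. cmod (a m) \<le> T) \<longrightarrow> (\<Sum>n\<in>{1..X div M}. cmod (b n) ^ 2) \<le> T * (real X / real M) \<longrightarrow>
     real X / T \<le> cmod (\<Sum>m\<in>{M<..2*M}. \<Sum>n\<in>{1..X div m}. a m * b n * add_char (phase k \<alpha> (m * n))) \<longrightarrow>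
     (rational_approx k \<alpha> X (T ^ C)))"

text \<open>A large correlation of \<open>m\<close> with a fixed \<open>m'\<close> is a Weyl sum in
  \<open>n\<close> with coefficients \<open>\<alpha> j * (m ^ k j - m' ^ k j)\<close>, of length
  about \<open>X / M\<close>. It approximates these numbers at scale \<open>(X / M) ^ k j\<close>.
  As this happens for many \<open>m\<close>, recurrence for the monomial in \<open>m\<close> removes
  the powers of \<open>m\<close> and gains a further \<open>M ^ k j\<close>.\<close>

lemma type_II_estimate:
  fixes k :: "'t::finite \<Rightarrow> nat"
  assumes inj: "inj k" and k0: "\<And>j. k j > 0"
  shows "\<exists>C. type_II_exponent k C"
proof -
  from weyl_system[OF inj k0] obtain C0 where C0: "weyl_system_exponent k C0" ..
  define d where "d = exponent_sum k"
  from monomial_recurrence[of d] obtain C1 where C1: "monomial_recurrence_exponent d C1" ..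
  \<comment> \<open>\<open>E1\<close> is the cost of \<open>weyl_system\<close> at
    \<open>T ^ 6\<close>, with \<open>6 * d\<close> for the loss in the length of the sum;
    \<open>E2\<close> adds that of the recurrence at \<open>T ^ (7 + E1)\<close>. The factor
    \<open>CARD('t) + 1\<close> in \<open>C\<close> comes from multiplying the denominators of all
    coordinates.\<close>
  define E1 where "E1 = 6 * C0 + 6 * d"
  define E2 where "E2 = E1 + (7 + E1) * C1"
  define C where "C = E1 + E2 * (CARD('t) + 1)"
  have dk: "k j \<le> d" for j unfolding d_def by (rule exponent_le_sum)
  have E2C: "E2 \<le> C" unfolding C_def by simp
  show ?thesis unfolding type_II_exponent_def
  proof (rule exI[of _ C], intro allI impI)
    fix \<alpha> :: "'t \<Rightarrow> real" and X M :: nat and T :: real and a b :: "nat \<Rightarrow> complex"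
    assume T: "T \<ge> 2" and M: "T ^ C \<le> real M" and MX: "T ^ C * real M \<le> real X"
      and a: "\<forall>m. cmod (a m) \<le> T" and b: "(\<Sum>n\<in>{1..X div M}. cmod (b n) ^ 2) \<le> T * (real X / real M)"
      and big: "real X / T \<le> cmod (\<Sum>m\<in>{M<..2*M}. \<Sum>n\<in>{1..X div m}. a m * b n * add_char (phase k \<alpha> (m * n)))"
    have Tp: "T ^ x \<le> T ^ y" if "x \<le> y" for x y using T that by (intro power_increasing) auto
    have T1: "1 \<le> T ^ x" for x using T by (simp add: one_le_power)
    have Mp: "real M > 0" using M T1[of C] by linarith
    have M1: "1 \<le> M" using Mp by simp
    have "1 * real M \<le> T ^ C * real M" using T1 by (intro mult_right_mono) auto
    then have XM: "real M \<le> real X" using MX by linarith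
    then have Xp: "real X > 0" using Mp by linarith
    define I where "I = {M<..2*M}"
    define W where "W = (\<lambda>m m'. \<Sum>n\<in>{1..X div (max m m')}. add_char (phase k \<alpha> (m * n)) * cnj (add_char (phase k \<alpha> (m' * n))))"
    have cI: "card I = M" unfolding I_def by simp
    have Weq: "W m m' = (\<Sum>n\<in>{1..X div (max m m')}. add_char (phase k (\<lambda>j. \<alpha> j * (real m ^ k j - real m' ^ k j)) n))" for m m'
      unfolding W_def phase_def add_char_diff[symmetric]
      by (simp add: power_mult_distrib algebra_simps sum_subtractf)
    have Wle: "cmod (W m m') \<le> real (X div (max m m'))" for m m'
      unfolding Weq using sum_norm_le[of "{1..X div (max m m')}" _ "\<lambda>_. 1"] by force
    have divle: "real (X div (max m m')) \<le> real X / real M" if "m \<in> I" for m m'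
    proof -
      have "X div (max m m') \<le> X div M" using that M1 unfolding I_def by (intro div_le_mono2) auto
      then have "real (X div (max m m')) \<le> real (X div M)" by (rule of_nat_mono)
      also have "\<dots> \<le> real X / real M" by (rule real_nat_div_le)
      finally show ?thesis .
    qed
    have "(real X / T) ^ 2 \<le> cmod (\<Sum>m\<in>{M<..2*M}. \<Sum>n\<in>{1..X div m}. a m * b n * add_char (phase k \<alpha> (m * n))) ^ 2"
      using big T by (intro power_mono) auto
    also have "\<dots> \<le> T * (real X / real M) * (T ^ 2 * (\<Sum>m'\<in>I. \<Sum>m\<in>I. cmod (W m m')))"
      unfolding I_def W_def by (rule bilinear_cauchy_schwarz[OF M1]) (use a b in auto)
    finally have tot: "real X * real M / T ^ 5 \<le> (\<Sum>m'\<in>I. \<Sum>m\<in>I. cmod (W m m'))"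
      using T Xp Mp by (simp add: field_simps eval_nat_numeral)
    \<comment> \<open>A single good \<open>m'\<close> suffices, since its powers become a constant
      shift in the recurrence in \<open>m\<close>.\<close>
    have "\<exists>m'\<in>I. real X / T ^ 5 \<le> (\<Sum>m\<in>I. cmod (W m m'))"
    proof (rule ccontr)
      assume "\<not> ?thesis"
      then have "(\<Sum>m'\<in>I. \<Sum>m\<in>I. cmod (W m m')) < (\<Sum>m'\<in>I. real X / T ^ 5)"
        using M1 by (intro sum_strict_mono) (auto simp: I_def not_le)
      then show False using tot by (simp add: cI mult.commute)
    qed
    then obtain m' where m': "m' \<in> I" "real X / T ^ 5 \<le> (\<Sum>m\<in>I. cmod (W m m'))" by blast
    define H where "H = {m\<in>I. real X / T ^ 5 / (2 * real (card I)) \<le> cmod (W m m')}"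
    have "real X / T ^ 5 / (2 * (real X / real M)) \<le> real (card H)"
      unfolding H_def
    proof (rule card_large_values)
      show "cmod (W h m') \<le> real X / real M" if "h \<in> I" for h using Wle divle[OF that] order_trans by blast
    qed (use Xp Mp m' T I_def in auto)
    then have "real M / (2 * T ^ 5) \<le> real (card H)" using Xp by (simp add: field_simps)
    moreover have T6: "2 * T ^ 5 \<le> T ^ 6"
      using T mult_right_mono[of 2 T "T ^ 5"] by (simp flip: power_Suc)
    moreover have "real M / T ^ 6 \<le> real M / (2 * T ^ 5)" using T6 T by (intro divide_left_mono) auto
    ultimately have cH: "real M / T ^ 6 \<le> real (card H)" by linarith
    have finH: "finite H" unfolding H_def I_def by simp
    define P where "P = (\<lambda>m q. \<forall>j. near (T ^ E1 * (real M / real X) ^ k j) (real q * (\<alpha> j * (real m ^ k j - real m' ^ k j))))"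
    have "\<exists>q::nat. 1 \<le> q \<and> real q \<le> T ^ E1 \<and> P m q" if m: "m \<in> H" for m
    proof -
      define N where "N = X div (max m m')"
      have mI: "m \<in> I" using m H_def by blast
      have "real X / (T ^ 6 * real M) \<le> real X / (2 * T ^ 5 * real M)" using T6 T Mp by (intro divide_left_mono mult_right_mono) auto
      also have "\<dots> \<le> cmod (W m m')" using m unfolding H_def by (simp add: cI mult_ac)
      finally have Wbig: "real X / (T ^ 6 * real M) \<le> cmod (W m m')" .
      then have Nbig: "real X / (T ^ 6 * real M) \<le> real N" using Wle[of m m'] unfolding N_def by linarith
      moreover have "0 < real X / (T ^ 6 * real M)" using Xp T Mp by simp
      ultimately have Np: "0 < real N" by linarith
      have "real N / T ^ 6 \<le> real X / real M / T ^ 6" using divle[OF mI] T unfolding N_def by (intro divide_right_mono) auto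
      also have "\<dots> = real X / (T ^ 6 * real M)" by (simp add: mult.commute)
      also note Wbig
      finally have "real N / T ^ 6 \<le> cmod (\<Sum>n\<in>{1..N}. add_char (phase k (\<lambda>j. \<alpha> j * (real m ^ k j - real m' ^ k j)) n))"
        unfolding Weq N_def .
      moreover have "2 \<le> T ^ 6" using Tp[of 1 6] T by simp
      ultimately have "rational_approx k (\<lambda>j. \<alpha> j * (real m ^ k j - real m' ^ k j)) N ((T ^ 6) ^ C0)"
        using Np by (intro C0[unfolded weyl_system_exponent_def, rule_format, of "T ^ 6" N]) auto
      then obtain q :: nat where q: "1 \<le> q" "real q \<le> (T ^ 6) ^ C0"
        and qn: "\<And>j. near ((T ^ 6) ^ C0 / real N ^ k j) (real q * (\<alpha> j * (real m ^ k j - real m' ^ k j)))" by blast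
      have "P m q" unfolding P_def
      proof
        fix j
        have "(real X / (T ^ 6 * real M)) ^ k j \<le> real N ^ k j" using Nbig Xp T Mp by (intro power_mono) auto
        then have "(T ^ 6) ^ C0 / real N ^ k j \<le> (T ^ 6) ^ C0 / (real X / (T ^ 6 * real M)) ^ k j"
          using Np Xp T Mp by (intro divide_left_mono) auto
        also have "\<dots> = T ^ (6 * C0 + 6 * k j) * (real M / real X) ^ k j"
          by (simp add: power_divide power_add power_mult power_mult_distrib)
        also have "\<dots> \<le> T ^ E1 * (real M / real X) ^ k j"
          using dk by (intro mult_right_mono Tp) (auto simp: E1_def)
        finally show "near (T ^ E1 * (real M / real X) ^ k j) (real q * (\<alpha> j * (real m ^ k j - real m' ^ k j)))"
          using near_mono[OF qn] by blast
      qed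
      moreover have "(T ^ 6) ^ C0 \<le> T ^ E1" using Tp[of "6 * C0" E1] by (simp add: E1_def power_mult)
      ultimately show ?thesis using q by force
    qed
    then have "\<exists>q::nat. 1 \<le> q \<and> real q \<le> T ^ E1 \<and> real (card H) / T ^ E1 \<le> real (card {m\<in>H. P m q})"
      using finH T1 by (intro pigeonhole_multiplier) auto
    then obtain q :: nat where q: "1 \<le> q" "real q \<le> T ^ E1" and cq: "real (card H) / T ^ E1 \<le> real (card {m\<in>H. P m q})" by blast
    \<comment> \<open>The recurrence counts in an interval starting at 1, so the set is viewed
      inside \<open>{1..2*M}\<close>; the halved density costs one more factor
      \<open>T\<close>.\<close>
    have "real (2 * M) / T ^ (7 + E1) = 2 / T * (real M / T ^ 6 / T ^ E1)"
      using T by (simp add: power_add eval_nat_numeral)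
    also have "\<dots> \<le> 1 * (real M / T ^ 6 / T ^ E1)" using T by (intro mult_right_mono) auto
    also have "\<dots> \<le> real (card H) / T ^ E1" unfolding mult_1 using cH T by (intro divide_right_mono) auto
    also note cq
    finally have c2: "real (2 * M) / T ^ (7 + E1) \<le> real (card {m\<in>H. P m q})" .
    have "\<exists>r::nat. 1 \<le> r \<and> real r \<le> T ^ E2 \<and> near (T ^ E2 / real X ^ k j) (real r * (real q * \<alpha> j))" for j
    proof -
      define \<epsilon> where "\<epsilon> = T ^ E1 * (real M / real X) ^ k j"
      have sub: "{m\<in>H. P m q} \<subseteq> {n\<in>{1..2*M}. near \<epsilon> ((real q * \<alpha> j) * real n ^ k j - real q * \<alpha> j * real m' ^ k j)}"
        unfolding H_def I_def P_def \<epsilon>_def by (auto simp: algebra_simps)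
      have "card {m\<in>H. P m q} \<le> card {n\<in>{1..2*M}. near \<epsilon> ((real q * \<alpha> j) * real n ^ k j - real q * \<alpha> j * real m' ^ k j)}"
        by (rule card_mono[OF _ sub]) simp
      then have c3: "real (2 * M) / T ^ (7 + E1) \<le> real (card {n\<in>{1..2*M}. near \<epsilon> ((real q * \<alpha> j) * real n ^ k j - real q * \<alpha> j * real m' ^ k j)})"
        using c2 by linarith
      have pw: "(T ^ (7 + E1)) ^ C1 = T ^ ((7 + E1) * C1)" by (rule power_mult[symmetric])
      have eE: "\<epsilon> * (T ^ (7 + E1)) ^ C1 = T ^ E2 * (real M / real X) ^ k j"
        unfolding pw \<epsilon>_def E2_def by (simp add: power_add)
      \<comment> \<open>Positivity of \<open>k j\<close> enters: \<epsilon> contains at least one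
        factor \<open>M / X\<close>, which \<open>T ^ C * M \<le> X\<close> makes small.\<close>
      have "(real M / real X) ^ k j \<le> (real M / real X) ^ 1"
        using k0[of j] XM Xp by (intro power_decreasing) auto
      then have "\<epsilon> * (T ^ (7 + E1)) ^ C1 \<le> T ^ E2 * (real M / real X)"
        unfolding eE using T by (intro mult_left_mono) auto
      also have "\<dots> \<le> T ^ C * (real M / real X)" using E2C by (intro mult_right_mono Tp) auto
      also have "\<dots> \<le> 1" using MX Xp by (simp add: field_simps)
      finally have small: "\<epsilon> * (T ^ (7 + E1)) ^ C1 \<le> 1" .
      have le: "(T ^ (7 + E1)) ^ C1 \<le> T ^ E2" unfolding pw by (rule Tp) (simp add: E2_def)
      have "T ^ E2 \<le> T ^ C" by (rule Tp[OF E2C])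
      then have "(T ^ (7 + E1)) ^ C1 \<le> real (2 * M)" using le M by simp
      moreover have "2 \<le> T ^ (7 + E1)" using Tp[of 1 "7 + E1"] T by simp
      moreover have "0 \<le> \<epsilon>" unfolding \<epsilon>_def using T by simp
      ultimately have "\<exists>r::nat. 1 \<le> r \<and> real r \<le> (T ^ (7 + E1)) ^ C1 \<and> near (\<epsilon> * (T ^ (7 + E1)) ^ C1 / real (2 * M) ^ k j) (real r * (real q * \<alpha> j))"
        using small c3 dk k0[of j] by (intro C1[unfolded monomial_recurrence_exponent_def, rule_format, where \<gamma> = "real q * \<alpha> j * real m' ^ k j"]) auto
      then obtain r :: nat where r: "1 \<le> r" "real r \<le> (T ^ (7 + E1)) ^ C1"
        "near (\<epsilon> * (T ^ (7 + E1)) ^ C1 / real (2 * M) ^ k j) (real r * (real q * \<alpha> j))" by blast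
      \<comment> \<open>The two scales multiply: the factor \<open>M ^ k j\<close> in \<epsilon>
        cancels against the recurrence in \<open>m\<close>, and the error is measured by
        \<open>X ^ k j\<close>.\<close>
      have "\<epsilon> * (T ^ (7 + E1)) ^ C1 / real (2 * M) ^ k j \<le> \<epsilon> * (T ^ (7 + E1)) ^ C1 / real M ^ k j"
        using Mp T by (intro divide_left_mono power_mono) (auto simp: eE)
      also have "\<dots> = T ^ E2 / real X ^ k j" unfolding eE using Mp by (simp add: power_divide)
      finally show ?thesis using r le near_mono order_trans by blast
    qed
    then obtain r :: "'t \<Rightarrow> nat" where r: "\<And>j. 1 \<le> r j" "\<And>j. real (r j) \<le> T ^ E2"
      "\<And>j. near (T ^ E2 / real X ^ k j) (real (r j) * (real q * \<alpha> j))" by metis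
    from near_common_multiplier[where r = r and D = "T ^ E2" and e = "\<lambda>j. T ^ E2 / real X ^ k j"
        and x = "\<lambda>j. real q * \<alpha> j", OF r] obtain R :: nat where R: "1 \<le> R" "real R \<le> (T ^ E2) ^ CARD('t)"
      "\<And>j. near ((T ^ E2) ^ CARD('t) * (T ^ E2 / real X ^ k j)) (real R * (real q * \<alpha> j))" by blast
    have "real (R * q) \<le> (T ^ E2) ^ CARD('t) * T ^ E1" using R q T by (simp, intro mult_mono) auto
    also have "\<dots> = T ^ (E2 * CARD('t) + E1)" by (simp add: power_add power_mult)
    also have "\<dots> \<le> T ^ C" by (rule Tp) (simp add: C_def)
    finally have Rq: "real (R * q) \<le> T ^ C" .
    have "near (T ^ C / real X ^ k j) (real (R * q) * \<alpha> j)" for j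
    proof -
      have "(T ^ E2) ^ CARD('t) * (T ^ E2 / real X ^ k j) = T ^ (E2 * CARD('t) + E2) / real X ^ k j"
        by (simp add: power_add power_mult)
      also have "\<dots> \<le> T ^ C / real X ^ k j" by (intro divide_right_mono Tp) (auto simp: C_def)
      finally show ?thesis using near_mono[OF R(3)] by (simp add: mult_ac)
    qed
    moreover have "1 \<le> R * q" using R q by (simp add: Suc_le_eq)
    ultimately show "rational_approx k \<alpha> X (T ^ C)"
      using Rq by blast
  qed
qed

section \<open>Vaughan's identity and divisor sums\<close>

definition moebius :: "nat \<Rightarrow> complex" where
  "moebius n = (if squarefree n then (-1) ^ card (prime_factors n) else 0)"

lemma norm_moebius_le: "cmod (moebius n) \<le> 1"
  unfolding moebius_def by (simp add: norm_power)

lemma moebius_prime_times: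
  assumes p: "prime p" and d: "squarefree d" "\<not> p dvd d"
  shows "moebius (p * d) = - moebius d"
proof -
  have d0: "d \<noteq> 0" using d(2) by (metis dvd_0_right)
  have "coprime p d" using p d by (simp add: prime_imp_coprime)
  then have sq: "squarefree (p * d)" using p d by (simp add: squarefree_mult_coprime squarefree_prime)
  have "prime_factors (p * d) = insert p (prime_factors d)"
    using p d0 by (subst prime_factors_product) (auto simp: prime_prime_factors dest: prime_gt_0_nat)
  moreover have "p \<notin> prime_factors d" using d by auto
  ultimately show ?thesis using d sq unfolding moebius_def by simp
qed

text \<open>For a prime \<open>p\<close> dividing \<open>n\<close>, the squarefree divisors
  \<open>d\<close> prime to \<open>p\<close> are paired with the divisors \<open>p * d\<close>,
  where the sign is opposite.\<close>

lemma sum_moebius_divisors: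
  assumes n: "n > 0"
  shows "(\<Sum>d | d dvd n. moebius d) = (if n = 1 then 1 else 0)"
proof (cases "n = 1")
  case True
  then show ?thesis by (simp add: moebius_def)
next
  case False
  then obtain p where p: "prime p" "p dvd n" using prime_factor_nat by blast
  define A where "A = {d. d dvd n \<and> squarefree d \<and> \<not> p dvd d}"
  define B where "B = {d. d dvd n \<and> squarefree d \<and> p dvd d}"
  have fin: "finite {d. d dvd n}" using n by simp
  have finAB: "finite A" "finite B" by (rule finite_subset[OF _ fin]; auto simp: A_def B_def)+
  have p0: "p > 0" using p prime_gt_0_nat by blast
  have "(\<Sum>d | d dvd n. moebius d) = (\<Sum>d\<in>A \<union> B. moebius d)"
    using fin by (intro sum.mono_neutral_right) (auto simp: A_def B_def moebius_def)
  also have "\<dots> = sum moebius A + sum moebius B"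
    using finAB by (intro sum.union_disjoint) (auto simp: A_def B_def)
  also have "sum moebius B = (\<Sum>d\<in>A. - moebius d)"
  proof (rule sum.reindex_bij_witness[of _ "\<lambda>d. p * d" "\<lambda>d. d div p"])
    fix d assume d: "d \<in> B"
    then obtain e where e: "d = p * e" unfolding B_def by auto
    have "\<not> p dvd e"
    proof
      assume "p dvd e"
      then have "p ^ 2 dvd d" using e by (simp add: power2_eq_square)
      then have "p dvd 1" using d squarefreeD unfolding B_def by blast
      then show False using p by (metis not_prime_unit)
    qed
    moreover have "squarefree e" "e dvd n"
      using d e squarefree_mono[of e d] unfolding B_def by (auto intro: dvd_trans[of e "p * e"])
    ultimately show "d div p \<in> A" "p * (d div p) = d" "- moebius (d div p) = moebius d"
      using e p0 moebius_prime_times[OF p(1), of e] unfolding A_def by auto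
  next
    fix d assume d: "d \<in> A"
    then have co: "coprime p d" using p unfolding A_def by (simp add: prime_imp_coprime)
    then have "p * d dvd n" using d p unfolding A_def by (simp add: divides_mult)
    then show "p * d \<in> B"
      using co d p unfolding A_def B_def by (simp add: squarefree_mult_coprime squarefree_prime)
    show "p * d div p = d" using p0 by simp
  qed
  finally show ?thesis using False by (simp add: sum_negf)
qed

section \<open>Rearranging sums over divisors\<close>

lemma sum_divisor_pairs:
  fixes h :: "nat \<Rightarrow> nat \<Rightarrow> 'a::comm_monoid_add"
  shows "(\<Sum>n\<in>{1..X}. \<Sum>d | d dvd n. h d n) = (\<Sum>d\<in>{1..X}. \<Sum>m\<in>{1..X div d}. h d (d * m))"
proof -
  have "(\<Sum>n\<in>{1..X}. \<Sum>d | d dvd n. h d n) = (\<Sum>(n, d)\<in>(SIGMA n:{1..X}. {d. d dvd n}). h d n)"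
    by (rule sum.Sigma) auto
  also have "\<dots> = (\<Sum>(d, m)\<in>(SIGMA d:{1..X}. {1..X div d}). h d (d * m))"
  proof (rule sum.reindex_bij_witness[of _ "\<lambda>(d, m). (d * m, d)" "\<lambda>(n, d). (d, n div d)"])
    fix x :: "nat \<times> nat" assume "x \<in> (SIGMA n:{1..X}. {d. d dvd n})"
    then obtain d e where x: "x = (d * e, d)" "1 \<le> d * e" "d * e \<le> X" by (auto elim!: dvdE)
    then have "1 \<le> d" "1 \<le> e" by (simp_all add: Suc_le_eq)
    moreover have "e \<le> X div d" using x(3) \<open>1 \<le> d\<close> by (simp add: less_eq_div_iff_mult_less_eq mult.commute)
    moreover have "d \<le> X" using x(3) \<open>1 \<le> e\<close> by (metis le_trans mult_le_mono2 mult_1_right)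
    ultimately show "(case case x of (n, d) \<Rightarrow> (d, n div d) of (d, m) \<Rightarrow> (d * m, d)) = x"
      "(case x of (n, d) \<Rightarrow> (d, n div d)) \<in> (SIGMA d:{1..X}. {1..X div d})"
      "(case case x of (n, d) \<Rightarrow> (d, n div d) of (d, m) \<Rightarrow> h d (d * m)) = (case x of (n, d) \<Rightarrow> h d n)"
      using x by auto
  next
    fix x :: "nat \<times> nat" assume "x \<in> (SIGMA d:{1..X}. {1..X div d})"
    then obtain d m where x: "x = (d, m)" "1 \<le> d" "1 \<le> m" "m \<le> X div d" by auto
    then have "d * m \<le> X" by (simp add: less_eq_div_iff_mult_less_eq mult.commute)
    moreover have "1 \<le> d * m" using x by (simp add: Suc_le_eq)
    ultimately show "(case case x of (d, m) \<Rightarrow> (d * m, d) of (n, d) \<Rightarrow> (d, n div d)) = x"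
      "(case x of (d, m) \<Rightarrow> (d * m, d)) \<in> (SIGMA n:{1..X}. {d. d dvd n})" using x by auto
  qed
  also have "\<dots> = (\<Sum>d\<in>{1..X}. \<Sum>m\<in>{1..X div d}. h d (d * m))" by (rule sum.Sigma[symmetric]) auto
  finally show ?thesis .
qed

lemma sum_hyperbola_swap:
  fixes h :: "nat \<Rightarrow> nat \<Rightarrow> 'a::comm_monoid_add"
  shows "(\<Sum>c\<in>{1..X}. \<Sum>b\<in>{1..X div c}. h c b) = (\<Sum>b\<in>{1..X}. \<Sum>c\<in>{1..X div b}. h c b)"
proof -
  have eq: "{1..X div c} = {b\<in>{1..X}. b * c \<le> X}" if "c \<in> {1..X}" for c
  proof -
    have "b \<le> X div c \<longleftrightarrow> b * c \<le> X" for b using that by (simp add: less_eq_div_iff_mult_less_eq)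
    moreover have "b \<le> X" if "b * c \<le> X" for b using \<open>c \<in> _\<close> that by (metis atLeastAtMost_iff le_trans mult_le_mono2 mult_1_right)
    ultimately show ?thesis by auto
  qed
  have "(\<Sum>c\<in>{1..X}. \<Sum>b\<in>{1..X div c}. h c b) = (\<Sum>c\<in>{1..X}. \<Sum>b\<in>{b\<in>{1..X}. b * c \<le> X}. h c b)"
    by (intro sum.cong eq refl)
  also have "\<dots> = (\<Sum>b\<in>{1..X}. \<Sum>c\<in>{c\<in>{1..X}. b * c \<le> X}. h c b)" by (rule sum.swap_restrict) auto
  also have "\<dots> = (\<Sum>b\<in>{1..X}. \<Sum>c\<in>{1..X div b}. h c b)"
    by (intro sum.cong refl) (use eq in \<open>simp add: mult.commute\<close>)
  finally show ?thesis .
qed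

text \<open>With \<open>*\<close> for Dirichlet convolution this is the sum of \<open>F n\<close>
  over \<open>n \<le> X\<close> weighted by \<open>h * g * 1\<close>. It is bilinear in
  \<open>g\<close> and \<open>h\<close>.\<close>

definition triple_sum :: "nat \<Rightarrow> (nat \<Rightarrow> complex) \<Rightarrow> (nat \<Rightarrow> complex) \<Rightarrow> (nat \<Rightarrow> complex) \<Rightarrow> complex" where
  "triple_sum X F g h = (\<Sum>c\<in>{1..X}. h c * (\<Sum>b\<in>{1..X div c}. g b * (\<Sum>r\<in>{1..X div c div b}. F (c * b * r))))"

lemma triple_sum_diff_left: "triple_sum X F (\<lambda>b. g b - g' b) h = triple_sum X F g h - triple_sum X F g' h"
  unfolding triple_sum_def by (simp add: left_diff_distrib right_diff_distrib sum_subtractf)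

lemma triple_sum_diff_right: "triple_sum X F g (\<lambda>c. h c - h' c) = triple_sum X F g h - triple_sum X F g h'"
  unfolding triple_sum_def by (simp add: left_diff_distrib sum_subtractf)

text \<open>Grouping \<open>b * r\<close> into one variable \<open>n\<close> gives a bilinear sum in
  \<open>c\<close> and \<open>n\<close>, the shape in which the type II estimate will be
  applied.\<close>

lemma triple_sum_eq_divisor_sum:
  "triple_sum X F g h = (\<Sum>c\<in>{1..X}. h c * (\<Sum>n\<in>{1..X div c}. (\<Sum>b | b dvd n. g b) * F (c * n)))"
proof -
  have "(\<Sum>n\<in>{1..X div c}. (\<Sum>b | b dvd n. g b) * F (c * n)) =
      (\<Sum>b\<in>{1..X div c}. g b * (\<Sum>r\<in>{1..X div c div b}. F (c * b * r)))" for c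
    using sum_divisor_pairs[of "\<lambda>b n. g b * F (c * n)" "X div c"]
    by (simp add: sum_distrib_left sum_distrib_right mult_ac)
  then show ?thesis unfolding triple_sum_def by simp
qed

lemma triple_sum_moebius: "triple_sum X F moebius h = (\<Sum>c\<in>{1..X}. h c * F c)"
  unfolding triple_sum_eq_divisor_sum
proof (rule sum.cong)
  fix c assume c: "c \<in> {1..X}"
  then have "1 \<le> X div c" by (simp add: less_eq_div_iff_mult_less_eq)
  have "(\<Sum>n\<in>{1..X div c}. (\<Sum>b | b dvd n. moebius b) * F (c * n)) = (\<Sum>n\<in>{1..X div c}. if n = 1 then F c else 0)"
    by (intro sum.cong) (auto simp: sum_moebius_divisors)
  also have "\<dots> = F c" using \<open>1 \<le> X div c\<close> by (subst sum.delta) auto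
  finally show "h c * (\<Sum>n\<in>{1..X div c}. (\<Sum>b | b dvd n. moebius b) * F (c * n)) = h c * F c" by simp
qed simp

text \<open>Interchanging the two outer variables lets \<open>mangoldt\<close> be summed over the
  divisors of the remaining variable, which yields the smooth weight \<open>ln\<close>.\<close>

lemma triple_sum_mangoldt:
  "triple_sum X F g mangoldt = (\<Sum>b\<in>{1..X}. g b * (\<Sum>n\<in>{1..X div b}. of_real (ln (real n)) * F (b * n)))"
proof -
  have "triple_sum X F g mangoldt = (\<Sum>c\<in>{1..X}. \<Sum>b\<in>{1..X div c}. mangoldt c * (g b * (\<Sum>r\<in>{1..X div c div b}. F (c * b * r))))"
    unfolding triple_sum_def by (simp add: sum_distrib_left)
  also have "\<dots> = (\<Sum>b\<in>{1..X}. \<Sum>c\<in>{1..X div b}. mangoldt c * (g b * (\<Sum>r\<in>{1..X div c div b}. F (c * b * r))))"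
    by (rule sum_hyperbola_swap)
  also have "\<dots> = (\<Sum>b\<in>{1..X}. g b * (\<Sum>n\<in>{1..X div b}. (\<Sum>c | c dvd n. mangoldt c) * F (b * n)))"
  proof (rule sum.cong)
    fix b
    have "(\<Sum>n\<in>{1..X div b}. (\<Sum>c | c dvd n. mangoldt c) * F (b * n)) =
       (\<Sum>c\<in>{1..X div b}. mangoldt c * (\<Sum>r\<in>{1..X div c div b}. F (c * b * r)))"
      using sum_divisor_pairs[of "\<lambda>c n. mangoldt c * F (b * n)" "X div b"]
      by (simp add: sum_distrib_left sum_distrib_right mult_ac div_mult2_eq[symmetric])
    then show "(\<Sum>c\<in>{1..X div b}. mangoldt c * (g b * (\<Sum>r\<in>{1..X div c div b}. F (c * b * r)))) =
       g b * (\<Sum>n\<in>{1..X div b}. (\<Sum>c | c dvd n. mangoldt c) * F (b * n))"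
      by (simp add: sum_distrib_left mult_ac)
  qed simp
  also have "\<dots> = (\<Sum>b\<in>{1..X}. g b * (\<Sum>n\<in>{1..X div b}. of_real (ln (real n)) * F (b * n)))"
    by (intro sum.cong refl arg_cong2[where f = "(*)"]) (simp_all add: mangoldt_sum)
  finally show ?thesis .
qed

text \<open>By bilinearity from \<open>\<mu> * 1 = \<delta>\<close> and \<open>\<Lambda> * 1 = log\<close>.\<close>

lemma vaughan_identity:
  fixes U :: real
  defines "\<mu>1 \<equiv> (\<lambda>b. if real b \<le> U then moebius b else 0)"
    and "\<Lambda>1 \<equiv> (\<lambda>c. if real c \<le> U then mangoldt c else 0)"
  shows "(\<Sum>n\<in>{1..X}. mangoldt n * F n) = (\<Sum>n\<in>{1..X}. \<Lambda>1 n * F n)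
     + triple_sum X F \<mu>1 mangoldt - triple_sum X F \<mu>1 \<Lambda>1
     + triple_sum X F (\<lambda>b. moebius b - \<mu>1 b) (\<lambda>c. mangoldt c - \<Lambda>1 c)"
  unfolding triple_sum_diff_left triple_sum_diff_right triple_sum_moebius by simp

text \<open>Abel summation: the weight is increasing, so its boundary value and its total variation
  each contribute at most \<open>ln Y\<close>.\<close>

lemma norm_sum_ln_weights:
  fixes F :: "nat \<Rightarrow> complex"
  assumes "\<And>y. y \<le> Y \<Longrightarrow> cmod (\<Sum>n\<in>{1..y}. F n) \<le> B" and "Y \<ge> 1"
  shows "cmod (\<Sum>n\<in>{1..Y}. of_real (ln (real n)) * F n) \<le> 2 * ln (real Y) * B"
proof -
  define S where "S = (\<lambda>y. \<Sum>n\<in>{1..y}. F n)"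
  have abel: "(\<Sum>n\<in>{1..y}. of_real (ln (real n)) * F n) = of_real (ln (real y)) * S y
      - (\<Sum>n\<in>{1..<y}. of_real (ln (real (Suc n)) - ln (real n)) * S n)" if "y \<ge> 1" for y
    using that
  proof (induction y rule: dec_induct)
    case (step y)
    have "S (Suc y) = S y + F (Suc y)" unfolding S_def by simp
    moreover have "{1..<Suc y} = insert y {1..<y}" using step by auto
    ultimately show ?case using step.IH by (simp add: algebra_simps)
  qed (simp add: S_def)
  have B: "cmod (S y) \<le> B" if "y \<le> Y" for y using assms that unfolding S_def by blast
  have tel: "(\<Sum>n\<in>{1..<y}. ln (real (Suc n)) - ln (real n)) = ln (real y)" if "y \<ge> 1" for y
    using that
  proof (induction y rule: dec_induct)
    case (step y)
    have "{1..<Suc y} = insert y {1..<y}" using step by auto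
    then show ?case using step.IH by simp
  qed simp
  have "cmod (\<Sum>n\<in>{1..<Y}. of_real (ln (real (Suc n)) - ln (real n)) * S n) \<le> (\<Sum>n\<in>{1..<Y}. (ln (real (Suc n)) - ln (real n)) * B)"
  proof (rule sum_norm_le)
    fix n assume n: "n \<in> {1..<Y}"
    have "0 \<le> ln (real (Suc n)) - ln (real n)" using n by simp
    then show "cmod (of_real (ln (real (Suc n)) - ln (real n)) * S n) \<le> (ln (real (Suc n)) - ln (real n)) * B"
      using B[of n] n by (simp only: norm_mult norm_of_real abs_of_nonneg) (intro mult_left_mono, auto)
  qed
  also have "\<dots> = ln (real Y) * B" using tel[OF assms(2)] by (simp only: sum_distrib_right[symmetric])
  finally have 1: "cmod (\<Sum>n\<in>{1..<Y}. of_real (ln (real (Suc n)) - ln (real n)) * S n) \<le> ln (real Y) * B" .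
  have "cmod (of_real (ln (real Y)) * S Y) \<le> ln (real Y) * B"
    using B[of Y] assms(2) by (simp only: norm_mult norm_of_real) (intro mult_mono, auto)
  then show ?thesis unfolding abel[OF assms(2)]
    using norm_triangle_ineq4[of "of_real (ln (real Y)) * S Y" "\<Sum>n\<in>{1..<Y}. of_real (ln (real (Suc n)) - ln (real n)) * S n"] 1 by linarith
qed

section \<open>The divisor function in mean square, dyadic blocks, and prime powers\<close>

lemma harm_le_ln: "1 \<le> n \<Longrightarrow> harm n \<le> 1 + ln (real n)"
  using decseqD[OF decseq_harm_diff_ln, of 0 "n - 1"] by (simp add: harm_def)

text \<open>A pair of divisors \<open>a\<close>, \<open>b\<close> of \<open>n\<close> is encoded by
  \<open>g = gcd a b\<close> and the cofactors \<open>u\<close>, \<open>v\<close>; then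
  \<open>g * u * v\<close> is their lcm and divides \<open>n\<close>. Summing over \<open>n\<close>
  first bounds the total by the sum of \<open>N / (g * u * v)\<close>, which factors into three
  harmonic sums.\<close>

lemma sum_divisor_count_squared_le:
  assumes N: "1 \<le> N"
  shows "(\<Sum>n\<in>{1..N}. real (card {d. d dvd n}) ^ 2) \<le> real N * (1 + ln (real N)) ^ 3"
proof -
  define Q where "Q = {1..N} \<times> ({1..N} \<times> {1..N})"
  define w :: "nat \<times> nat \<times> nat \<Rightarrow> nat" where "w = (\<lambda>(g, u, v). g * u * v)"
  have finQ: "finite Q" unfolding Q_def by simp
  have le: "real (card {d. d dvd n}) ^ 2 \<le> real (card {x\<in>Q. w x dvd n})" if n: "n \<in> {1..N}" for n
  proof -
    have "{d. d dvd n} \<times> {d. d dvd n} \<subseteq> (\<lambda>(g, u, v). (g * u, g * v)) ` {x\<in>Q. w x dvd n}"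
    proof
      fix x assume "x \<in> {d. d dvd n} \<times> {d. d dvd n}"
      then obtain a b where ab: "x = (a, b)" "a dvd n" "b dvd n" by auto
      define g where "g = gcd a b"
      have pos: "a > 0" "b > 0" using ab n by (auto intro: Nat.gr0I)
      have g0: "g > 0" unfolding g_def using pos by simp
      obtain u v where uv: "a = g * u" "b = g * v" unfolding g_def by (metis dvdE gcd_dvd1 gcd_dvd2)
      have "g * (g * u * v) = g * lcm a b"
        using prod_gcd_lcm_nat[of a b] uv unfolding g_def[symmetric] by (simp add: mult_ac)
      then have "g * u * v = lcm a b" using g0 by simp
      moreover have "lcm a b dvd n" using ab by simp
      ultimately have dvd: "g * u * v dvd n" by simp
      have n0: "n > 0" "n \<le> N" using n by auto
      have "g dvd n" "u dvd n" "v dvd n"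
        using dvd_trans[OF _ dvd, of g] dvd_trans[OF _ dvd, of u] dvd_trans[OF _ dvd, of v] by simp_all
      then have "g \<le> N" "u \<le> N" "v \<le> N" using n0 dvd_imp_le le_trans by blast+
      moreover have "u > 0" "v > 0" using uv pos by auto
      ultimately have "(g, u, v) \<in> {x\<in>Q. w x dvd n}" using dvd g0 unfolding Q_def w_def by auto
      then show "x \<in> (\<lambda>(g, u, v). (g * u, g * v)) ` {x\<in>Q. w x dvd n}"
        using ab uv by force
    qed
    then have "card ({d. d dvd n} \<times> {d. d dvd n}) \<le> card ((\<lambda>(g, u, v). (g * u, g * v)) ` {x\<in>Q. w x dvd n})"
      using finQ by (intro card_mono) auto
    also have "\<dots> \<le> card {x\<in>Q. w x dvd n}" using finQ by (intro card_image_le) auto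
    finally have "card {d. d dvd n} ^ 2 \<le> card {x\<in>Q. w x dvd n}" by (simp add: card_cartesian_product power2_eq_square)
    then show ?thesis by (metis of_nat_mono of_nat_power)
  qed
  have "(\<Sum>n\<in>{1..N}. real (card {d. d dvd n}) ^ 2) \<le> (\<Sum>n\<in>{1..N}. real (card {x\<in>Q. w x dvd n}))"
    by (intro sum_mono le)
  also have "\<dots> = (\<Sum>n\<in>{1..N}. \<Sum>x\<in>{x\<in>Q. w x dvd n}. 1)" by simp
  also have "\<dots> = (\<Sum>x\<in>Q. \<Sum>n\<in>{n\<in>{1..N}. w x dvd n}. 1)"
    using finQ by (intro sum.swap_restrict) auto
  also have "\<dots> \<le> (\<Sum>x\<in>Q. real N / real (w x))"
  proof (rule sum_mono)
    fix x assume "x \<in> Q"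
    then have w0: "w x > 0" unfolding Q_def w_def by auto
    have "{n\<in>{1..N}. w x dvd n} \<subseteq> (\<lambda>m. w x * m) ` {1..N div w x}"
    proof
      fix n assume n: "n \<in> {n\<in>{1..N}. w x dvd n}"
      then obtain m where m: "n = w x * m" by auto
      then have "m \<le> N div w x" "1 \<le> m"
        using n w0 by (auto simp: less_eq_div_iff_mult_less_eq mult.commute Suc_le_eq)
      then show "n \<in> (\<lambda>m. w x * m) ` {1..N div w x}" using m by auto
    qed
    then have "card {n\<in>{1..N}. w x dvd n} \<le> card ((\<lambda>m. w x * m) ` {1..N div w x})" by (intro card_mono) auto
    also have "\<dots> \<le> N div w x" using card_image_le[of "{1..N div w x}"] by simp
    finally have "real (card {n\<in>{1..N}. w x dvd n}) \<le> real N / real (w x)"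
      using real_nat_div_le[of N "w x"] by linarith
    then show "(\<Sum>n\<in>{n\<in>{1..N}. w x dvd n}. 1) \<le> real N / real (w x)" by simp
  qed
  also have "\<dots> = real N * (\<Sum>g\<in>{1..N}. \<Sum>u\<in>{1..N}. \<Sum>v\<in>{1..N}. inverse (real g) * (inverse (real u) * inverse (real v)))"
    unfolding Q_def w_def sum.cartesian_product sum_distrib_left
    by (intro sum.cong) (auto simp: divide_inverse mult_ac)
  also have "\<dots> = real N * harm N ^ 3"
    unfolding harm_def by (simp add: sum_distrib_left[symmetric] sum_distrib_right[symmetric] power3_eq_cube mult_ac)
  also have "\<dots> \<le> real N * (1 + ln (real N)) ^ 3"
    using harm_le_ln[OF N] by (intro mult_left_mono power_mono harm_nonneg) auto
  finally show ?thesis .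
qed

lemma dyadic_sum:
  fixes f :: "nat \<Rightarrow> 'a::comm_monoid_add"
  shows "(\<Sum>m\<in>{1<..2 ^ L}. f m) = (\<Sum>i<L. \<Sum>m\<in>{2 ^ i<..2 * 2 ^ i}. f m)"
proof (induction L)
  case (Suc L)
  have "{1<..2 ^ Suc L} = {1<..2 ^ L} \<union> {2 ^ L<..2 * 2 ^ L :: nat}"
    by (auto simp: le_less_trans[of "Suc 0" "2 ^ L"])
  then have "(\<Sum>m\<in>{1<..2 ^ Suc L}. f m) = (\<Sum>m\<in>{1<..2 ^ L} \<union> {2 ^ L<..2 * 2 ^ L}. f m)" by simp
  also have "\<dots> = (\<Sum>m\<in>{1<..2 ^ L}. f m) + (\<Sum>m\<in>{2 ^ L<..2 * 2 ^ L}. f m)"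
    by (rule sum.union_disjoint) auto
  finally show ?case using Suc by simp
qed simp

text \<open>A prime power up to \<open>X\<close> that is not a prime has base at most
  \<open>sqrt X\<close> and exponent at most \<open>L\<close>, so there are few, and each has weight
  at most \<open>ln X\<close>.\<close>

lemma prime_power_contribution_le:
  fixes F :: "nat \<Rightarrow> complex"
  assumes X: "1 \<le> X" and F: "\<And>n. cmod (F n) \<le> 1" and L: "X \<le> 2 ^ L"
  shows "cmod ((\<Sum>n\<in>{1..X}. mangoldt n * F n) - (\<Sum>p | prime p \<and> p \<le> X. of_real (ln (real p)) * F p))
    \<le> sqrt (real X) * real (Suc L) * ln (real X)"
proof -
  define A where "A = {n\<in>{1..X}. primepow n \<and> \<not> prime n}"
  have "(\<Sum>p | prime p \<and> p \<le> X. of_real (ln (real p)) * F p) = (\<Sum>p | prime p \<and> p \<le> X. mangoldt p * F p)"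
    by (intro sum.cong) auto
  moreover have "(\<Sum>n\<in>{1..X}. mangoldt n * F n) = (\<Sum>n\<in>A \<union> {p. prime p \<and> p \<le> X}. mangoldt n * F n)"
    by (rule sum.mono_neutral_right) (auto simp: A_def mangoldt_def Suc_le_eq prime_gt_0_nat)
  moreover have "\<dots> = (\<Sum>n\<in>A. mangoldt n * F n) + (\<Sum>p | prime p \<and> p \<le> X. mangoldt p * F p)"
    by (rule sum.union_disjoint) (auto simp: A_def)
  ultimately have eq: "(\<Sum>n\<in>{1..X}. mangoldt n * F n) - (\<Sum>p | prime p \<and> p \<le> X. of_real (ln (real p)) * F p) =
      (\<Sum>n\<in>A. mangoldt n * F n)" by simp
  have "cmod (\<Sum>n\<in>A. mangoldt n * F n) \<le> (\<Sum>n\<in>A. ln (real X))"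
  proof (rule sum_norm_le)
    fix n assume n: "n \<in> A"
    then have "n > 0" "n \<le> X" unfolding A_def by auto
    then have "mangoldt n \<le> ln (real X)" using mangoldt_le[of n] by (meson ln_le_cancel_iff of_nat_0_less_iff of_nat_mono order_less_le_trans order_trans)
    then have "mangoldt n * cmod (F n) \<le> ln (real X) * 1" using F X by (intro mult_mono) auto
    then show "cmod (mangoldt n * F n) \<le> ln (real X)" by (simp add: norm_mult)
  qed
  also have "\<dots> = real (card A) * ln (real X)" by simp
  also have "\<dots> \<le> (sqrt (real X) * real (Suc L)) * ln (real X)"
  proof (rule mult_right_mono)
    define s where "s = nat \<lfloor>sqrt (real X)\<rfloor>"
    have "A \<subseteq> (\<lambda>(p, a). p ^ a) ` ({1..s} \<times> {..L})"
    proof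
      fix n assume n: "n \<in> A"
      then obtain p a where pa: "prime p" "a > 0" "n = p ^ a" unfolding A_def primepow_def by auto
      have "a \<noteq> 1" using n pa unfolding A_def by auto
      then have a2: "2 \<le> a" using pa by simp
      have p2: "2 \<le> p" using pa prime_ge_2_nat by blast
      have nX: "n \<le> X" using n unfolding A_def by auto
      have "p ^ 2 \<le> p ^ a" using a2 p2 by (intro power_increasing) auto
      then have "real (p ^ 2) \<le> real X" using pa nX of_nat_mono order_trans by blast
      then have "real p \<le> sqrt (real X)" by (simp add: real_le_rsqrt)
      then have ps: "p \<le> s" unfolding s_def by linarith
      have "2 ^ a \<le> p ^ a" using p2 by (intro power_mono) auto
      then have "(2::nat) ^ a \<le> 2 ^ L" using pa nX L by linarith
      then have "a \<le> L" by simp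
      then show "n \<in> (\<lambda>(p, a). p ^ a) ` ({1..s} \<times> {..L})" using ps p2 pa by force
    qed
    then have "card A \<le> card ((\<lambda>(p, a). p ^ a) ` ({1..s} \<times> {..L}))" by (intro card_mono) auto
    also have "\<dots> \<le> card ({1..s} \<times> {..L})" by (intro card_image_le) auto
    also have "\<dots> = s * Suc L" by simp
    finally have "real (card A) \<le> real s * real (Suc L)" by (metis of_nat_mono of_nat_mult)
    also have "\<dots> \<le> sqrt (real X) * real (Suc L)" unfolding s_def by (intro mult_right_mono) auto
    finally show "real (card A) \<le> sqrt (real X) * real (Suc L)" .
  qed (use X in auto)
  finally show ?thesis unfolding eq .
qed

section \<open>Exponential sums over primes\<close>

definition type_I_exponent :: "('t::finite \<Rightarrow> nat) \<Rightarrow> nat \<Rightarrow> bool" where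
  "type_I_exponent k C \<longleftrightarrow> (\<forall>(\<alpha> :: 't \<Rightarrow> real) X m y (T::real). T \<ge> 2 \<longrightarrow> 1 \<le> X \<longrightarrow> y \<le> X \<longrightarrow> 1 \<le> m \<longrightarrow> real m \<le> T \<longrightarrow>
     real X / T \<le> cmod (\<Sum>r\<in>{1..y}. add_char (phase k \<alpha> (m * r))) \<longrightarrow>
     (rational_approx k \<alpha> X (T ^ C)))"

text \<open>The fixed factor \<open>m\<close> is moved into the coefficients, giving a Weyl sum with
  coefficients \<open>\<alpha> j * m ^ k j\<close>; a large value forces
  \<open>y \<ge> X / T\<close>, so scales in \<open>y\<close> and in \<open>X\<close> are
  comparable. Multiplying \<open>q\<close> by \<open>m ^ d\<close> instead of \<open>m ^ k j\<close>
  yields one denominator for all coordinates.\<close>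

lemma type_I_estimate:
  fixes k :: "'t::finite \<Rightarrow> nat"
  assumes inj: "inj k" and k0: "\<And>j. k j > 0"
  shows "\<exists>C. type_I_exponent k C"
proof -
  from weyl_system[OF inj k0] obtain C0 where C0: "weyl_system_exponent k C0" ..
  define d where "d = exponent_sum k"
  have dk: "k j \<le> d" for j unfolding d_def by (rule exponent_le_sum)
  define C where "C = C0 + 2 * d"
  show ?thesis unfolding type_I_exponent_def
  proof (rule exI[of _ C], intro allI impI)
    fix \<alpha> :: "'t \<Rightarrow> real" and X m y :: nat and T :: real
    assume T: "T \<ge> 2" and X: "1 \<le> X" and y: "y \<le> X" and m: "1 \<le> m" "real m \<le> T"
      and big: "real X / T \<le> cmod (\<Sum>r\<in>{1..y}. add_char (phase k \<alpha> (m * r)))"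
    have Tp: "T ^ a \<le> T ^ b" if "a \<le> b" for a b using T that by (intro power_increasing) auto
    have eq: "phase k \<alpha> (m * r) = phase k (\<lambda>j. \<alpha> j * real m ^ k j) r" for r
      unfolding phase_def by (simp add: power_mult_distrib mult_ac)
    have "cmod (\<Sum>r\<in>{1..y}. add_char (phase k \<alpha> (m * r))) \<le> real y"
      using sum_norm_le[of "{1..y}" _ "\<lambda>_. 1"] by force
    then have yX: "real X / T \<le> real y" using big by linarith
    moreover have "0 < real X / T" using X T by simp
    ultimately have y0: "0 < real y" by linarith
    have "real y / T \<le> real X / T" using y T by (intro divide_right_mono) auto
    then have "real y / T \<le> cmod (\<Sum>r\<in>{1..y}. add_char (phase k (\<lambda>j. \<alpha> j * real m ^ k j) r))"
      using big unfolding eq by linarith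
    then have "rational_approx k (\<lambda>j. \<alpha> j * real m ^ k j) y (T ^ C0)"
      using T y0 by (intro C0[unfolded weyl_system_exponent_def, rule_format, of T y]) auto
    then obtain q :: nat where q: "1 \<le> q" "real q \<le> T ^ C0"
      and qn: "\<And>j. near (T ^ C0 / real y ^ k j) (real q * (\<alpha> j * real m ^ k j))" by blast
    have md: "real m ^ a \<le> T ^ d" if "a \<le> d" for a
    proof -
      have "real m ^ a \<le> T ^ a" using m by (intro power_mono) auto
      also have "\<dots> \<le> T ^ d" by (rule Tp[OF that])
      finally show ?thesis .
    qed
    have "near (T ^ C / real X ^ k j) (real (q * m ^ d) * \<alpha> j)" for j
    proof -
      have eq2: "real (q * m ^ d) * \<alpha> j = real (m ^ (d - k j)) * (real q * (\<alpha> j * real m ^ k j))"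
        using dk[of j] by (simp add: mult_ac flip: power_add)
      show ?thesis unfolding eq2
      proof (rule near_mult_le[OF qn])
        have "(real X / T) ^ k j \<le> real y ^ k j" using yX X T by (intro power_mono) auto
        then have "T ^ C0 / real y ^ k j \<le> T ^ C0 / (real X / T) ^ k j"
          using y0 X T by (intro divide_left_mono) auto
        also have "\<dots> = T ^ (C0 + k j) / real X ^ k j" by (simp add: power_divide power_add)
        also have "\<dots> \<le> T ^ (C0 + d) / real X ^ k j" using dk by (intro divide_right_mono Tp) auto
        finally have "real (m ^ (d - k j)) * (T ^ C0 / real y ^ k j) \<le> T ^ d * (T ^ (C0 + d) / real X ^ k j)"
          using md[of "d - k j"] T y0 by (intro mult_mono) auto
        also have "\<dots> = T ^ C / real X ^ k j" by (simp add: C_def power_add power_mult power2_eq_square mult_ac)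
        finally show "real (m ^ (d - k j)) * (T ^ C0 / real y ^ k j) \<le> T ^ C / real X ^ k j" .
      qed
    qed
    moreover have "real (q * m ^ d) \<le> T ^ C"
    proof -
      have "real q * real m ^ d \<le> T ^ C0 * T ^ d" using q md[of d] T by (intro mult_mono) auto
      also have "\<dots> = T ^ (C0 + d)" by (simp add: power_add)
      also have "\<dots> \<le> T ^ C" by (rule Tp) (simp add: C_def)
      finally show ?thesis by simp
    qed
    moreover have "1 \<le> q * m ^ d" using q m by (simp add: Suc_le_eq)
    ultimately show "rational_approx k \<alpha> X (T ^ C)" by blast
  qed
qed

text \<open>All terms of Vaughan's identity except the last have their coefficients supported on
  arguments up to \<open>U\<close>, leaving free inner sums over multiples of \<open>m\<close>. Here
  \<open>m = b\<close>, or \<open>m = c * b\<close> with both factors at most \<open>U\<close>;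
  hence the range \<open>U ^ 2\<close> in the hypothesis on these sums.\<close>

lemma norm_mangoldt_sum_le:
  fixes F :: "nat \<Rightarrow> complex" and U \<delta> :: real
  defines "\<mu>1 \<equiv> (\<lambda>b. if real b \<le> U then moebius b else 0)"
    and "\<Lambda>1 \<equiv> (\<lambda>c. if real c \<le> U then mangoldt c else 0)"
  assumes X: "1 \<le> X" and U: "1 \<le> U" and F: "\<And>n. cmod (F n) \<le> 1"
    and I: "\<And>m y. 1 \<le> m \<Longrightarrow> real m \<le> U ^ 2 \<Longrightarrow> y \<le> X \<Longrightarrow> cmod (\<Sum>r\<in>{1..y}. F (m * r)) \<le> \<delta>"
  shows "cmod (\<Sum>n\<in>{1..X}. mangoldt n * F n) \<le> U * ln (real X) + 2 * U * ln (real X) * \<delta> + U ^ 2 * ln (real X) * \<delta>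
     + cmod (triple_sum X F (\<lambda>b. moebius b - \<mu>1 b) (\<lambda>c. mangoldt c - \<Lambda>1 c))"
proof -
  define D where "D = {n\<in>{1..X}. real n \<le> U}"
  have finD: "finite D" unfolding D_def by simp
  have l0: "0 \<le> ln (real X)" using X by simp
  have \<delta>0: "0 \<le> \<delta>" using I[of 1 0] U by (simp add: one_le_power)
  have UU: "U \<le> U ^ 2" using U by (simp add: self_le_power)
  have "card D \<le> card {1..nat \<lfloor>U\<rfloor>}" unfolding D_def by (intro card_mono) (auto simp: le_nat_floor)
  then have "card D \<le> nat \<lfloor>U\<rfloor>" by simp
  then have cD: "real (card D) \<le> U" using U by linarith
  have sumD: "(\<Sum>n\<in>D. c) \<le> U * c" if "0 \<le> c" for c :: real
    using cD that by (simp add: mult_right_mono)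
  have mang: "cmod (mangoldt n :: complex) \<le> ln (real X)" if "n \<in> {1..X}" for n
  proof -
    have "mangoldt n \<le> ln (real n)" using that by (intro mangoldt_le) auto
    also have "\<dots> \<le> ln (real X)" using that by simp
    finally show ?thesis by simp
  qed
  have "(\<Sum>n\<in>{1..X}. \<Lambda>1 n * F n) = (\<Sum>n\<in>D. mangoldt n * F n)"
    by (rule sum.mono_neutral_cong_right) (auto simp: D_def \<Lambda>1_def)
  also have "cmod \<dots> \<le> (\<Sum>n\<in>D. ln (real X))"
  proof (rule sum_norm_le)
    fix n assume "n \<in> D"
    then have "cmod (mangoldt n :: complex) * cmod (F n) \<le> ln (real X) * 1"
      using mang F l0 unfolding D_def by (intro mult_mono) auto
    then show "cmod (mangoldt n * F n) \<le> ln (real X)" by (simp add: norm_mult)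
  qed
  also have "\<dots> \<le> U * ln (real X)" by (rule sumD[OF l0])
  finally have b1: "cmod (\<Sum>n\<in>{1..X}. \<Lambda>1 n * F n) \<le> U * ln (real X)" .
  have "triple_sum X F \<mu>1 mangoldt = (\<Sum>b\<in>D. moebius b * (\<Sum>n\<in>{1..X div b}. of_real (ln (real n)) * F (b * n)))"
    unfolding triple_sum_mangoldt by (rule sum.mono_neutral_cong_right) (auto simp: D_def \<mu>1_def)
  also have "cmod \<dots> \<le> (\<Sum>b\<in>D. 2 * ln (real X) * \<delta>)"
  proof (rule sum_norm_le)
    fix b assume b: "b \<in> D"
    have Y: "1 \<le> X div b" "X div b \<le> X" using b unfolding D_def by (auto simp: less_eq_div_iff_mult_less_eq)
    have "cmod (\<Sum>n\<in>{1..X div b}. of_real (ln (real n)) * F (b * n)) \<le> 2 * ln (real (X div b)) * \<delta>"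
    proof (rule norm_sum_ln_weights)
      fix y assume "y \<le> X div b"
      then show "cmod (\<Sum>n\<in>{1..y}. F (b * n)) \<le> \<delta>"
        using Y b UU unfolding D_def by (intro I) (simp_all only: mem_Collect_eq atLeastAtMost_iff, linarith+)
    qed (use Y in simp)
    also have "\<dots> \<le> 2 * ln (real X) * \<delta>"
      using ln_mono[OF of_nat_mono[OF Y(2)]] Y(1) \<delta>0 by (intro mult_right_mono mult_left_mono) auto
    finally have "cmod (moebius b) * cmod (\<Sum>n\<in>{1..X div b}. of_real (ln (real n)) * F (b * n)) \<le> 1 * (2 * ln (real X) * \<delta>)"
      using norm_moebius_le by (intro mult_mono) auto
    then show "cmod (moebius b * (\<Sum>n\<in>{1..X div b}. of_real (ln (real n)) * F (b * n))) \<le> 2 * ln (real X) * \<delta>"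
      by (simp add: norm_mult)
  qed
  also have "\<dots> \<le> U * (2 * ln (real X) * \<delta>)" using l0 \<delta>0 by (intro sumD) auto
  finally have b2: "cmod (triple_sum X F \<mu>1 mangoldt) \<le> 2 * U * ln (real X) * \<delta>" by simp
  have "triple_sum X F \<mu>1 \<Lambda>1 = (\<Sum>c\<in>D. mangoldt c * (\<Sum>b\<in>{1..X div c}. \<mu>1 b * (\<Sum>r\<in>{1..X div c div b}. F (c * b * r))))"
    unfolding triple_sum_def by (rule sum.mono_neutral_cong_right) (auto simp: D_def \<Lambda>1_def)
  also have "cmod \<dots> \<le> (\<Sum>c\<in>D. ln (real X) * (U * \<delta>))"
  proof (rule sum_norm_le)
    fix c assume c: "c \<in> D"
    define D' where "D' = {b\<in>{1..X div c}. real b \<le> U}"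
    have D'D: "D' \<subseteq> D"
    proof
      fix b assume "b \<in> D'"
      moreover have "X div c \<le> X" by simp
      ultimately show "b \<in> D" unfolding D'_def D_def by (auto intro: le_trans)
    qed
    have "(\<Sum>b\<in>{1..X div c}. \<mu>1 b * (\<Sum>r\<in>{1..X div c div b}. F (c * b * r))) =
        (\<Sum>b\<in>D'. moebius b * (\<Sum>r\<in>{1..X div c div b}. F (c * b * r)))"
      by (rule sum.mono_neutral_cong_right) (auto simp: D'_def \<mu>1_def)
    also have "cmod \<dots> \<le> (\<Sum>b\<in>D'. \<delta>)"
    proof (rule sum_norm_le)
      fix b assume b: "b \<in> D'"
      have "real c * real b \<le> U * U" using b c U unfolding D'_def D_def by (intro mult_mono) auto
      then have "real (c * b) \<le> U ^ 2" by (simp add: power2_eq_square)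
      moreover have "1 \<le> c * b" using b c unfolding D'_def D_def by (simp add: Suc_le_eq)
      moreover have "X div c div b \<le> X" using div_le_dividend le_trans by blast
      ultimately have "cmod (\<Sum>r\<in>{1..X div c div b}. F (c * b * r)) \<le> \<delta>" by (intro I)
      then have "cmod (moebius b) * cmod (\<Sum>r\<in>{1..X div c div b}. F (c * b * r)) \<le> 1 * \<delta>"
        using norm_moebius_le by (intro mult_mono) auto
      then show "cmod (moebius b * (\<Sum>r\<in>{1..X div c div b}. F (c * b * r))) \<le> \<delta>" by (simp add: norm_mult)
    qed
    also have "\<dots> \<le> (\<Sum>b\<in>D. \<delta>)" using D'D finD \<delta>0 by (intro sum_mono2) auto
    also have "\<dots> \<le> U * \<delta>" by (rule sumD[OF \<delta>0])
    finally have "cmod (\<Sum>b\<in>{1..X div c}. \<mu>1 b * (\<Sum>r\<in>{1..X div c div b}. F (c * b * r))) \<le> U * \<delta>" .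
    moreover have "cmod (mangoldt c :: complex) \<le> ln (real X)" using c unfolding D_def by (intro mang) auto
    ultimately show "cmod (mangoldt c * (\<Sum>b\<in>{1..X div c}. \<mu>1 b * (\<Sum>r\<in>{1..X div c div b}. F (c * b * r)))) \<le> ln (real X) * (U * \<delta>)"
      unfolding norm_mult using l0 by (intro mult_mono) auto
  qed
  also have "\<dots> \<le> U * (ln (real X) * (U * \<delta>))" using l0 \<delta>0 U by (intro sumD) auto
  finally have b3: "cmod (triple_sum X F \<mu>1 \<Lambda>1) \<le> U ^ 2 * ln (real X) * \<delta>" by (simp add: power2_eq_square mult_ac)
  have "cmod (\<Sum>n\<in>{1..X}. mangoldt n * F n) \<le> cmod (\<Sum>n\<in>{1..X}. \<Lambda>1 n * F n)
     + cmod (triple_sum X F \<mu>1 mangoldt) + cmod (triple_sum X F \<mu>1 \<Lambda>1)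
     + cmod (triple_sum X F (\<lambda>b. moebius b - \<mu>1 b) (\<lambda>c. mangoldt c - \<Lambda>1 c))"
    unfolding vaughan_identity[where X = X and F = F and U = U] \<mu>1_def \<Lambda>1_def
    by (meson add_mono norm_triangle_ineq norm_triangle_ineq4 order_refl order_trans)
  then show ?thesis using b1 b2 b3 by linarith
qed

text \<open>The lower bound on \<open>T\<close> in terms of \<open>ln X\<close> lets one factor
  \<open>T\<close> absorb a logarithm as well as the number of dyadic blocks.\<close>

definition prime_sum_exponent :: "('t::finite \<Rightarrow> nat) \<Rightarrow> nat \<Rightarrow> bool" where
  "prime_sum_exponent k C \<longleftrightarrow> (\<forall>(\<alpha> :: 't \<Rightarrow> real) X (T::real). 2 \<le> T \<longrightarrow> 2 * ln (real X) + 3 \<le> T \<longrightarrow> T ^ C \<le> real X \<longrightarrow>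
     real X / T \<le> cmod (\<Sum>p | prime p \<and> p \<le> X. of_real (ln (real p)) * add_char (phase k \<alpha> p)) \<longrightarrow>
     (rational_approx k \<alpha> X (T ^ C)))"

text \<open>Suppose that no approximation exists. Then all type I sums are small, so Vaughan's
  identity forces the bilinear part to be large, and so is one of its dyadic blocks. The type II
  estimate there yields an approximation after all.\<close>

lemma prime_sum_estimate:
  fixes k :: "'t::finite \<Rightarrow> nat"
  assumes inj: "inj k" and k0: "\<And>j. k j > 0"
  shows "\<exists>C. prime_sum_exponent k C"
proof -
  from type_I_estimate[OF inj k0] obtain C1 where C1: "type_I_exponent k C1" ..
  from type_II_estimate[OF inj k0] obtain C2 where C2: "type_II_exponent k C2" ..
  \<comment> \<open>The saving \<open>T ^ E\<close> in the type I sums must beat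
    \<open>U ^ 2\<close>, a logarithm and constants, with
    \<open>U ^ 2 \<le> T ^ (10 * C2 + 2)\<close>.\<close>
  define E where "E = 10 * C2 + 10"
  define C where "C = (E + 12) * (C1 + 1)"
  have EC: "E + 12 \<le> C" "E * C1 \<le> C" "5 * C2 \<le> C"
    by (simp_all add: C_def algebra_simps) (simp add: E_def)
  show ?thesis unfolding prime_sum_exponent_def
  proof (rule exI[of _ C], intro allI impI)
    fix \<alpha> :: "'t \<Rightarrow> real" and X :: nat and T :: real
    assume T: "2 \<le> T" and lnT: "2 * ln (real X) + 3 \<le> T" and XC: "T ^ C \<le> real X"
      and big: "real X / T \<le> cmod (\<Sum>p | prime p \<and> p \<le> X. of_real (ln (real p)) * add_char (phase k \<alpha> p))"
    have Tp: "T ^ a \<le> T ^ b" if "a \<le> b" for a b using T that by (intro power_increasing) auto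
    have T1: "1 \<le> T ^ a" for a using T by (simp add: one_le_power)
    have TX: "T ^ a \<le> real X" if "a \<le> C" for a using Tp[OF that] XC by linarith
    have X1: "1 \<le> X" using TX[of 0] by simp
    have X0: "0 < real X" using X1 by simp
    have l0: "0 \<le> ln (real X)" using X1 by simp
    have lT: "ln (real X) \<le> T" using lnT l0 by linarith
    show "rational_approx k \<alpha> X (T ^ C)"
    proof (rule ccontr)
      assume no: "\<not> ?thesis"
      have no': False if "1 \<le> q" "real q \<le> T ^ a" "\<forall>j. near (T ^ a / real X ^ k j) (real q * \<alpha> j)" "a \<le> C" for q a
      proof -
        have "near (T ^ C / real X ^ k j) (real q * \<alpha> j)" for j
          by (rule near_mono[OF that(3)[rule_format]]) (use that(4) in \<open>intro divide_right_mono Tp, auto\<close>)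
        then show False using no that(1,2) Tp[OF that(4)] order_trans by blast
      qed
      define F where "F = (\<lambda>n. add_char (phase k \<alpha> n))"
      have F1: "cmod (F n) \<le> 1" for n unfolding F_def by simp
      \<comment> \<open>Chosen so that the support conditions of the bilinear part, both arguments
        beyond \<open>U\<close>, give the range of the type II estimate at \<open>T ^ 5\<close>. The
        factor 2 covers the passage from \<open>m\<close> in \<open>{M<..2*M}\<close> to
        \<open>M\<close>.\<close>
      define U where "U = 2 * T ^ (5 * C2)"
      define \<delta> where "\<delta> = real X / T ^ E"
      have U1: "1 \<le> U" unfolding U_def using T1[of "5 * C2"] by linarith
      have "U \<le> T * T ^ (5 * C2)" unfolding U_def using T by (intro mult_right_mono) auto
      then have UT: "U \<le> T ^ (5 * C2 + 1)" by simp
      have "U ^ 2 \<le> (T ^ (5 * C2 + 1)) ^ 2" using UT U1 by (intro power_mono) auto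
      also have "\<dots> = T ^ (10 * C2 + 2)"
        unfolding power_mult[symmetric] by (rule arg_cong[where f = "\<lambda>x. T ^ x"]) simp
      finally have U2T: "U ^ 2 \<le> T ^ (10 * C2 + 2)" .
      define \<mu>2 where "\<mu>2 = (\<lambda>b. moebius b - (if real b \<le> U then moebius b else 0))"
      define \<Lambda>2 where "\<Lambda>2 = (\<lambda>c. mangoldt c - (if real c \<le> U then mangoldt c else 0) :: complex)"
      have typeI: "cmod (\<Sum>r\<in>{1..y}. F (m * r)) \<le> \<delta>" if m: "1 \<le> m" "real m \<le> U ^ 2" and y: "y \<le> X" for m y
      proof (rule ccontr)
        assume "\<not> ?thesis"
        then have "real X / T ^ E \<le> cmod (\<Sum>r\<in>{1..y}. add_char (phase k \<alpha> (m * r)))" unfolding F_def \<delta>_def by simp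
        moreover have "2 \<le> T ^ E" using Tp[of 1 E] T by (simp add: E_def)
        moreover have "real m \<le> T ^ E" using m U2T Tp[of "10 * C2 + 2" E] by (simp add: E_def)
        ultimately have "rational_approx k \<alpha> X ((T ^ E) ^ C1)"
          using X1 y m by (intro C1[unfolded type_I_exponent_def, rule_format, of "T ^ E" X y m \<alpha>]) auto
        then show False using no' EC(2) by (simp only: power_mult[symmetric]) blast
      qed
      obtain L where L: "X \<le> 2 ^ L" "real (Suc L) \<le> T"
      proof
        define L where "L = nat \<lceil>log 2 (real X)\<rceil>"
        have "0 \<le> log 2 (real X)" using X1 by simp
        then have L: "log 2 (real X) \<le> real L" "real L \<le> log 2 (real X) + 1" unfolding L_def by linarith+
        have "real X = 2 powr (log 2 (real X))" using X0 by simp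
        also have "\<dots> \<le> 2 powr (real L)" using L by simp
        also have "\<dots> = real (2 ^ L)" by (simp add: powr_realpow)
        finally show "X \<le> 2 ^ L" by (simp only: of_nat_le_iff)
        have "ln 2 \<ge> (1/2 :: real)" using ln2_ge_two_thirds by simp
        then have "ln (real X) / ln 2 \<le> ln (real X) / (1 / 2)" using l0 by (intro divide_left_mono) auto
        then have "log 2 (real X) \<le> 2 * ln (real X)" by (simp add: log_def)
        then show "real (Suc L) \<le> T" using L lnT by simp
      qed
      have X8: "c * T ^ a \<le> real X" if "c \<le> T ^ b" "a + b \<le> C" for c :: real and a b
      proof -
        have "c * T ^ a \<le> T ^ b * T ^ a" using that T by (intro mult_right_mono) auto
        also have "\<dots> = T ^ (a + b)" by (simp add: power_add)
        finally show ?thesis using TX[OF that(2)] by linarith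
      qed
      have T8: "8 \<le> T ^ 3" using const_le_power[OF T, of 8 3] by simp
      have pp: "cmod ((\<Sum>n\<in>{1..X}. mangoldt n * F n) - (\<Sum>p | prime p \<and> p \<le> X. of_real (ln (real p)) * F p)) \<le> real X / (8 * T)"
      proof -
        have "cmod ((\<Sum>n\<in>{1..X}. mangoldt n * F n) - (\<Sum>p | prime p \<and> p \<le> X. of_real (ln (real p)) * F p)) \<le> sqrt (real X) * real (Suc L) * ln (real X)"
          by (rule prime_power_contribution_le[OF X1 F1 L(1)])
        also have "\<dots> \<le> sqrt (real X) * T * T" using L lT l0 T by (intro mult_mono) auto
        also have "\<dots> \<le> real X / (8 * T)"
        proof -
          have "(8 * T ^ 3) ^ 2 \<le> (T ^ 3 * T ^ 3) ^ 2" using T8 T by (intro power_mono mult_right_mono) auto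
          also have "\<dots> = T ^ 12" by (simp flip: power_add power_mult)
          also have "\<dots> \<le> real X" using EC by (intro TX) auto
          finally have "8 * T ^ 3 \<le> sqrt (real X)" by (rule real_le_rsqrt)
          then have "sqrt (real X) * (8 * T ^ 3) \<le> sqrt (real X) * sqrt (real X)" by (intro mult_left_mono) auto
          then have "sqrt (real X) * (8 * T ^ 3) \<le> real X" by simp
          then show ?thesis using T by (simp add: field_simps eval_nat_numeral)
        qed
        finally show ?thesis .
      qed
      have m1: "U * ln (real X) \<le> real X / (8 * T)"
      proof -
        have "U * ln (real X) \<le> T ^ (5 * C2 + 1) * T" using UT lT l0 U1 T by (intro mult_mono) auto
        then have "U * ln (real X) * (8 * T) \<le> T ^ (5 * C2 + 1) * T * (8 * T)" using T by (intro mult_right_mono) auto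
        also have "\<dots> = 8 * T ^ (5 * C2 + 3)" by (simp add: power_add eval_nat_numeral)
        also have "\<dots> \<le> real X" using EC by (intro X8[OF T8]) (auto simp: E_def)
        finally show ?thesis using T by (simp add: field_simps)
      qed
      have \<delta>0: "0 \<le> \<delta>" unfolding \<delta>_def using T by simp
      have m2: "2 * U * ln (real X) * \<delta> + U ^ 2 * ln (real X) * \<delta> \<le> real X / (4 * T)"
      proof -
        have "U * (ln (real X) * \<delta>) \<le> U ^ 2 * (ln (real X) * \<delta>)"
          using U1 l0 \<delta>0 by (intro mult_right_mono) (auto simp: self_le_power)
        then have "2 * U * ln (real X) * \<delta> + U ^ 2 * ln (real X) * \<delta> \<le> 3 * (U ^ 2 * ln (real X) * \<delta>)"
          by (simp only: mult.assoc)
        also have "\<dots> \<le> 3 * (T ^ (10 * C2 + 2) * T * \<delta>)"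
          using U2T lT l0 T \<delta>0 by (intro mult_left_mono mult_right_mono mult_mono) auto
        also have "\<dots> = 12 * T ^ (10 * C2 + 4) * (\<delta> / (4 * T))" using T by (simp add: power_add eval_nat_numeral)
        also have "\<dots> \<le> T ^ 4 * T ^ (10 * C2 + 4) * (\<delta> / (4 * T))"
          using const_le_power[OF T, of 12 4] T \<delta>0 by (intro mult_right_mono) auto
        also have "T ^ 4 * T ^ (10 * C2 + 4) = T ^ (10 * C2 + 8)" by (simp add: power_add eval_nat_numeral)
        also have "T ^ (10 * C2 + 8) * (\<delta> / (4 * T)) \<le> T ^ E * (\<delta> / (4 * T))"
          using \<delta>0 T by (intro mult_right_mono Tp) (auto simp: E_def)
        also have "\<dots> = real X / (4 * T)" unfolding \<delta>_def using T by simp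
        finally show ?thesis .
      qed
      have "cmod (\<Sum>n\<in>{1..X}. mangoldt n * F n) \<le> U * ln (real X) + 2 * U * ln (real X) * \<delta> + U ^ 2 * ln (real X) * \<delta>
         + cmod (triple_sum X F \<mu>2 \<Lambda>2)"
        unfolding \<mu>2_def \<Lambda>2_def by (rule norm_mangoldt_sum_le[OF X1 U1 F1 typeI])
      moreover have "real X / T \<le> cmod (\<Sum>n\<in>{1..X}. mangoldt n * F n) + real X / (8 * T)"
        using big norm_triangle_sub[of "\<Sum>p | prime p \<and> p \<le> X. of_real (ln (real p)) * F p" "\<Sum>n\<in>{1..X}. mangoldt n * F n"] pp
        unfolding F_def by (simp add: norm_minus_commute)
      moreover have "real X / (8 * T) + real X / (8 * T) + real X / (4 * T) = real X / (2 * T)" using T by (simp add: field_simps)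
      moreover have "real X / T = real X / (2 * T) + real X / (2 * T)" using T by (simp add: field_simps)
      ultimately have big2: "real X / (2 * T) \<le> cmod (triple_sum X F \<mu>2 \<Lambda>2)" using m1 m2 by linarith
      define B where "B = (\<lambda>n. \<Sum>b | b dvd n. \<mu>2 b)"
      define f where "f = (\<lambda>m. \<Sum>n\<in>{1..X div m}. \<Lambda>2 m * B n * F (m * n))"
      have "triple_sum X F \<mu>2 \<Lambda>2 = (\<Sum>m\<in>{1..X}. f m)"
        unfolding triple_sum_eq_divisor_sum f_def B_def by (simp add: sum_distrib_left mult_ac)
      \<comment> \<open>The dyadic blocks start above 1: the term at 1 vanishes with
        \<open>mangoldt\<close>, and beyond \<open>X\<close> the inner sums are empty.\<close>
      also have "\<dots> = (\<Sum>m\<in>{1<..2 ^ L}. f m)"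
      proof (rule sum.mono_neutral_cong)
        show "f m = 0" if "m \<in> {1<..2 ^ L} - {1..X}" for m using that unfolding f_def by auto
        show "f m = 0" if "m \<in> {1..X} - {1<..2 ^ L}" for m
        proof -
          have "m = 1" using that L(1) by auto
          then show ?thesis unfolding f_def \<Lambda>2_def by simp
        qed
      qed auto
      also have "\<dots> = (\<Sum>i<L. \<Sum>m\<in>{2 ^ i<..2 * 2 ^ i}. f m)" by (rule dyadic_sum)
      finally have dy: "triple_sum X F \<mu>2 \<Lambda>2 = (\<Sum>i<L. \<Sum>m\<in>{2 ^ i<..2 * 2 ^ i}. f m)" .
      have "\<exists>i<L. real X / (2 * T ^ 2) < cmod (\<Sum>m\<in>{2 ^ i<..2 * 2 ^ i}. f m)"
      proof (rule ccontr)
        assume "\<not> ?thesis"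
        then have "cmod (\<Sum>m\<in>{2 ^ i<..2 * 2 ^ i}. f m) \<le> real X / (2 * T ^ 2)" if "i < L" for i
          using that by (meson not_less)
        then have "cmod (triple_sum X F \<mu>2 \<Lambda>2) \<le> (\<Sum>i<L. real X / (2 * T ^ 2))"
          unfolding dy by (intro sum_norm_le) simp
        also have "\<dots> = real L * (real X / (2 * T ^ 2))" by simp
        also have "\<dots> < T * (real X / (2 * T ^ 2))" using L X0 T by (intro mult_strict_right_mono) auto
        also have "\<dots> = real X / (2 * T)" using T by (simp add: power2_eq_square)
        finally show False using big2 by linarith
      qed
      then obtain i where i: "real X / (2 * T ^ 2) < cmod (\<Sum>m\<in>{2 ^ i<..2 * 2 ^ i}. f m)" by blast
      define M :: nat where "M = 2 ^ i"
      have M1: "1 \<le> M" unfolding M_def by simp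
      have T52: "2 * T ^ 2 \<le> T ^ 5"
      proof -
        have "2 * T ^ 2 \<le> T ^ 3 * T ^ 2" using T T8 by (intro mult_right_mono) auto
        then show ?thesis by (simp flip: power_add)
      qed
      then have "real X / T ^ 5 \<le> real X / (2 * T ^ 2)" using T by (intro divide_left_mono) auto
      then have bigM: "real X / T ^ 5 \<le> cmod (\<Sum>m\<in>{M<..2*M}. f m)" using i unfolding M_def by linarith
      have "0 < real X / T ^ 5" using X0 T by simp
      then have "(\<Sum>m\<in>{M<..2*M}. f m) \<noteq> 0" using bigM by auto
      \<comment> \<open>The block need not be located in advance. A nonzero summand has
        \<open>m > U\<close> and a divisor \<open>b > U\<close> of \<open>n\<close>, and with
        \<open>m * n \<le> X\<close> this places \<open>M\<close> in the admissible range.\<close>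
      then obtain m where m: "m \<in> {M<..2*M}" "f m \<noteq> 0" by (meson sum.neutral)
      then obtain n where n: "n \<in> {1..X div m}" "\<Lambda>2 m * B n * F (m * n) \<noteq> 0" unfolding f_def by (meson sum.neutral)
      have "\<Lambda>2 m \<noteq> 0" using n by auto
      then have mU: "U < real m" unfolding \<Lambda>2_def by (auto split: if_splits)
      have "B n \<noteq> 0" using n by auto
      then obtain b where b: "b dvd n" "\<mu>2 b \<noteq> 0" unfolding B_def by (metis (mono_tags, lifting) mem_Collect_eq sum.neutral)
      then have "U < real b" unfolding \<mu>2_def by (auto split: if_splits)
      moreover have "b \<le> n" using b n by (intro dvd_imp_le) auto
      ultimately have nU: "U < real n" by linarith
      have nm: "n * m \<le> X" using n m by (simp add: less_eq_div_iff_mult_less_eq)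
      have cond1: "(T ^ 5) ^ C2 \<le> real M"
      proof -
        have "U < 2 * real M" using mU m by auto
        then show ?thesis unfolding U_def by (simp add: power_mult)
      qed
      have cond2: "(T ^ 5) ^ C2 * real M \<le> real X"
      proof -
        have "(T ^ 5) ^ C2 \<le> U" unfolding U_def using T1[of "5 * C2"] by (simp add: power_mult)
        then have "(T ^ 5) ^ C2 * real M \<le> real n * real m" using nU m by (intro mult_mono) auto
        also have "\<dots> \<le> real X" using nm by (metis of_nat_le_iff of_nat_mult)
        finally show ?thesis .
      qed
      have TT5: "T \<le> T ^ 5" using Tp[of 1 5] by simp
      \<comment> \<open>Truncation at \<open>X\<close> makes the pointwise bound by
        \<open>ln X\<close> hold for all \<open>m\<close>; larger \<open>m\<close> have empty inner
        sums.\<close>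
      define a where "a = (\<lambda>m. if m \<le> X then \<Lambda>2 m else 0)"
      have cond3: "\<forall>m. cmod (a m) \<le> T ^ 5"
      proof
        fix m
        show "cmod (a m) \<le> T ^ 5"
        proof (cases "1 \<le> m \<and> m \<le> X")
          case True
          have "cmod (\<Lambda>2 m) \<le> mangoldt m" unfolding \<Lambda>2_def by (simp add: mangoldt_nonneg)
          also have "\<dots> \<le> ln (real m)" using True by (intro mangoldt_le) auto
          also have "\<dots> \<le> ln (real X)" using True by simp
          finally show ?thesis using True lT TT5 unfolding a_def by simp
        next
          case False
          then have "a m = 0" unfolding a_def \<Lambda>2_def by (cases "m = 0") auto
          then show ?thesis using T by simp
        qed
      qed
      have cond4: "(\<Sum>n\<in>{1..X div M}. cmod (B n) ^ 2) \<le> T ^ 5 * (real X / real M)"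
      proof -
        have Bn: "cmod (B n) \<le> real (card {d. d dvd n})" for n
        proof -
          have "cmod (\<mu>2 b) \<le> 1" for b unfolding \<mu>2_def using norm_moebius_le[of b] by simp
          then have "cmod (B n) \<le> (\<Sum>b | b dvd n. 1)" unfolding B_def by (intro sum_norm_le)
          then show ?thesis by simp
        qed
        have MX: "1 \<le> X div M"
        proof -
          have "real M \<le> real X" using cond2 T1[of "5 * C2"] mult_right_mono[of 1 "(T ^ 5) ^ C2" "real M"] by (simp add: power_mult)
          then show ?thesis using M1 by (simp add: less_eq_div_iff_mult_less_eq)
        qed
        have "(\<Sum>n\<in>{1..X div M}. cmod (B n) ^ 2) \<le> (\<Sum>n\<in>{1..X div M}. real (card {d. d dvd n}) ^ 2)"
          using Bn by (intro sum_mono power_mono) auto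
        also have "\<dots> \<le> real (X div M) * (1 + ln (real (X div M))) ^ 3" by (rule sum_divisor_count_squared_le[OF MX])
        also have "\<dots> \<le> (real X / real M) * T ^ 3"
        proof (intro mult_mono power_mono)
          have "X div M \<le> X" by simp
          then have "ln (real (X div M)) \<le> ln (real X)" using MX by (intro ln_mono of_nat_mono) auto
          then show "1 + ln (real (X div M)) \<le> T" using lnT l0 by linarith
        qed (use MX real_nat_div_le in auto)
        also have "\<dots> \<le> (real X / real M) * T ^ 5" by (intro mult_left_mono Tp) auto
        finally show ?thesis by (simp add: mult.commute)
      qed
      have "f m = (\<Sum>n\<in>{1..X div m}. a m * B n * add_char (phase k \<alpha> (m * n)))" if "m \<in> {M<..2*M}" for m
      proof (cases "m \<le> X")
        case False
        then show ?thesis unfolding f_def by simp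
      qed (simp add: f_def a_def F_def)
      then have "real X / T ^ 5 \<le> cmod (\<Sum>m\<in>{M<..2*M}. \<Sum>n\<in>{1..X div m}. a m * B n * add_char (phase k \<alpha> (m * n)))"
        using bigM by simp
      then have "rational_approx k \<alpha> X ((T ^ 5) ^ C2)"
        using cond1 cond2 cond3 cond4 TT5 T by (intro C2[unfolded type_II_exponent_def, rule_format, of "T ^ 5" M X a B \<alpha>]) auto
      then show False using no' EC(3) by (simp only: power_mult[symmetric]) blast
    qed
  qed
qed

section \<open>Mean values\<close>

text \<open>Orthogonality in one variable. The integral is computed on the closed interval by an
  antiderivative; the half-open interval, a side of \<open>torus\<close>, differs by a null
  set.\<close>

lemma integral_add_char_unit_interval:
  fixes n :: int
  defines "g \<equiv> (\<lambda>x. indicator {0..<1} x *\<^sub>R add_char (x * of_int n) :: complex)"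
  shows "integrable lborel g" "integral\<^sup>L lborel g = (if n = 0 then 1 else 0)"
proof -
  define h where "h = (\<lambda>x::real. indicator {0..1} x *\<^sub>R add_char (x * of_int n) :: complex)"
  have cont: "continuous_on {0..1::real} (\<lambda>x. add_char (x * of_int n))"
    unfolding add_char_def by (intro continuous_intros)
  have inth: "integrable lborel h"
    using borel_integrable_atLeastAtMost'[OF cont] unfolding h_def set_integrable_def by simp
  have meas [measurable]: "(\<lambda>x::real. add_char (x * of_int n)) \<in> borel_measurable borel"
    unfolding add_char_def by (intro borel_measurable_continuous_onI continuous_intros)
  have mg: "g \<in> borel_measurable lborel" unfolding g_def by measurable
  have ae: "AE x in lborel. h x = g x"
    using AE_lborel_singleton[of "1::real"] by eventually_elim (auto simp: h_def g_def indicator_def)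
  show "integrable lborel g" using inth mg ae by (rule integrable_cong_AE_imp)
  have "integral\<^sup>L lborel g = integral\<^sup>L lborel h"
    using ae mg inth by (intro integral_cong_AE) auto
  also have "\<dots> = (if n = 0 then 1 else 0)"
  proof (cases "n = 0")
    case True
    then show ?thesis unfolding h_def by (simp add: add_char_def measure_def)
  next
    case False
    define G where "G = (\<lambda>x::real. add_char (x * of_int n) / (2 * pi * \<i> * of_int n))"
    have "integral\<^sup>L lborel h = G 1 - G 0"
      unfolding h_def
    proof (rule integral_FTC_atLeastAtMost)
      fix x :: real
      have "((\<lambda>z. exp (2 * of_real pi * \<i> * (z * of_int n)) / (2 * pi * \<i> * of_int n)) has_field_derivative
          exp (2 * of_real pi * \<i> * (of_real x * of_int n))) (at (of_real x))"
        using False by (auto intro!: derivative_eq_intros)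
      then have "((\<lambda>y::real. exp (2 * of_real pi * \<i> * (of_real y * of_int n)) / (2 * pi * \<i> * of_int n)) has_vector_derivative
          exp (2 * of_real pi * \<i> * (of_real x * of_int n))) (at x within {0..1})"
        by (rule has_vector_derivative_real_field)
      then show "(G has_vector_derivative add_char (x * of_int n)) (at x within {0..1})"
        unfolding G_def add_char_def comp_def by simp
    qed (use cont in auto)
    also have "\<dots> = 0" unfolding G_def using add_char_of_int[of n] add_char_of_int[of 0] by simp
    finally show ?thesis using False by simp
  qed
  finally show "integral\<^sup>L lborel g = (if n = 0 then 1 else 0)" .
qed

text \<open>Lebesgue measure on the vector space is the image of the product measure over the basis,
  and the integrand factors along the coordinates.\<close>

lemma integral_torus_add_char:
  fixes n :: "'t::finite \<Rightarrow> int"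
  defines "g \<equiv> (\<lambda>\<alpha>::real^'t. indicator torus \<alpha> *\<^sub>R add_char (\<Sum>j\<in>UNIV. \<alpha> $ j * of_int (n j)))"
  shows "integrable lborel g" "integral\<^sup>L lborel g = (if \<forall>j. n j = 0 then 1 else 0)"
proof -
  interpret product_sigma_finite "\<lambda>_::real^'t. lborel :: real measure" ..
  define B where "B = (Basis :: (real^'t) set)"
  define h where "h = (\<lambda>(b::real^'t) x. indicator {0..<1} x *\<^sub>R add_char (x * of_int (n (axis_index b))) :: complex)"
  define emb where "emb = (\<lambda>f. \<Sum>b\<in>B. f b *\<^sub>R b)"
  have B: "B = (\<lambda>j. axis j 1) ` UNIV" unfolding B_def Basis_vec_def by auto
  have inj: "inj (\<lambda>j. axis j 1 :: real^'t)" by (auto simp: inj_def axis_eq_axis)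
  have finB: "finite B" unfolding B_def by simp
  have hint: "integrable lborel (h b)" "integral\<^sup>L lborel (h b) = (if n (axis_index b) = 0 then 1 else 0)" for b
    unfolding h_def by (rule integral_add_char_unit_interval)+
  have prodind: "(\<Prod>j\<in>A. indicator {0..<1} (x j) *\<^sub>R c j) = (if \<forall>j\<in>A. 0 \<le> x j \<and> x j < 1 then \<Prod>j\<in>A. c j else 0)"
    if "finite A" for A :: "'t set" and x :: "'t \<Rightarrow> real" and c :: "'t \<Rightarrow> complex"
    using that by (induction A rule: finite_induct) (auto simp: indicator_def)
  have expsum: "add_char (\<Sum>j\<in>A. x j) = (\<Prod>j\<in>A. add_char (x j))" if "finite A" for A :: "'t set" and x
    using that by (induction A rule: finite_induct) (auto simp: add_char_add add_char_of_int[of 0, simplified])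
  have gh: "g \<alpha> = (\<Prod>b\<in>B. h b (\<alpha> \<bullet> b))" for \<alpha>
  proof -
    have "(\<Prod>b\<in>B. h b (\<alpha> \<bullet> b)) = (\<Prod>j\<in>UNIV. indicator {0..<1} (\<alpha> $ j) *\<^sub>R add_char (\<alpha> $ j * of_int (n j)))"
      unfolding B prod.reindex[OF inj] by (simp add: h_def cart_eq_inner_axis)
    also have "\<dots> = g \<alpha>" unfolding g_def prodind[OF finite] by (simp add: torus_def expsum)
    finally show ?thesis by simp
  qed
  have ge: "g (emb f) = (\<Prod>b\<in>B. h b (f b))" for f
    unfolding gh emb_def B_def by (intro prod.cong) auto
  have mh [measurable]: "h b \<in> borel_measurable borel" for b
    using borel_measurable_integrable[OF hint(1)] by simp
  have mg: "g \<in> borel_measurable borel" unfolding gh[abs_def] by measurable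
  have memb: "emb \<in> measurable (\<Pi>\<^sub>M b\<in>B. lborel) borel" unfolding emb_def B_def by measurable
  have lb: "(lborel :: (real^'t) measure) = distr (\<Pi>\<^sub>M b\<in>B. lborel) borel emb"
    unfolding emb_def B_def by (rule lborel_eq)
  have "integrable (\<Pi>\<^sub>M b\<in>B. lborel) (\<lambda>f. g (emb f))"
    unfolding ge using finB hint(1) by (intro product_integrable_prod) auto
  then show "integrable lborel g" unfolding lb using integrable_distr_eq[OF memb mg] by simp
  have "integral\<^sup>L lborel g = (\<integral>f. g (emb f) \<partial>(\<Pi>\<^sub>M b\<in>B. lborel))"
    unfolding lb by (rule integral_distr[OF memb mg])
  also have "\<dots> = (\<Prod>b\<in>B. integral\<^sup>L lborel (h b))"
    unfolding ge using finB hint(1) by (intro product_integral_prod) auto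
  also have "\<dots> = (\<Prod>j\<in>UNIV. if n j = 0 then 1 else 0)"
    unfolding hint(2) B prod.reindex[OF inj] by simp
  also have "\<dots> = (if \<forall>j. n j = 0 then 1 else 0)" by (simp add: prod_zero)
  finally show "integral\<^sup>L lborel g = (if \<forall>j. n j = 0 then 1 else 0)" .
qed

text \<open>By orthogonality the moment is exactly a count of solutions in primes with nonnegative
  weights. Bounding each logarithm by \<open>ln P\<close> and dropping primality only increases
  it.\<close>

lemma prime_mean_value:
  fixes k :: "'t::finite \<Rightarrow> nat"
  assumes P: "P \<ge> 2"
  shows "integrable lborel (\<lambda>\<alpha>. indicator torus \<alpha> *\<^sub>R cmod (prime_exp_sum k P \<alpha>) ^ (2 * l))"
    and "(LINT \<alpha>|lborel. indicator torus \<alpha> *\<^sub>R cmod (prime_exp_sum k P \<alpha>) ^ (2 * l))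
      \<le> ln P ^ (2 * l) * real (num_solutions l k P)"
proof -
  define R where "R = {p. prime p \<and> real p \<le> P}"
  define N where "N = {n::nat. 1 \<le> n \<and> real n \<le> P}"
  have finN: "finite N" by (rule finite_subset[of _ "{..nat \<lfloor>P\<rfloor>}"]) (auto simp: N_def le_nat_floor)
  have RN: "R \<subseteq> N" unfolding R_def N_def using prime_gt_0_nat by (auto simp: Suc_le_eq)
  have finR: "finite R" using RN finN finite_subset by blast
  define X where "X = {..<l} \<rightarrow>\<^sub>E R"
  have finX: "finite X" unfolding X_def using finR by (intro finite_PiE) auto
  define w where "w = (\<lambda>x. \<Prod>i<l. ln (real (x i)))"
  define s where "s = (\<lambda>x j. int (\<Sum>i<l. x i ^ k j))"
  define G where "G = (\<lambda>n (\<alpha>::real^'t). indicator torus \<alpha> *\<^sub>R add_char (\<Sum>j\<in>UNIV. \<alpha> $ j * of_int (n j)))"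
  have expsum: "add_char (\<Sum>i<m. x i) = (\<Prod>i<m. add_char (x i))" for m :: nat and x
    by (induction m) (auto simp: add_char_add add_char_of_int[of 0, simplified])
  have pow: "prime_exp_sum k P \<alpha> ^ l = (\<Sum>x\<in>X. of_real (w x) * add_char (\<Sum>j\<in>UNIV. \<alpha> $ j * of_int (s x j)))" for \<alpha>
  proof -
    have "prime_exp_sum k P \<alpha> ^ l = (\<Prod>i<l. \<Sum>p\<in>R. of_real (ln (real p)) * add_char (\<Sum>j\<in>UNIV. \<alpha> $ j * real p ^ k j))"
      unfolding prime_exp_sum_def R_def by simp
    also have "\<dots> = (\<Sum>x\<in>X. \<Prod>i<l. of_real (ln (real (x i))) * add_char (\<Sum>j\<in>UNIV. \<alpha> $ j * real (x i) ^ k j))"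
      unfolding X_def using finR by (intro prod_sum_PiE) auto
    also have "\<dots> = (\<Sum>x\<in>X. of_real (w x) * add_char (\<Sum>j\<in>UNIV. \<alpha> $ j * of_int (s x j)))"
    proof (rule sum.cong)
      fix x
      have "(\<Sum>j\<in>UNIV. \<alpha> $ j * of_int (s x j)) = (\<Sum>i<l. \<Sum>j\<in>UNIV. \<alpha> $ j * real (x i) ^ k j)"
        unfolding s_def by (subst sum.swap) (simp add: sum_distrib_left)
      then show "(\<Prod>i<l. of_real (ln (real (x i))) * add_char (\<Sum>j\<in>UNIV. \<alpha> $ j * real (x i) ^ k j)) =
         complex_of_real (w x) * add_char (\<Sum>j\<in>UNIV. \<alpha> $ j * of_int (s x j))"
        unfolding w_def by (simp add: prod.distrib expsum)
    qed simp
    finally show ?thesis .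
  qed
  have expand: "complex_of_real (indicator torus \<alpha> *\<^sub>R cmod (prime_exp_sum k P \<alpha>) ^ (2 * l)) =
     (\<Sum>x\<in>X. \<Sum>y\<in>X. of_real (w x * w y) * G (\<lambda>j. s x j - s y j) \<alpha>)" for \<alpha>
  proof -
    have "complex_of_real (cmod (prime_exp_sum k P \<alpha>) ^ (2 * l)) = complex_of_real (cmod (prime_exp_sum k P \<alpha> ^ l) ^ 2)"
      by (simp add: norm_power power_mult mult.commute)
    also have "\<dots> = prime_exp_sum k P \<alpha> ^ l * cnj (prime_exp_sum k P \<alpha> ^ l)" by (rule complex_norm_square)
    also have "\<dots> = (\<Sum>x\<in>X. \<Sum>y\<in>X. of_real (w x * w y) * add_char (\<Sum>j\<in>UNIV. \<alpha> $ j * of_int (s x j - s y j)))"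
      unfolding pow by (simp add: sum_product right_diff_distrib sum_subtractf add_char_diff mult_ac)
    finally have eq: "complex_of_real (cmod (prime_exp_sum k P \<alpha>) ^ (2 * l)) =
      (\<Sum>x\<in>X. \<Sum>y\<in>X. of_real (w x * w y) * add_char (\<Sum>j\<in>UNIV. \<alpha> $ j * of_int (s x j - s y j)))" .
    have "complex_of_real (indicator torus \<alpha> *\<^sub>R cmod (prime_exp_sum k P \<alpha>) ^ (2 * l)) =
      indicator torus \<alpha> *\<^sub>R complex_of_real (cmod (prime_exp_sum k P \<alpha>) ^ (2 * l))"
      by (simp add: scaleR_conv_of_real)
    then show ?thesis unfolding eq G_def by (simp add: scaleR_sum_right)
  qed
  have Gint: "integrable lborel (G n)" "integral\<^sup>L lborel (G n) = (if \<forall>j. n j = 0 then 1 else 0)" for n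
    unfolding G_def by (rule integral_torus_add_char)+
  have intc: "integrable lborel (\<lambda>\<alpha>. complex_of_real (indicator torus \<alpha> *\<^sub>R cmod (prime_exp_sum k P \<alpha>) ^ (2 * l)))"
    unfolding expand by (intro Bochner_Integration.integrable_sum integrable_mult_right Gint)
  then show int: "integrable lborel (\<lambda>\<alpha>. indicator torus \<alpha> *\<^sub>R cmod (prime_exp_sum k P \<alpha>) ^ (2 * l))"
    by (simp only: complex_of_real_integrable_eq)
  have "complex_of_real (LINT \<alpha>|lborel. indicator torus \<alpha> *\<^sub>R cmod (prime_exp_sum k P \<alpha>) ^ (2 * l)) =
     (LINT \<alpha>|lborel. (\<Sum>x\<in>X. \<Sum>y\<in>X. of_real (w x * w y) * G (\<lambda>j. s x j - s y j) \<alpha>))"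
    unfolding expand[symmetric] by (rule integral_complex_of_real[symmetric])
  also have "\<dots> = (\<Sum>x\<in>X. \<Sum>y\<in>X. of_real (w x * w y) * integral\<^sup>L lborel (G (\<lambda>j. s x j - s y j)))"
    by (simp add: Bochner_Integration.integral_sum Gint Bochner_Integration.integrable_sum integrable_mult_right)
  also have "\<dots> = complex_of_real (\<Sum>x\<in>X. \<Sum>y\<in>X. if \<forall>j. s x j = s y j then w x * w y else 0)"
    unfolding Gint(2) of_real_sum by (intro sum.cong) auto
  finally have "(LINT \<alpha>|lborel. indicator torus \<alpha> *\<^sub>R cmod (prime_exp_sum k P \<alpha>) ^ (2 * l)) =
      (\<Sum>x\<in>X. \<Sum>y\<in>X. if \<forall>j. s x j = s y j then w x * w y else 0)"
    by (simp only: of_real_eq_iff)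
  also have "\<dots> \<le> (\<Sum>x\<in>X. \<Sum>y\<in>X. if \<forall>j. s x j = s y j then ln P ^ (2 * l) else 0)"
  proof (intro sum_mono)
    have wx: "0 \<le> w x \<and> w x \<le> ln P ^ l" if x: "x \<in> X" for x
    proof -
      have "0 \<le> ln (real (x i)) \<and> ln (real (x i)) \<le> ln P" if "i \<in> {..<l}" for i
      proof -
        have "x i \<in> N" using x that RN unfolding X_def by (auto simp: PiE_def Pi_def)
        then show ?thesis using P unfolding N_def by auto
      qed
      then show ?thesis unfolding w_def using prod_mono[of "{..<l}" "\<lambda>i. ln (real (x i))" "\<lambda>_. ln P"]
        by (auto intro: prod_nonneg)
    qed
    fix x y assume xy: "x \<in> X" "y \<in> X"
    have "w x * w y \<le> ln P ^ l * ln P ^ l" using wx xy by (intro mult_mono) (auto intro: order_trans)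
    then show "(if \<forall>j. s x j = s y j then w x * w y else 0) \<le> (if \<forall>j. s x j = s y j then ln P ^ (2 * l) else 0)"
      by (simp add: mult_2 power_add)
  qed
  also have "\<dots> = (\<Sum>z\<in>X \<times> X. if \<forall>j. s (fst z) j = s (snd z) j then ln P ^ (2 * l) else 0)"
    by (simp add: sum.cartesian_product case_prod_beta)
  also have "\<dots> = (\<Sum>z\<in>{z\<in>X \<times> X. \<forall>j. s (fst z) j = s (snd z) j}. ln P ^ (2 * l))"
    using finX by (subst sum.inter_filter) auto
  also have "\<dots> = real (card {z\<in>X \<times> X. \<forall>j. s (fst z) j = s (snd z) j}) * ln P ^ (2 * l)" by simp
  also have "\<dots> \<le> real (num_solutions l k P) * ln P ^ (2 * l)"
  proof (rule mult_right_mono)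
    define S where "S = {(x, y). x \<in> {..<l} \<rightarrow>\<^sub>E {n::nat. 1 \<le> n \<and> real n \<le> P} \<and>
                   y \<in> {..<l} \<rightarrow>\<^sub>E {n::nat. 1 \<le> n \<and> real n \<le> P} \<and>
                   (\<forall>j. (\<Sum>i<l. x i ^ k j) = (\<Sum>i<l. y i ^ k j))}"
    have "S \<subseteq> ({..<l} \<rightarrow>\<^sub>E N) \<times> ({..<l} \<rightarrow>\<^sub>E N)" unfolding S_def N_def by auto
    moreover have "finite (({..<l} \<rightarrow>\<^sub>E N) \<times> ({..<l} \<rightarrow>\<^sub>E N))" using finN by (intro finite_cartesian_product finite_PiE) auto
    ultimately have finS: "finite S" using finite_subset by blast
    have XN: "X \<subseteq> {..<l} \<rightarrow>\<^sub>E N" unfolding X_def using RN by (intro PiE_mono) auto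
    have "{z\<in>X \<times> X. \<forall>j. s (fst z) j = s (snd z) j} \<subseteq> S"
    proof
      fix z assume "z \<in> {z\<in>X \<times> X. \<forall>j. s (fst z) j = s (snd z) j}"
      then obtain x y where z: "z = (x, y)" "x \<in> X" "y \<in> X" "\<forall>j. s x j = s y j" by auto
      then have "(\<forall>j. (\<Sum>i<l. x i ^ k j) = (\<Sum>i<l. y i ^ k j))" unfolding s_def of_nat_eq_iff by blast
      moreover have "x \<in> {..<l} \<rightarrow>\<^sub>E N" "y \<in> {..<l} \<rightarrow>\<^sub>E N" using z XN by blast+
      ultimately show "z \<in> S" unfolding z(1) S_def N_def mem_Collect_eq case_prod_conv by blast
    qed
    then have "card {z\<in>X \<times> X. \<forall>j. s (fst z) j = s (snd z) j} \<le> card S" by (rule card_mono[OF finS])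
    then show "real (card {z\<in>X \<times> X. \<forall>j. s (fst z) j = s (snd z) j}) \<le> real (num_solutions l k P)"
      unfolding num_solutions_def S_def by simp
  qed (use P in simp)
  finally show "(LINT \<alpha>|lborel. indicator torus \<alpha> *\<^sub>R cmod (prime_exp_sum k P \<alpha>) ^ (2 * l))
      \<le> ln P ^ (2 * l) * real (num_solutions l k P)" by (simp add: mult.commute)
qed

section \<open>Minor arcs\<close>

text \<open>The nearest integers to \<open>q * \<alpha> $ j\<close> and \<open>q\<close> may share a
  factor \<open>g\<close>. Dividing it out lowers the denominator and also the error by
  \<open>g\<close>, so the reduced fraction satisfies the conditions of an arc.\<close>

lemma mem_major_arcs:
  fixes k :: "'t::finite \<Rightarrow> nat"
  assumes \<alpha>: "\<alpha> \<in> torus" and q: "1 \<le> q" "real q < Q"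
    and nearq: "\<And>j. near (Q / P ^ k j) (real q * \<alpha> $ j)"
  shows "\<alpha> \<in> major_arcs k P Q"
proof -
  have "\<forall>j. \<exists>b::int. \<bar>real q * \<alpha> $ j - of_int b\<bar> \<le> Q / P ^ k j" using nearq unfolding near_def by blast
  then obtain b :: "'t \<Rightarrow> int" where b: "\<And>j. \<bar>real q * \<alpha> $ j - of_int (b j)\<bar> \<le> Q / P ^ k j" by metis
  define g where "g = Gcd (insert (int q) (range b))"
  have g0: "g \<noteq> 0" "0 \<le> g" unfolding g_def using q by (auto simp: Gcd_0_iff)
  then have g1: "1 \<le> g" by linarith
  have gd: "g dvd int q" "g dvd b j" for j unfolding g_def by (rule Gcd_dvd; simp)+
  then obtain q'' where q'': "int q = g * q''" by blast
  have "0 < g * q''" using q q'' by linarith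
  then have "0 < q''" using g1 by (simp add: zero_less_mult_iff)
  define q' where "q' = nat q''"
  have q': "int q = g * int q'" "1 \<le> q'" using q'' \<open>0 < q''\<close> unfolding q'_def by auto
  define b' where "b' = (\<lambda>j. b j div g)"
  have b': "b j = g * b' j" for j unfolding b'_def using gd(2)[of j] by simp
  \<comment> \<open>Numerators are taken in \<open>1..q'\<close>, hence the shift by 1 before and
    after \<open>mod\<close>; the quotient supplies the integer translate.\<close>
  define a where "a = (\<lambda>j. nat ((b' j - 1) mod int q') + 1)"
  have a_int: "int (a j) = (b' j - 1) mod int q' + 1" for j unfolding a_def using q' by simp
  have a1: "1 \<le> a j" "a j \<le> q'" for j
  proof -
    show "1 \<le> a j" unfolding a_def by simp
    have "(b' j - 1) mod int q' < int q'" using q' by (intro pos_mod_bound) auto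
    then show "a j \<le> q'" using a_int[of j] by linarith
  qed
  have bm: "b' j = int (a j) + int q' * ((b' j - 1) div int q')" for j
    unfolding a_int using mult_div_mod_eq[of "int q'" "b' j - 1"] by linarith
  have qq: "real q = of_int g * real q'"
  proof -
    have "real_of_int (int q) = real_of_int (g * int q')" using q' by simp
    then show ?thesis by simp
  qed
  have "real q' * 1 \<le> real q' * of_int g" using g1 by (intro mult_left_mono) auto
  then have q'q: "real q' \<le> real q" using qq by (simp add: mult.commute)
  have arc: "\<bar>\<alpha> $ j - real (a j) / real q' - of_int ((b' j - 1) div int q')\<bar> \<le> Q / (real q' * P ^ k j)" for j
  proof -
    have "of_int (b' j) = real (a j) + real q' * of_int ((b' j - 1) div int q')"
      by (subst bm) simp
    then have eq: "\<alpha> $ j - real (a j) / real q' - of_int ((b' j - 1) div int q') = (real q' * \<alpha> $ j - of_int (b' j)) / real q'"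
      using q' by (simp add: field_simps)
    have "real q * \<alpha> $ j - of_int (b j) = of_int g * (real q' * \<alpha> $ j - of_int (b' j))"
      unfolding qq b' by (simp add: algebra_simps)
    then have "of_int g * \<bar>real q' * \<alpha> $ j - of_int (b' j)\<bar> \<le> Q / P ^ k j"
      using b[of j] g1 by (simp add: abs_mult)
    moreover have "1 * \<bar>real q' * \<alpha> $ j - of_int (b' j)\<bar> \<le> of_int g * \<bar>real q' * \<alpha> $ j - of_int (b' j)\<bar>"
      using g1 by (intro mult_right_mono) auto
    ultimately have "\<bar>real q' * \<alpha> $ j - of_int (b' j)\<bar> / real q' \<le> Q / P ^ k j / real q'"
      by (intro divide_right_mono) auto
    then show ?thesis unfolding eq by (simp add: mult.commute)
  qed
  have gcd1: "Gcd (insert q' (range a)) = 1"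
  proof -
    define c where "c = Gcd (insert q' (range a))"
    have cq: "int c dvd int q'" and ca: "int c dvd int (a j)" for j unfolding c_def int_dvd_int_iff by (rule Gcd_dvd; simp)+
    have cb: "int c dvd b' j" for j
      by (subst bm) (use cq ca in \<open>auto intro: dvd_add dvd_mult2\<close>)
    \<comment> \<open>\<open>g * c\<close> divides \<open>q\<close> and every \<open>b j\<close>,
      hence also their greatest common divisor \<open>g\<close>.\<close>
    have "g * int c dvd g"
      unfolding g_def
    proof (rule Gcd_greatest)
      fix x assume "x \<in> insert (int q) (range b)"
      then have "g * int c dvd x" using q' b' cq cb by (auto intro: mult_dvd_mono)
      then show "Gcd (insert (int q) (range b)) * int c dvd x" unfolding g_def .
    qed
    then have "int c dvd 1" using g0 by (metis dvd_mult_cancel_left mult.right_neutral)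
    then show ?thesis unfolding c_def[symmetric] by simp
  qed
  have "\<alpha> \<in> major_arc k P a q' Q"
    unfolding major_arc_def using \<alpha> arc by blast
  moreover have "1 \<le> q' \<and> real q' < Q \<and> (\<forall>j. 1 \<le> a j \<and> a j \<le> q') \<and> Gcd (insert q' (range a)) = 1"
    using q' q'q q a1 gcd1 by auto
  ultimately show ?thesis unfolding major_arcs_def by blast
qed

text \<open>A value beyond the bound at a large \<open>P\<close> would, by
  \<open>prime_sum_estimate\<close> with \<open>T = P powr \<eta>\<close>, put
  \<open>\<alpha>\<close> on a major arc. For bounded \<open>P\<close> the trivial estimate is
  covered by the constant.\<close>

lemma minor_arc_estimate:
  fixes k :: "'t::finite \<Rightarrow> nat"
  assumes inj: "inj k" and k0: "\<And>j. k j > 0" and \<delta>: "0 < \<delta>" "\<delta> < 1"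
  shows "\<exists>\<eta>>0. \<exists>C>0. \<forall>P\<ge>2. \<forall>\<alpha>\<in>minor_arcs k P (P powr \<delta>). cmod (prime_exp_sum k P \<alpha>) \<le> C * P powr (1 - \<eta>)"
proof -
  from prime_sum_estimate[OF inj k0] obtain C where C: "prime_sum_exponent k C" ..
  define d where "d = exponent_sum k"
  \<comment> \<open>This makes \<open>T ^ (C + d + 1)\<close> equal to
    \<open>P powr \<delta>\<close>: \<open>T ^ C\<close> comes from
    \<open>prime_sum_estimate\<close>, \<open>T ^ d\<close> pays for replacing the integer part
    \<open>X \<ge> P / 2\<close> by \<open>P\<close> in the scales, and the extra 1 secures the
    strict bound on \<open>q\<close>.\<close>
  define \<eta> where "\<eta> = \<delta> / real (C + d + 1)"
  have \<eta>: "0 < \<eta>" "\<eta> * real (C + d + 1) = \<delta>" unfolding \<eta>_def using \<delta> by auto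
  have "\<eta> * 1 \<le> \<eta> * real (C + d + 1)" using \<eta>(1) by (intro mult_left_mono) auto
  then have \<eta>1: "\<eta> \<le> 1" using \<eta>(2) \<delta> by linarith
  \<comment> \<open>Beyond \<open>P0\<close> one has
    \<open>v = P powr (\<eta> / 2) \<ge> 4 / \<eta> + 3\<close>. With
    \<open>ln P \<le> (2 / \<eta>) * v\<close> this gives
    \<open>2 * ln P + 3 \<le> v * v = T\<close>.\<close>
  define P0 where "P0 = max 2 ((4 / \<eta> + 3) powr (2 / \<eta>))"
  define C' where "C' = max 1 (P0 * ln P0)"
  have P02: "2 \<le> P0" unfolding P0_def by simp
  have main: "cmod (prime_exp_sum k P \<alpha>) \<le> C' * P powr (1 - \<eta>)" if P: "P \<ge> 2" and \<alpha>: "\<alpha> \<in> minor_arcs k P (P powr \<delta>)" for P \<alpha>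
  proof -
    define X where "X = nat \<lfloor>P\<rfloor>"
    have X: "real X \<le> P" "P / 2 \<le> real X" "1 \<le> X" using P unfolding X_def by linarith+
    have Xiff: "real p \<le> P \<longleftrightarrow> p \<le> X" for p :: nat unfolding X_def using P by (simp add: le_nat_iff le_floor_iff)
    have f_eq: "prime_exp_sum k P \<alpha> = (\<Sum>p | prime p \<and> p \<le> X. of_real (ln (real p)) * add_char (phase k (\<lambda>j. \<alpha> $ j) p))"
      unfolding prime_exp_sum_def phase_def Xiff ..
    have triv: "cmod (prime_exp_sum k P \<alpha>) \<le> P * ln P"
    proof -
      have "cmod (prime_exp_sum k P \<alpha>) \<le> (\<Sum>p | prime p \<and> p \<le> X. ln P)"
        unfolding f_eq
      proof (rule sum_norm_le)
        fix p assume "p \<in> {p. prime p \<and> p \<le> X}"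
        then have "1 \<le> real p" "real p \<le> P" using Xiff prime_gt_0_nat[of p] by auto
        then show "cmod (of_real (ln (real p)) * add_char (phase k (\<lambda>j. \<alpha> $ j) p)) \<le> ln P"
          by (simp add: norm_mult)
      qed
      also have "\<dots> = real (card {p. prime p \<and> p \<le> X}) * ln P" by simp
      also have "\<dots> \<le> P * ln P"
      proof (rule mult_right_mono)
        have "card {p. prime p \<and> p \<le> X} \<le> card {1..X}"
          by (rule card_mono) (auto simp: Suc_le_eq prime_gt_0_nat)
        then show "real (card {p. prime p \<and> p \<le> X}) \<le> P" using X by simp
      qed (use P in simp)
      finally show ?thesis .
    qed
    have C'1: "1 \<le> C'" unfolding C'_def by simp
    show ?thesis
    proof (cases "P < P0")
      case True
      have "P * ln P \<le> P0 * ln P0" using True P by (intro mult_mono) auto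
      also have "\<dots> \<le> C' * 1" unfolding C'_def by simp
      also have "\<dots> \<le> C' * P powr (1 - \<eta>)" using C'1 \<eta>1 P by (intro mult_left_mono ge_one_powr_ge_zero) auto
      finally show ?thesis using triv by linarith
    next
      case False
      define T where "T = P powr \<eta>"
      define v where "v = P powr (\<eta> / 2)"
      have Tv: "T = v * v" unfolding T_def v_def by (simp flip: powr_add)
      have v: "4 / \<eta> + 3 \<le> v"
      proof -
        have "(4 / \<eta> + 3) powr (2 / \<eta>) \<le> P" using False unfolding P0_def by simp
        then have "((4 / \<eta> + 3) powr (2 / \<eta>)) powr (\<eta> / 2) \<le> v"
          unfolding v_def using \<eta> by (intro powr_mono2) auto
        then show ?thesis using \<eta> by (simp add: powr_powr add_pos_pos less_imp_le)
      qed
      have v3: "3 \<le> v" using v \<eta>(1) divide_pos_pos[of 4 \<eta>] by linarith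
      have lnT: "2 * ln P + 3 \<le> T"
      proof -
        have "ln P \<le> v / (\<eta> / 2)" unfolding v_def using P \<eta> by (intro ln_powr_bound) auto
        then have "2 * ln P + 3 \<le> (4 / \<eta>) * v + 3 * v" using v3 by simp
        also have "\<dots> = (4 / \<eta> + 3) * v" by (simp add: algebra_simps)
        also have "\<dots> \<le> T" unfolding Tv using v v3 by (intro mult_right_mono) auto
        finally show ?thesis .
      qed
      have T2: "2 \<le> T" using lnT P ln_ge_zero[of P] by linarith
      have Tpow: "T ^ a = P powr (\<eta> * real a)" for a
        unfolding T_def using P by (simp add: powr_realpow[symmetric] powr_powr)
      have Td: "T ^ (C + d + 1) = P powr \<delta>" unfolding Tpow \<eta>(2) ..
      have Tp: "T ^ a \<le> T ^ b" if "a \<le> b" for a b using T2 that by (intro power_increasing) auto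
      have "2 * T ^ C \<le> T ^ (C + 1)" using T2 by (simp add: mult_right_mono)
      also have "\<dots> \<le> P powr \<delta>" unfolding Td[symmetric] by (rule Tp) simp
      also have "\<dots> \<le> P powr 1" using P \<delta> by (intro powr_mono) auto
      finally have TC: "T ^ C \<le> real X" using X P by simp
      have "ln (real X) \<le> ln P" using X by (intro ln_mono) auto
      then have lnX: "2 * ln (real X) + 3 \<le> T" using lnT by linarith
      have PT: "P powr (1 - \<eta>) = P / T" unfolding T_def using P by (simp add: powr_diff)
      show ?thesis
      proof (rule ccontr)
        assume "\<not> ?thesis"
        moreover have "1 * P powr (1 - \<eta>) \<le> C' * P powr (1 - \<eta>)" using C'1 by (intro mult_right_mono) auto
        moreover have "real X / T \<le> P / T" using X T2 by (intro divide_right_mono) auto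
        ultimately have "real X / T \<le> cmod (prime_exp_sum k P \<alpha>)" using PT by linarith
        then have "rational_approx k (\<lambda>j. \<alpha> $ j) X (T ^ C)"
          unfolding f_eq using T2 lnX TC by (intro C[unfolded prime_sum_exponent_def, rule_format, where \<alpha> = "\<lambda>j. \<alpha> $ j"]) auto
        then obtain q :: nat where q: "1 \<le> q" "real q \<le> T ^ C"
          "\<And>j. near (T ^ C / real X ^ k j) (real q * \<alpha> $ j)" by blast
        have "T ^ C < T ^ (C + d + 1)" using T2 by (intro power_strict_increasing) auto
        then have qQ: "real q < P powr \<delta>" using q Td by linarith
        have "near (P powr \<delta> / P ^ k j) (real q * \<alpha> $ j)" for j
        proof -
          have "(P / 2) ^ k j \<le> real X ^ k j" using X P by (intro power_mono) auto
          then have "T ^ C / real X ^ k j \<le> T ^ C / (P / 2) ^ k j"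
            using X P T2 by (intro divide_left_mono) auto
          also have "\<dots> = T ^ C * 2 ^ k j / P ^ k j" by (simp add: power_divide)
          also have "\<dots> \<le> T ^ C * T ^ k j / P ^ k j"
            using T2 P by (intro divide_right_mono mult_left_mono power_mono) auto
          also have "\<dots> = T ^ (C + k j) / P ^ k j" by (simp add: power_add)
          also have "\<dots> \<le> P powr \<delta> / P ^ k j"
            unfolding Td[symmetric] using P exponent_le_sum[of k j] by (intro divide_right_mono Tp) (auto simp: d_def)
          finally show ?thesis using near_mono[OF q(3)] by blast
        qed
        moreover have "\<alpha> \<in> torus" "\<alpha> \<notin> major_arcs k P (P powr \<delta>)" using \<alpha> unfolding minor_arcs_def by auto
        ultimately show False using mem_major_arcs[OF _ q(1) qQ] by blast
      qed
    qed
  qed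
  have "0 < C'" unfolding C'_def by simp
  then show ?thesis using \<eta>(1) main by blast
qed

text \<open>The balance of exponents: the factors of the supremum save at least
  \<open>P powr \<eta>\<close>, the mean value loses \<open>P powr \<epsilon>\<close> with
  \<epsilon> below \<open>\<eta> / 2\<close>, and the logarithms lose at most
  \<open>P powr (\<eta> / 4)\<close>, which leaves a saving of \<open>\<eta> / 4\<close>.\<close>

theorem theorem4:
  fixes k :: "'t::finite \<Rightarrow> nat"
  assumes "inj k" and "\<And>j. k j > 0"
  shows "\<exists>\<delta>\<^sub>0>0. \<forall>\<delta>. 0 < \<delta> \<and> \<delta> < \<delta>\<^sub>0 \<longrightarrow>
          (\<exists>\<epsilon>\<^sub>0>0. \<forall>\<epsilon>. 0 < \<epsilon> \<and> \<epsilon> < \<epsilon>\<^sub>0 \<longrightarrow>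
            (\<forall>s::real. ereal s \<ge> 2 * ereal_of_enat (s_eps \<epsilon> k) + 1 \<longrightarrow>
              (\<exists>\<epsilon>'>0. \<exists>C. \<forall>P\<ge>2.
                 (LINT \<alpha>:minor_arcs k P (P powr \<delta>)|lborel. cmod (prime_exp_sum k P \<alpha>) powr s)
                   \<le> C * P powr (s - real (exponent_sum k) - \<epsilon>'))))"
proof (rule exI[of _ 1], intro conjI allI impI)
  fix \<delta> :: real assume "0 < \<delta> \<and> \<delta> < 1"
  then obtain \<eta> B where \<eta>: "\<eta> > 0" and B: "B > 0"
    and minor: "\<And>P \<alpha>. P \<ge> 2 \<Longrightarrow> \<alpha> \<in> minor_arcs k P (P powr \<delta>) \<Longrightarrow> cmod (prime_exp_sum k P \<alpha>) \<le> B * P powr (1 - \<eta>)"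
    using minor_arc_estimate[OF assms, of \<delta>] by blast
  show "\<exists>\<epsilon>\<^sub>0>0. \<forall>\<epsilon>. 0 < \<epsilon> \<and> \<epsilon> < \<epsilon>\<^sub>0 \<longrightarrow>
            (\<forall>s::real. ereal s \<ge> 2 * ereal_of_enat (s_eps \<epsilon> k) + 1 \<longrightarrow>
              (\<exists>\<epsilon>'>0. \<exists>C. \<forall>P\<ge>2.
                 (LINT \<alpha>:minor_arcs k P (P powr \<delta>)|lborel. cmod (prime_exp_sum k P \<alpha>) powr s)
                   \<le> C * P powr (s - real (exponent_sum k) - \<epsilon>')))"
  proof (rule exI[of _ "\<eta> / 2"], intro conjI allI impI)
    fix \<epsilon> s :: real
    assume \<epsilon>: "0 < \<epsilon> \<and> \<epsilon> < \<eta> / 2" and s: "ereal s \<ge> 2 * ereal_of_enat (s_eps \<epsilon> k) + 1"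
    define S where "S = {enat l | l. \<exists>C. \<forall>P\<ge>2. real (num_solutions l k P)
                        \<le> C * P powr (2 * real l - real (exponent_sum k) + \<epsilon>)}"
    have sS: "s_eps \<epsilon> k = Inf S" unfolding s_eps_def S_def ..
    \<comment> \<open>A real \<open>s\<close> cannot dominate an infinite bound, so the set of
      admissible \<open>l\<close> is nonempty and its infimum is attained.\<close>
    have "s_eps \<epsilon> k \<noteq> \<infinity>"
    proof
      assume "s_eps \<epsilon> k = \<infinity>"
      then have "2 * ereal_of_enat (s_eps \<epsilon> k) + 1 = \<infinity>" by simp
      then show False using s by simp
    qed
    then have "S \<noteq> {}" unfolding sS by (auto simp: top_enat_def)
    then have "Inf S \<in> S" unfolding Inf_enat_def by (auto intro: LeastI)
    then obtain l CJ where l: "s_eps \<epsilon> k = enat l"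
      and CJ: "\<And>P. P \<ge> 2 \<Longrightarrow> real (num_solutions l k P) \<le> CJ * P powr (2 * real l - real (exponent_sum k) + \<epsilon>)"
      unfolding sS S_def by auto
    have "ereal (2 * real l + 1) \<le> ereal s" using s unfolding l by (simp add: times_ereal.simps one_ereal_def)
    then have sl: "1 \<le> s - 2 * real l" by simp
    \<comment> \<open>Small enough that replacing \<open>ln P\<close> by \<open>P powr a / a\<close>
      in all \<open>2 * l\<close> factors costs at most \<open>P powr (\<eta> / 4)\<close>; the 1
      added to \<open>l\<close> allows \<open>l = 0\<close>.\<close>
    define a where "a = \<eta> / (8 * (real l + 1))"
    have a: "0 < a" "2 * real l * a \<le> \<eta> / 4" unfolding a_def using \<eta> by (auto simp: field_simps)
    define C where "C = B powr (s - 2 * real l) * ((1 / a) ^ (2 * l) * \<bar>CJ\<bar>)"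
    have "(LINT \<alpha>:minor_arcs k P (P powr \<delta>)|lborel. cmod (prime_exp_sum k P \<alpha>) powr s)
        \<le> C * P powr (s - real (exponent_sum k) - \<eta> / 4)" if P: "P \<ge> 2" for P
    proof -
      define W where "W = (B * P powr (1 - \<eta>)) powr (s - 2 * real l)"
      define f where "f = (\<lambda>\<alpha>. cmod (prime_exp_sum k P \<alpha>))"
      have W0: "0 \<le> W" unfolding W_def by simp
      \<comment> \<open>The comparison asks for integrability of the majorant only: a non-integrable
        left side has integral 0 by convention, which the nonnegative majorant bounds too.\<close>
      have "(LINT \<alpha>:minor_arcs k P (P powr \<delta>)|lborel. f \<alpha> powr s)
         \<le> (LINT \<alpha>|lborel. W * (indicator torus \<alpha> *\<^sub>R f \<alpha> ^ (2 * l)))"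
        unfolding set_lebesgue_integral_def
      proof (rule integral_mono')
        show "integrable lborel (\<lambda>\<alpha>. W * (indicator torus \<alpha> *\<^sub>R f \<alpha> ^ (2 * l)))"
          unfolding f_def by (intro integrable_mult_right prime_mean_value(1)[OF P])
        fix \<alpha> :: "real^'t"
        show "0 \<le> W * (indicator torus \<alpha> *\<^sub>R f \<alpha> ^ (2 * l))" using W0 unfolding f_def by (simp add: indicator_def)
        show "indicator (minor_arcs k P (P powr \<delta>)) \<alpha> *\<^sub>R f \<alpha> powr s \<le> W * (indicator torus \<alpha> *\<^sub>R f \<alpha> ^ (2 * l))"
        proof (cases "\<alpha> \<in> minor_arcs k P (P powr \<delta>)")
          case False
          then show ?thesis using \<open>0 \<le> W * _\<close> by simp
        next
          case True
          then have tor: "\<alpha> \<in> torus" unfolding minor_arcs_def by simp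
          have f0: "0 \<le> f \<alpha>" unfolding f_def by simp
          have "f \<alpha> powr s \<le> W * f \<alpha> ^ (2 * l)"
          \<comment> \<open>At 0 the two kinds of powers differ, \<open>0 powr 0\<close> being 0 and
            \<open>0 ^ 0\<close> being 1, so the factorisation is done for positive
            \<open>f \<alpha>\<close>.\<close>
          proof (cases "f \<alpha> = 0")
            case True
            then show ?thesis using W0 by simp
          next
            case False
            then have fp: "0 < f \<alpha>" using f0 by simp
            have "f \<alpha> powr s = f \<alpha> powr (s - 2 * real l) * f \<alpha> powr real (2 * l)" by (simp flip: powr_add)
            also have "f \<alpha> powr real (2 * l) = f \<alpha> ^ (2 * l)" using fp by (rule powr_realpow)
            also have "f \<alpha> powr (s - 2 * real l) * f \<alpha> ^ (2 * l) \<le> W * f \<alpha> ^ (2 * l)"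
              unfolding W_def using minor[OF P True] f0 sl
              by (intro mult_right_mono powr_mono2) (auto simp: f_def)
            finally show ?thesis .
          qed
          then show ?thesis using True tor by simp
        qed
      qed
      also have "\<dots> = W * (LINT \<alpha>|lborel. indicator torus \<alpha> *\<^sub>R f \<alpha> ^ (2 * l))"
        by (rule integral_mult_right_zero)
      also have "\<dots> \<le> W * (ln P ^ (2 * l) * real (num_solutions l k P))"
        using prime_mean_value(2)[OF P, of k l] W0 unfolding f_def by (intro mult_left_mono) auto
      also have "\<dots> \<le> W * ((P powr a / a) ^ (2 * l) * (\<bar>CJ\<bar> * P powr (2 * real l - real (exponent_sum k) + \<epsilon>)))"
      proof (intro mult_left_mono mult_mono power_mono)
        show "ln P \<le> P powr a / a" using P a by (intro ln_powr_bound) auto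
        have "CJ * P powr (2 * real l - real (exponent_sum k) + \<epsilon>) \<le> \<bar>CJ\<bar> * P powr (2 * real l - real (exponent_sum k) + \<epsilon>)"
          by (intro mult_right_mono) auto
        then show "real (num_solutions l k P) \<le> \<bar>CJ\<bar> * P powr (2 * real l - real (exponent_sum k) + \<epsilon>)"
          using CJ[OF P] by linarith
      qed (use P W0 a in auto)
      also have "\<dots> = C * P powr ((1 - \<eta>) * (s - 2 * real l) + (2 * real l * a) + (2 * real l - real (exponent_sum k) + \<epsilon>))"
      proof -
        have "W = B powr (s - 2 * real l) * P powr ((1 - \<eta>) * (s - 2 * real l))"
          unfolding W_def using B P by (simp add: powr_mult powr_powr)
        moreover have "(P powr a / a) ^ (2 * l) = (1 / a) ^ (2 * l) * P powr (2 * real l * a)"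
          using P by (simp add: power_divide powr_powr powr_realpow[symmetric] mult.commute mult.left_commute)
        ultimately show ?thesis unfolding C_def by (simp add: powr_add)
      qed
      also have "\<dots> \<le> C * P powr (s - real (exponent_sum k) - \<eta> / 4)"
      proof (intro mult_left_mono powr_mono)
        have "\<eta> * 1 \<le> \<eta> * (s - 2 * real l)" using \<eta> sl by (intro mult_left_mono) auto
        then show "(1 - \<eta>) * (s - 2 * real l) + (2 * real l * a) + (2 * real l - real (exponent_sum k) + \<epsilon>) \<le> s - real (exponent_sum k) - \<eta> / 4"
          using a \<epsilon> by (simp add: algebra_simps)
        show "0 \<le> C" unfolding C_def using a by simp
      qed (use P in auto)
      finally show ?thesis unfolding f_def .
    qed
    then show "\<exists>\<epsilon>'>0. \<exists>C. \<forall>P\<ge>2.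
                 (LINT \<alpha>:minor_arcs k P (P powr \<delta>)|lborel. cmod (prime_exp_sum k P \<alpha>) powr s)
                   \<le> C * P powr (s - real (exponent_sum k) - \<epsilon>')"
      using \<eta> by (intro exI[of _ "\<eta> / 4"] conjI exI[of _ C] allI impI) auto
  qed (use \<eta> in simp)
qed simp

end
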